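(* Let $\varphi$ be an analytic self-map of $\mathbb{D}$ and let $n$ be a positive integer. The operator $D_{\varphi,n}$ is compact on $H^{2}$ if and only if \[ N_{\varphi}(w)=o\Big(\big[\log(1/|w|)\big]^{2n+1}\Big)\qquad (|w|\to 1). \]
   Context: $\mathbb{D}$ is the open unit disk in $\mathbb{C}$ and $H^2$ is the Hardy space of analytic functions $f$ on $\mathbb{D}$ with $\|f\|^2=\lim_{r\to1}\frac{1}{2\pi}\int_0^{2\pi}|f(re^{i\theta})|^2\,d\theta<\infty$. For an analytic self-map $\varphi$ of $\mathbb{D}$ and a positive integer $n$, $D_{\varphi,n}$ is the operator $D_{\varphi,n}f=f^{(n)}\circ\varphi$. The Nevanlinna counting function is $N_{\varphi}(w)=\sum_{z\in\mathbb{D},\,\varphi(z)=w}\log(1/|z|)$ for $w\in\mathbb{D}\setminus\{\varphi(0)\}$ (multiplicities counted; $N_\varphi(w)=0$ if $w\notin\varphi(\mathbb{D})$), and $N_\varphi(\varphi(0))=\infty$. *)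

theory Defs
  imports "HOL-Complex_Analysis.Complex_Analysis"
begin

definition hardy_mean :: "(complex \<Rightarrow> complex) \<Rightarrow> real \<Rightarrow> real" where
  "hardy_mean f r = (1 / (2 * pi)) * integral {0..2*pi} (\<lambda>\<theta>. (cmod (f (of_real r * cis \<theta>)))\<^sup>2)"

definition in_H2 :: "(complex \<Rightarrow> complex) \<Rightarrow> bool" where
  "in_H2 f \<longleftrightarrow> f holomorphic_on ball 0 1 \<and> (\<exists>L. (hardy_mean f \<longlongrightarrow> L) (at_left 1))"

definition H2_norm :: "(complex \<Rightarrow> complex) \<Rightarrow> real" where
  "H2_norm f = sqrt (Lim (at_left 1) (hardy_mean f))"

definition D_op :: "(complex \<Rightarrow> complex) \<Rightarrow> nat \<Rightarrow> (complex \<Rightarrow> complex) \<Rightarrow> (complex \<Rightarrow> complex)" where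
  "D_op \<phi> n f = (\<lambda>z. (deriv ^^ n) f (\<phi> z))"

definition compact_on_H2 :: "((complex \<Rightarrow> complex) \<Rightarrow> (complex \<Rightarrow> complex)) \<Rightarrow> bool" where
  "compact_on_H2 T \<longleftrightarrow>
     (\<forall>f. in_H2 f \<longrightarrow> in_H2 (T f)) \<and>
     (\<forall>fs :: nat \<Rightarrow> complex \<Rightarrow> complex. (\<forall>k. in_H2 (fs k)) \<and> bounded (range (\<lambda>k. H2_norm (fs k))) \<longrightarrow>
        (\<exists>r g. strict_mono r \<and> in_H2 g \<and>
               (\<lambda>k. H2_norm (\<lambda>z. T (fs (r k)) z - g z)) \<longlonglongrightarrow> 0))"

definition nevanlinna :: "(complex \<Rightarrow> complex) \<Rightarrow> complex \<Rightarrow> ennreal" where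
  "nevanlinna \<phi> w =
     (if w = \<phi> 0 then \<infinity>
      else (\<Sum>\<^sub>\<infinity> z \<in> {z \<in> ball 0 1. \<phi> z = w}.
              ennreal (of_int (zorder (\<lambda>x. \<phi> x - w) z) * ln (1 / cmod z))))"

end

(* Necessity. Apply the operator to the normalized Szego kernel k_a. The function D k_a takes the
   single value c, with |c|^2 comparable to (1-|a|)^(-2n-1), on the whole fibre of phi over a, so
   D k_a - c is divisible by the Blaschke product B of that fibre, and therefore
   ||D k_a||^2 >= |c|^2 (1-|B(0)|^2). Since |B(0)| = exp(-N(a)) and compactness forces D k_a -> 0 as
   |a| -> 1, the required decay of N follows.

   Sufficiency. Jensen's inequality along phi, averaged over the part in the disk of a circle of
   radius s about a boundary point b, shows that the set where |phi - b| < s/2 has measure at most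
   a constant times the supremum of N on that circle, that is o(s^(2n+1)), uniformly over the
   circles |z| = r < 1. A dyadic decomposition into the layers 1-|phi| ~ 2^-j, with a weighted
   Cauchy formula on circles of radius 1-2^-j/4, turns this into a vanishing Carleson embedding for
   n-th derivatives; Parseval's identity sums the layers. Montel's theorem then gives compactness. *)

theory Submission
  imports Defs
begin

text \<open>Why the powers match: for 1 - |z| about h, the value |F(z)|^2 is at most about 1/h times
  the mean of |F|^2 on a nearby circle, while balls of radius h at the boundary carry mass
  o(h^(2n+1)). The product o(h^(2n)) is the weight in the discrete Littlewood-Paley inequality sum_j
  2^(-2nj) * (mean of |f^(n)|^2 on |z| = 1 - 2^(-j)/4) <= C ||f||^2. On the other side, 2n+1 is the
  order of growth of the squared n-th derivative of the normalized kernel at a. The obstacle is that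
  the decay of the counting function is known only pointwise and only near the boundary. Averaging
  over a whole circle about b costs nothing, since values outside the disk have empty fibres. All
  estimates live on circles |z| = r < 1 with constants independent of r, and each fibre is cut down
  to finite subsets, so every Blaschke product is finite.\<close>

section \<open>Circle means and Parseval's identity\<close>

text \<open>Normalized arc length, written as a density on the whole line: its sets are then all
  Borel sets, and continuity on \<open>UNIV\<close> settles measurability and integrability at
  once.\<close>

definition circ :: "real measure" where
  "circ = density lborel (\<lambda>t. ennreal (indicator {0..2*pi} t / (2*pi)))"

lemma sets_circ [simp, measurable_cong]: "sets circ = sets borel"
  by (simp add: circ_def)

lemma space_circ [simp]: "space circ = UNIV"
  by (simp add: circ_def)

lemma emeasure_circ_UNIV: "emeasure circ UNIV = 1"
proof -
  have "emeasure circ UNIV = (\<integral>\<^sup>+t. ennreal (1/(2*pi)) * indicator {0..2*pi} t \<partial>lborel)"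
    unfolding circ_def
    by (subst emeasure_density) (auto intro!: nn_integral_cong split: split_indicator)
  also have "\<dots> = ennreal (1/(2*pi)) * ennreal (2*pi)"
    by (subst nn_integral_cmult_indicator) auto
  also have "\<dots> = 1"
    by (subst ennreal_mult[symmetric]) (auto simp: ennreal_1)
  finally show ?thesis .
qed

lemma finite_measure_circ: "finite_measure circ"
  by (rule finite_measureI) (simp add: emeasure_circ_UNIV)

lemma sigma_finite_circ: "sigma_finite_measure circ"
  by (rule finite_measure.axioms(1)[OF finite_measure_circ])

lemma measure_circ_UNIV: "measure circ UNIV = 1"
  by (simp add: measure_def emeasure_circ_UNIV)

lemma circ_integral:
  fixes g :: "real \<Rightarrow> 'a :: euclidean_space"
  assumes "continuous_on UNIV g"
  shows "integrable circ g"
    and "integral\<^sup>L circ g = (1 / (2*pi)) *\<^sub>R integral {0..2*pi} g"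
proof -
  have m: "g \<in> borel_measurable borel"
    using assms by (rule borel_measurable_continuous_onI)
  have i: "set_integrable lborel {0..2*pi} g"
    by (rule borel_integrable_atLeastAtMost')
       (use assms continuous_on_subset in blast)
  have e: "(indicator {0..2*pi} t / (2*pi)) *\<^sub>R g t = (1/(2*pi)) *\<^sub>R (indicator {0..2*pi} t *\<^sub>R g t)" for t
    by simp
  have "integrable lborel (\<lambda>t. (indicator {0..2*pi} t / (2*pi)) *\<^sub>R g t)"
    unfolding e by (intro integrable_scaleR_right) (use i in \<open>simp add: set_integrable_def\<close>)
  thus "integrable circ g"
    unfolding circ_def using m by (subst integrable_density) (auto intro!: AE_I2)
  have "integral\<^sup>L circ g = (\<integral>t. (1/(2*pi)) *\<^sub>R (indicator {0..2*pi} t *\<^sub>R g t) \<partial>lborel)"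
    unfolding circ_def using m
    by (subst integral_density) (auto intro!: AE_I2 simp: e[symmetric] simp del: scaleR_scaleR)
  also have "\<dots> = (1/(2*pi)) *\<^sub>R (LINT t:{0..2*pi}|lborel. g t)"
    unfolding set_lebesgue_integral_def by (rule integral_scaleR_right)
  also have "(LINT t:{0..2*pi}|lborel. g t) = integral {0..2*pi} g"
    by (rule set_borel_integral_eq_integral(2)[OF i])
  finally show "integral\<^sup>L circ g = (1 / (2*pi)) *\<^sub>R integral {0..2*pi} g" .
qed

lemma continuous_on_circle:
  assumes "F holomorphic_on ball 0 R" "0 \<le> r" "r < R"
  shows "continuous_on UNIV (\<lambda>t. F (of_real r * cis t))"
  by (rule continuous_on_compose2[OF holomorphic_on_imp_continuous_on[OF assms(1)]])
     (use assms in \<open>auto intro!: continuous_intros simp: norm_mult\<close>)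

lemma hardy_mean_eq:
  assumes "f holomorphic_on ball 0 1" "0 \<le> r" "r < 1"
  shows "hardy_mean f r = (\<integral>t. (cmod (f (of_real r * cis t)))\<^sup>2 \<partial>circ)"
proof -
  have "continuous_on UNIV (\<lambda>t. (cmod (f (of_real r * cis t)))\<^sup>2)"
    by (intro continuous_intros continuous_on_circle[OF assms])
  from circ_integral(2)[OF this] show ?thesis
    by (simp add: hardy_mean_def)
qed

text \<open>With dz = i z dt the contour integral becomes a mean, which puts the extra factor
  \<open>r * cis t\<close> into the numerator.\<close>

lemma circ_Cauchy_higher:
  fixes r :: real
  assumes "F holomorphic_on ball 0 R" "0 < r" "r < R" "cmod w < r"
  shows "(\<integral>t. F (r * cis t) * (r * cis t) / (r * cis t - w) ^ Suc k \<partial>circ) = (deriv ^^ k) F w / fact k"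
proof -
  have sub: "cball 0 r \<subseteq> ball (0::complex) R" using assms by auto
  have cF: "continuous_on (ball 0 R) F"
    by (rule holomorphic_on_imp_continuous_on) fact
  have nz: "of_real r * cis t - w \<noteq> 0" for t
    using assms by (auto simp: norm_mult dest!: arg_cong[of _ _ cmod])
  have "((\<lambda>u. F u / (u-w) ^ (Suc k)) has_contour_integral ((2 * pi * \<i>) / (fact k) * (deriv ^^ k) F w))
           (circlepath 0 r)"
    by (rule Cauchy_has_contour_integral_higher_derivative_circlepath)
       (use assms sub in \<open>auto intro: continuous_on_subset[OF cF] holomorphic_on_subset[OF assms(1)]\<close>)
  hence "((\<lambda>t. F (r * cis t) / (r * cis t - w) ^ Suc k * r * \<i> * cis t) has_integral
           (2 * pi * \<i>) / (fact k) * (deriv ^^ k) F w) {0..2*pi}"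
    unfolding circlepath_def by (subst (asm) has_contour_integral_part_circlepath_iff) auto
  hence "((\<lambda>t. (- \<i>) * (F (r * cis t) / (r * cis t - w) ^ Suc k * r * \<i> * cis t)) has_integral
           (- \<i>) * ((2 * pi * \<i>) / (fact k) * (deriv ^^ k) F w)) {0..2*pi}"
    by (rule has_integral_mult_right)
  hence i: "((\<lambda>t. F (r * cis t) * (r * cis t) / (r * cis t - w) ^ Suc k) has_integral
           (2 * pi) / (fact k) * (deriv ^^ k) F w) {0..2*pi}"
    by (simp add: mult_ac)
  have "continuous_on UNIV (\<lambda>t. F (r * cis t) * (r * cis t) / (r * cis t - w) ^ Suc k)"
    using nz by (intro continuous_intros continuous_on_circle[OF assms(1)]) (use assms in auto)
  from circ_integral(2)[OF this] show ?thesis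
    unfolding integral_unique[OF i] by (simp add: scaleR_conv_of_real)
qed

lemma circ_mean_value:
  fixes r :: real
  assumes "F holomorphic_on ball 0 R" "0 \<le> r" "r < R"
  shows "(\<integral>t. F (r * cis t) \<partial>circ) = F 0"
proof (cases "r = 0")
  case True
  thus ?thesis by (simp add: measure_circ_UNIV)
next
  case False
  thus ?thesis using circ_Cauchy_higher[of F R r 0 0] assms by simp
qed

definition taylor_coeff :: "(complex \<Rightarrow> complex) \<Rightarrow> nat \<Rightarrow> complex" where
  "taylor_coeff f k = (deriv ^^ k) f 0 / fact k"

lemma taylor_coeff_sums:
  assumes "f holomorphic_on ball 0 1" "cmod z < 1"
  shows "(\<lambda>k. taylor_coeff f k * z ^ k) sums f z"
  using holomorphic_power_series[OF assms(1), of z] assms(2)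
  by (simp add: taylor_coeff_def)

lemma taylor_coeff_abs_summable:
  fixes r :: real
  assumes "f holomorphic_on ball 0 1" "0 \<le> r" "r < 1"
  shows "summable (\<lambda>k. cmod (taylor_coeff f k) * r ^ k)"
proof -
  obtain s where s: "r < s" "s < 1" using assms(3) dense by blast
  have "summable (\<lambda>k. taylor_coeff f k * of_real s ^ k)"
    using taylor_coeff_sums[OF assms(1), of "of_real s"] s assms by (auto simp: sums_iff)
  from powser_insidea[OF this, of "of_real r"] s assms show ?thesis
    by (simp add: norm_mult norm_power)
qed

lemma circ_coefficient:
  fixes r :: real
  assumes "f holomorphic_on ball 0 1" "0 < r" "r < 1"
  shows "(\<integral>t. f (r * cis t) * cnj ((r * cis t) ^ k) \<partial>circ) = taylor_coeff f k * r ^ (2*k)"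
proof -
  \<comment> \<open>On the circle cnj (z^k) = r^(2k) / z^k, so pairing with a monomial is Cauchy's
    formula at 0.\<close>
  have e: "f (r * cis t) * cnj ((r * cis t) ^ k) =
      r ^ (2*k) * (f (r * cis t) * (r * cis t) / (r * cis t - 0) ^ Suc k)" for t
  proof -
    have "(r * cis t) ^ k * cnj ((r * cis t) ^ k) = r ^ (2*k)"
      using assms by (subst complex_norm_square[symmetric]) (simp add: norm_mult norm_power power_even_eq)
    moreover have "(r * cis t) \<noteq> 0" using assms by simp
    ultimately show ?thesis by (simp add: field_simps)
  qed
  show ?thesis unfolding e integral_mult_right_zero
    using circ_Cauchy_higher[OF assms(1), of r 0 k] assms
    by (simp add: taylor_coeff_def)
qed

text \<open>Only one of the two factors is expanded: f is paired with the partial sums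
  \<open>S N\<close>, each term being a coefficient formula, and dominated convergence, with
  \<open>A\<close> bounding all partial sums, lets N tend to infinity. No double series
  appears.\<close>

theorem Parseval:
  assumes f: "f holomorphic_on ball 0 1" and r: "0 \<le> r" "r < 1"
  shows "(\<lambda>k. (cmod (taylor_coeff f k))\<^sup>2 * r ^ (2*k)) sums hardy_mean f r"
proof (cases "r = 0")
  case True
  have "hardy_mean f r = (cmod (f 0))\<^sup>2"
    unfolding hardy_mean_eq[OF f r] by (simp add: True measure_circ_UNIV)
  moreover have "(\<lambda>k. (cmod (taylor_coeff f k))\<^sup>2 * r ^ (2*k)) sums (\<Sum>k\<in>{0}. (cmod (taylor_coeff f k))\<^sup>2 * r ^ (2*k))"
    by (rule sums_finite) (auto simp: True)
  ultimately show ?thesis by (simp add: taylor_coeff_def)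
next
  case False
  hence r0: "r > 0" using r by simp
  define S where "S = (\<lambda>N z. \<Sum>k<N. taylor_coeff f k * z ^ k)"
  define A where "A = (\<Sum>k. cmod (taylor_coeff f k) * r ^ k)"
  have cf: "continuous_on UNIV (\<lambda>t. f (r * cis t))"
    by (rule continuous_on_circle[OF f r])
  have SA: "cmod (S N (r * cis t)) \<le> A" for N t
  proof -
    have "cmod (S N (r * cis t)) \<le> (\<Sum>k<N. cmod (taylor_coeff f k) * r ^ k)"
      unfolding S_def by (rule norm_sum[THEN order_trans]) (use r in \<open>simp add: norm_mult norm_power\<close>)
    also have "\<dots> \<le> A" unfolding A_def
      by (rule sum_le_suminf) (use r taylor_coeff_abs_summable[OF f r] in auto)
    finally show ?thesis .
  qed
  have mean: "(\<integral>t. f (r * cis t) * cnj (S N (r * cis t)) \<partial>circ) =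
      of_real (\<Sum>k<N. (cmod (taylor_coeff f k))\<^sup>2 * r ^ (2*k))" for N
  proof -
    have "(\<integral>t. f (r * cis t) * cnj (S N (r * cis t)) \<partial>circ) =
       (\<integral>t. (\<Sum>k<N. cnj (taylor_coeff f k) * (f (r * cis t) * cnj ((r * cis t) ^ k))) \<partial>circ)"
      by (simp add: S_def sum_distrib_left mult_ac)
    also have "\<dots> = (\<Sum>k<N. (\<integral>t. cnj (taylor_coeff f k) * (f (r * cis t) * cnj ((r * cis t) ^ k)) \<partial>circ))"
      by (intro Bochner_Integration.integral_sum circ_integral continuous_intros cf)
    also have "\<dots> = (\<Sum>k<N. cnj (taylor_coeff f k) * (taylor_coeff f k * r ^ (2*k)))"
      by (intro sum.cong refl) (simp only: integral_mult_right_zero circ_coefficient[OF f r0 r(2)])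
    also have "\<dots> = of_real (\<Sum>k<N. (cmod (taylor_coeff f k))\<^sup>2 * r ^ (2*k))"
      unfolding of_real_sum
    proof (intro sum.cong refl)
      fix k
      have "cnj (taylor_coeff f k) * taylor_coeff f k = of_real ((cmod (taylor_coeff f k))\<^sup>2)"
        using complex_norm_square[of "taylor_coeff f k"] by (simp add: mult_ac)
      thus "cnj (taylor_coeff f k) * (taylor_coeff f k * of_real (r ^ (2*k))) =
          of_real ((cmod (taylor_coeff f k))\<^sup>2 * r ^ (2*k))"
        by (simp add: mult.assoc[symmetric])
    qed
    finally show ?thesis .
  qed
  have lim: "(\<lambda>N. (\<integral>t. f (r * cis t) * cnj (S N (r * cis t)) \<partial>circ)) \<longlonglongrightarrow>
      (\<integral>t. f (r * cis t) * cnj (f (r * cis t)) \<partial>circ)"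
  proof (rule integral_dominated_convergence[where w = "\<lambda>t. cmod (f (r * cis t)) * A"])
    show "(\<lambda>t. f (r * cis t) * cnj (f (r * cis t))) \<in> borel_measurable circ"
      unfolding measurable_cong_sets[OF sets_circ refl]
      by (intro borel_measurable_continuous_onI continuous_intros cf)
    show "(\<lambda>t. f (r * cis t) * cnj (S N (r * cis t))) \<in> borel_measurable circ" for N
      unfolding measurable_cong_sets[OF sets_circ refl] S_def
      by (intro borel_measurable_continuous_onI continuous_intros cf)
    show "integrable circ (\<lambda>t. cmod (f (r * cis t)) * A)"
      by (intro circ_integral continuous_intros cf)
    show "AE t in circ. (\<lambda>N. f (r * cis t) * cnj (S N (r * cis t))) \<longlonglongrightarrow> f (r * cis t) * cnj (f (r * cis t))"
    proof (rule AE_I2)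
      fix t
      have "(\<lambda>N. S N (r * cis t)) \<longlonglongrightarrow> f (r * cis t)"
        using taylor_coeff_sums[OF f, of "r * cis t"] r
        by (simp add: S_def sums_def norm_mult)
      thus "(\<lambda>N. f (r * cis t) * cnj (S N (r * cis t))) \<longlonglongrightarrow> f (r * cis t) * cnj (f (r * cis t))"
        by (intro tendsto_intros)
    qed
    show "AE t in circ. cmod (f (r * cis t) * cnj (S N (r * cis t))) \<le> cmod (f (r * cis t)) * A" for N
      by (rule AE_I2) (auto simp: norm_mult intro!: mult_left_mono SA)
  qed
  have "(\<integral>t. f (r * cis t) * cnj (f (r * cis t)) \<partial>circ) = of_real (hardy_mean f r)"
    unfolding hardy_mean_eq[OF f r]
    by (simp only: complex_norm_square[symmetric] integral_complex_of_real)
  with lim show ?thesis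
    unfolding mean sums_def by (simp only: tendsto_of_real_iff)
qed

section \<open>The Hardy space\<close>

lemma hardy_mean_nonneg: "hardy_mean f r \<ge> 0"
proof (cases "(\<lambda>\<theta>. (cmod (f (of_real r * cis \<theta>)))\<^sup>2) integrable_on {0..2*pi}")
  case True
  thus ?thesis unfolding hardy_mean_def by (intro mult_nonneg_nonneg integral_nonneg) auto
next
  case False
  thus ?thesis by (simp add: hardy_mean_def not_integrable_integral)
qed

lemma in_H2_holomorphic: "in_H2 f \<Longrightarrow> f holomorphic_on ball 0 1"
  by (simp add: in_H2_def)

lemma eventually_at_left_1: "eventually (\<lambda>r. 0 < r \<and> r < (1::real)) (at_left 1)"
  unfolding eventually_at_left_field by (rule exI[of _ 0]) auto

text \<open>The bound may vary with r, so that one lemma covers both the convergent means of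
  \<open>in_H2\<close> and a constant bound.\<close>

lemma hardy_mean_bounded_sum:
  assumes f: "f holomorphic_on ball 0 1"
    and B: "eventually (\<lambda>r. hardy_mean f r \<le> B r) (at_left 1)" and L: "(B \<longlongrightarrow> L) (at_left 1)"
  shows "(\<Sum>k<N. (cmod (taylor_coeff f k))\<^sup>2) \<le> L"
proof -
  have "((\<lambda>r. \<Sum>k<N. (cmod (taylor_coeff f k))\<^sup>2 * r ^ (2*k)) \<longlongrightarrow> (\<Sum>k<N. (cmod (taylor_coeff f k))\<^sup>2 * 1 ^ (2*k))) (at_left 1)"
    by (intro tendsto_intros)
  moreover have "eventually (\<lambda>r. (\<Sum>k<N. (cmod (taylor_coeff f k))\<^sup>2 * r ^ (2*k)) \<le> B r) (at_left 1)"
    using B eventually_at_left_1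
  proof eventually_elim
    case (elim r)
    from elim have P: "(\<lambda>k. (cmod (taylor_coeff f k))\<^sup>2 * r ^ (2*k)) sums hardy_mean f r"
      by (intro Parseval f) auto
    have "(\<Sum>k<N. (cmod (taylor_coeff f k))\<^sup>2 * r ^ (2*k)) \<le> hardy_mean f r"
      unfolding sums_unique[OF P]
      by (rule sum_le_suminf) (use P in \<open>auto simp: sums_iff intro!: mult_nonneg_nonneg zero_le_even_power\<close>)
    with elim show ?case by linarith
  qed
  ultimately have "(\<Sum>k<N. (cmod (taylor_coeff f k))\<^sup>2 * 1 ^ (2*k)) \<le> L"
    by (intro tendsto_le[OF _ L]) auto
  thus ?thesis by simp
qed

lemma hardy_mean_le_suminf:
  assumes f: "f holomorphic_on ball 0 1" and s: "summable (\<lambda>k. (cmod (taylor_coeff f k))\<^sup>2)"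
    and r: "0 \<le> r" "r < 1"
  shows "hardy_mean f r \<le> (\<Sum>k. (cmod (taylor_coeff f k))\<^sup>2)"
  unfolding sums_unique[OF Parseval[OF f r]]
  by (rule suminf_le)
     (use s Parseval[OF f r] r in \<open>auto simp: sums_iff power_le_one intro!: mult_right_le_one_le\<close>)

text \<open>For the lower half, a finite section of the series already exceeds a at r = 1, hence for
  r near 1 by continuity; the upper half is a termwise comparison.\<close>

lemma hardy_mean_tendsto:
  assumes f: "f holomorphic_on ball 0 1" and s: "summable (\<lambda>k. (cmod (taylor_coeff f k))\<^sup>2)"
  shows "(hardy_mean f \<longlongrightarrow> (\<Sum>k. (cmod (taylor_coeff f k))\<^sup>2)) (at_left 1)"
proof (rule order_tendstoI)
  fix a assume "a < (\<Sum>k. (cmod (taylor_coeff f k))\<^sup>2)"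
  with s obtain N where N: "a < (\<Sum>k<N. (cmod (taylor_coeff f k))\<^sup>2)"
    using order_tendstoD(1)[OF summable_LIMSEQ[OF s]] by (auto simp: eventually_sequentially)
  have "((\<lambda>r. \<Sum>k<N. (cmod (taylor_coeff f k))\<^sup>2 * r ^ (2*k)) \<longlongrightarrow> (\<Sum>k<N. (cmod (taylor_coeff f k))\<^sup>2 * 1 ^ (2*k))) (at_left 1)"
    by (intro tendsto_intros)
  hence "eventually (\<lambda>r. a < (\<Sum>k<N. (cmod (taylor_coeff f k))\<^sup>2 * r ^ (2*k))) (at_left 1)"
    by (rule order_tendstoD) (use N in simp)
  thus "eventually (\<lambda>r. a < hardy_mean f r) (at_left 1)"
    using eventually_at_left_1
  proof eventually_elim
    case (elim r)
    from elim have P: "(\<lambda>k. (cmod (taylor_coeff f k))\<^sup>2 * r ^ (2*k)) sums hardy_mean f r"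
      by (intro Parseval f) auto
    have "(\<Sum>k<N. (cmod (taylor_coeff f k))\<^sup>2 * r ^ (2*k)) \<le> hardy_mean f r"
      unfolding sums_unique[OF P]
      by (rule sum_le_suminf) (use P in \<open>auto simp: sums_iff intro!: mult_nonneg_nonneg zero_le_even_power\<close>)
    with elim show ?case by linarith
  qed
next
  fix a assume a: "a > (\<Sum>k. (cmod (taylor_coeff f k))\<^sup>2)"
  show "eventually (\<lambda>r. hardy_mean f r < a) (at_left 1)"
    using eventually_at_left_1
  proof eventually_elim
    case (elim r)
    thus ?case using hardy_mean_le_suminf[OF f s, of r] a by simp
  qed
qed

text \<open>From here on, membership and norm are read off the Taylor coefficients.\<close>

lemma in_H2_iff:
  "in_H2 f \<longleftrightarrow> f holomorphic_on ball 0 1 \<and> summable (\<lambda>k. (cmod (taylor_coeff f k))\<^sup>2)"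
proof
  assume "in_H2 f"
  then obtain L where f: "f holomorphic_on ball 0 1" and L: "(hardy_mean f \<longlongrightarrow> L) (at_left 1)"
    by (auto simp: in_H2_def)
  have "summable (\<lambda>k. (cmod (taylor_coeff f k))\<^sup>2)"
    by (rule bounded_imp_summable[where B = L])
       (use hardy_mean_bounded_sum[OF f _ L, of "Suc n" for n] in \<open>auto simp: lessThan_Suc_atMost\<close>)
  with f show "f holomorphic_on ball 0 1 \<and> summable (\<lambda>k. (cmod (taylor_coeff f k))\<^sup>2)" by simp
qed (auto simp: in_H2_def intro: hardy_mean_tendsto)

lemma H2_norm_eq:
  assumes "in_H2 f"
  shows "H2_norm f = sqrt (\<Sum>k. (cmod (taylor_coeff f k))\<^sup>2)"
proof -
  have "Lim (at_left 1) (hardy_mean f) = (\<Sum>k. (cmod (taylor_coeff f k))\<^sup>2)"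
    by (intro tendsto_Lim hardy_mean_tendsto) (use assms in \<open>auto simp: in_H2_iff\<close>)
  thus ?thesis by (simp add: H2_norm_def)
qed

lemma H2_norm_nonneg: "in_H2 f \<Longrightarrow> H2_norm f \<ge> 0"
  by (auto simp: H2_norm_eq in_H2_iff intro!: suminf_nonneg)

lemma H2_norm_sq: "in_H2 f \<Longrightarrow> (H2_norm f)\<^sup>2 = (\<Sum>k. (cmod (taylor_coeff f k))\<^sup>2)"
  by (auto simp: H2_norm_eq in_H2_iff intro!: suminf_nonneg)

lemma hardy_mean_le_norm:
  assumes "in_H2 f" "0 \<le> r" "r < 1"
  shows "hardy_mean f r \<le> (H2_norm f)\<^sup>2"
  using hardy_mean_le_suminf[of f r] assms by (auto simp: H2_norm_sq in_H2_iff)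

text \<open>The membership test used below: a bound on the circle means that is uniform in r already
  forces their limit to exist.\<close>

lemma in_H2_bounded:
  assumes f: "f holomorphic_on ball 0 1" and "\<And>r. 0 < r \<Longrightarrow> r < 1 \<Longrightarrow> hardy_mean f r \<le> B"
  shows "in_H2 f" "(H2_norm f)\<^sup>2 \<le> B"
proof -
  have *: "(\<Sum>k<N. (cmod (taylor_coeff f k))\<^sup>2) \<le> B" for N
    by (rule hardy_mean_bounded_sum[OF f _ tendsto_const])
       (use eventually_at_left_1 assms(2) in \<open>auto elim: eventually_mono\<close>)
  have s: "summable (\<lambda>k. (cmod (taylor_coeff f k))\<^sup>2)"
    by (rule bounded_imp_summable[where B = B])
       (use *[of "Suc n" for n] in \<open>auto simp: lessThan_Suc_atMost\<close>)
  with f show 1: "in_H2 f" by (simp add: in_H2_iff)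
  show "(H2_norm f)\<^sup>2 \<le> B"
    unfolding H2_norm_sq[OF 1] by (rule suminf_le_const[OF s *])
qed

text \<open>Cauchy-Schwarz between the coefficients of f and the geometric sequence of powers of
  |z|.\<close>

lemma H2_pointwise_bound:
  assumes f: "in_H2 f" and z: "cmod z < 1"
  shows "(cmod (f z))\<^sup>2 \<le> (H2_norm f)\<^sup>2 / (1 - (cmod z)\<^sup>2)"
proof -
  have h: "f holomorphic_on ball 0 1" using f by (rule in_H2_holomorphic)
  have s: "summable (\<lambda>k. (cmod (taylor_coeff f k))\<^sup>2)" using f by (simp add: in_H2_iff)
  have z2: "(cmod z)\<^sup>2 < 1" using z by (simp add: power_less_one_iff)
  have "(cmod (\<Sum>k<N. taylor_coeff f k * z ^ k))\<^sup>2 \<le> (H2_norm f)\<^sup>2 / (1 - (cmod z)\<^sup>2)" for N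
  proof -
    have "(cmod (\<Sum>k<N. taylor_coeff f k * z ^ k))\<^sup>2 \<le> (\<Sum>k<N. cmod (taylor_coeff f k) * cmod z ^ k)\<^sup>2"
      by (intro power_mono norm_sum[THEN order_trans]) (auto simp: norm_mult norm_power)
    also have "\<dots> \<le> (\<Sum>k<N. (cmod (taylor_coeff f k))\<^sup>2) * (\<Sum>k<N. (cmod z ^ k)\<^sup>2)"
      by (rule Cauchy_Schwarz_ineq_sum)
    also have "\<dots> \<le> (H2_norm f)\<^sup>2 * (1 / (1 - (cmod z)\<^sup>2))"
    proof (intro mult_mono)
      show "(\<Sum>k<N. (cmod (taylor_coeff f k))\<^sup>2) \<le> (H2_norm f)\<^sup>2"
        unfolding H2_norm_sq[OF f] by (rule sum_le_suminf) (use s in auto)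
      have "(\<lambda>k. ((cmod z)\<^sup>2) ^ k) sums (1 / (1 - (cmod z)\<^sup>2))"
        by (rule geometric_sums) (use z2 in simp)
      moreover have "((cmod z)\<^sup>2) ^ k = (cmod z ^ k)\<^sup>2" for k
        by (simp add: power_mult[symmetric] mult.commute)
      ultimately have "(\<lambda>k. (cmod z ^ k)\<^sup>2) sums (1 / (1 - (cmod z)\<^sup>2))" by simp
      thus "(\<Sum>k<N. (cmod z ^ k)\<^sup>2) \<le> 1 / (1 - (cmod z)\<^sup>2)"
        using sum_le_suminf[of "\<lambda>k. (cmod z ^ k)\<^sup>2" "{..<N}"] by (auto simp: sums_iff)
    qed (auto intro!: sum_nonneg)
    finally show ?thesis by simp
  qed
  moreover have "(\<lambda>N. (cmod (\<Sum>k<N. taylor_coeff f k * z ^ k))\<^sup>2) \<longlonglongrightarrow> (cmod (f z))\<^sup>2"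
    using taylor_coeff_sums[OF h z] unfolding sums_def by (intro tendsto_intros)
  ultimately show ?thesis
    by (intro LIMSEQ_le_const2) auto
qed

text \<open>Crude but sufficient: the factor 2 comes from (x + y)^2 <= 2 x^2 + 2 y^2, applied
  pointwise on each circle.\<close>

lemma H2_diff:
  assumes "in_H2 f" "in_H2 g"
  shows "in_H2 (\<lambda>z. f z - g z)" "(H2_norm (\<lambda>z. f z - g z))\<^sup>2 \<le> 2 * (H2_norm f)\<^sup>2 + 2 * (H2_norm g)\<^sup>2"
proof -
  have h: "f holomorphic_on ball 0 1" "g holomorphic_on ball 0 1"
    using assms by (auto intro: in_H2_holomorphic)
  have hd: "(\<lambda>z. f z - g z) holomorphic_on ball 0 1" by (intro holomorphic_intros h)
  have "hardy_mean (\<lambda>z. f z - g z) r \<le> 2 * (H2_norm f)\<^sup>2 + 2 * (H2_norm g)\<^sup>2"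
    if r: "0 < r" "r < 1" for r
  proof -
    have c: "continuous_on UNIV (\<lambda>t. f (r * cis t))" "continuous_on UNIV (\<lambda>t. g (r * cis t))"
      using r by (auto intro!: continuous_on_circle[OF h(1)] continuous_on_circle[OF h(2)])
    have "hardy_mean (\<lambda>z. f z - g z) r \<le>
        (\<integral>t. 2 * (cmod (f (r * cis t)))\<^sup>2 + 2 * (cmod (g (r * cis t)))\<^sup>2 \<partial>circ)"
      unfolding hardy_mean_eq[OF hd less_imp_le[OF r(1)] r(2)]
    proof (rule integral_mono)
      fix t
      have "(cmod (f (r * cis t) - g (r * cis t)))\<^sup>2 \<le> (cmod (f (r * cis t)) + cmod (g (r * cis t)))\<^sup>2"
        by (intro power_mono norm_triangle_ineq4) auto
      also have "\<dots> \<le> 2 * (cmod (f (r * cis t)))\<^sup>2 + 2 * (cmod (g (r * cis t)))\<^sup>2"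
        using sum_squares_bound[of "cmod (f (r * cis t))" "cmod (g (r * cis t))"]
        by (simp add: power2_sum)
      finally show "(cmod (f (r * cis t) - g (r * cis t)))\<^sup>2 \<le> 2 * (cmod (f (r * cis t)))\<^sup>2 + 2 * (cmod (g (r * cis t)))\<^sup>2" .
    qed (intro circ_integral continuous_intros c)+
    also have "\<dots> = 2 * hardy_mean f r + 2 * hardy_mean g r"
      using r by (subst Bochner_Integration.integral_add)
         (auto intro!: circ_integral continuous_intros c simp: hardy_mean_eq h)
    also have "\<dots> \<le> 2 * (H2_norm f)\<^sup>2 + 2 * (H2_norm g)\<^sup>2"
      using hardy_mean_le_norm[of f r] hardy_mean_le_norm[of g r] assms r by simp
    finally show ?thesis .
  qed
  from in_H2_bounded[OF hd this]
  show "in_H2 (\<lambda>z. f z - g z)" "(H2_norm (\<lambda>z. f z - g z))\<^sup>2 \<le> 2 * (H2_norm f)\<^sup>2 + 2 * (H2_norm g)\<^sup>2"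
    by auto
qed

section \<open>Zeros and Blaschke products\<close>

text \<open>Z may miss zeros of f: for necessity it is a finite piece of a fibre, while for Jensen's
  inequality it holds all zeros in a smaller closed disk. The last conclusion serves the second use,
  where it makes h zero-free on that disk.\<close>

lemma factor_out_zeros:
  assumes f: "f holomorphic_on S" and S: "open S" "connected S" and nz: "\<exists>z\<in>S. f z \<noteq> 0"
    and Z: "finite Z" "Z \<subseteq> S"
  obtains h where "h holomorphic_on S"
    "\<And>z. z \<in> S \<Longrightarrow> f z = h z * (\<Prod>\<zeta>\<in>Z. (z - \<zeta>) ^ nat (zorder f \<zeta>))"
    "\<And>z. z \<in> S \<Longrightarrow> f z \<noteq> 0 \<or> z \<in> Z \<Longrightarrow> h z \<noteq> 0"
proof -
  define m where "m = (\<lambda>\<zeta>. nat (zorder f \<zeta>))"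
  define P where "P = (\<lambda>Y z. \<Prod>\<zeta>\<in>Y. (z - \<zeta>) ^ m \<zeta>)"
  \<comment> \<open>At a zero in Z the plain quotient would be 0/0; \<open>zor_poly\<close> supplies
    the value that makes h holomorphic there.\<close>
  define h where "h = (\<lambda>z. if z \<in> Z then zor_poly f z z / P (Z - {z}) z else f z / P Z z)"
  have P0: "P Y z \<noteq> 0" if "z \<notin> Y" "finite Y" for Y z
    using that by (auto simp: P_def)
  have Pholo: "P Y holomorphic_on A" for Y A
    unfolding P_def by (intro holomorphic_intros)
  have loc: "\<exists>r>0. ball z0 r \<subseteq> S \<and> zor_poly f z0 holomorphic_on ball z0 r \<and> zor_poly f z0 z0 \<noteq> 0 \<and>
      (\<forall>w\<in>ball z0 r. f w = zor_poly f z0 w * (w - z0) ^ m z0)" if z0: "z0 \<in> S" for z0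
  proof -
    obtain r where "r > 0" "cball z0 r \<subseteq> S" "zor_poly f z0 holomorphic_on cball z0 r"
      "\<forall>w\<in>cball z0 r. f w = zor_poly f z0 w * (w - z0) ^ nat (zorder f z0) \<and> zor_poly f z0 w \<noteq> 0"
      using zorder_exist_zero[OF f S z0 nz] by blast
    thus ?thesis unfolding m_def
      by (intro exI[of _ r]) (auto intro: holomorphic_on_subset)
  qed
  have "h field_differentiable (at z0)" if z0: "z0 \<in> S" for z0
  proof (cases "z0 \<in> Z")
    case True
    obtain r where r: "r > 0" "ball z0 r \<subseteq> S" "zor_poly f z0 holomorphic_on ball z0 r"
      "\<And>w. w\<in>ball z0 r \<Longrightarrow> f w = zor_poly f z0 w * (w - z0) ^ m z0"
      using loc[OF z0] by blast
    define U where "U = ball z0 r - (Z - {z0})"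
    have U: "open U" "z0 \<in> U"
      unfolding U_def using r(1) Z(1) by (auto intro!: open_Diff finite_imp_closed)
    have hU: "h w = zor_poly f z0 w / P (Z - {z0}) w" if w: "w \<in> U" for w
    proof (cases "w = z0")
      case False
      hence "w \<notin> Z" using w by (auto simp: U_def)
      moreover have "P Z w = (w - z0) ^ m z0 * P (Z - {z0}) w"
        unfolding P_def using Z(1) True by (subst prod.remove[of _ z0]) auto
      ultimately show ?thesis using r(4)[of w] w False
        by (auto simp: h_def U_def)
    qed (use True in \<open>simp add: h_def\<close>)
    have "(\<lambda>w. zor_poly f z0 w / P (Z - {z0}) w) holomorphic_on U"
      by (intro holomorphic_intros Pholo holomorphic_on_subset[OF r(3)] P0)
         (use Z in \<open>auto simp: U_def\<close>)
    hence "h holomorphic_on U" by (rule holomorphic_transform) (simp add: hU)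
    thus ?thesis using U holomorphic_on_imp_differentiable_at by blast
  next
    case False
    define U where "U = S - Z"
    have U: "open U" "z0 \<in> U"
      unfolding U_def using S Z False z0 by (auto intro!: open_Diff finite_imp_closed)
    have "(\<lambda>w. f w / P Z w) holomorphic_on U"
      by (intro holomorphic_intros Pholo holomorphic_on_subset[OF f] P0)
         (use Z in \<open>auto simp: U_def\<close>)
    hence "h holomorphic_on U" by (rule holomorphic_transform) (auto simp: h_def U_def)
    thus ?thesis using U holomorphic_on_imp_differentiable_at by blast
  qed
  hence "h holomorphic_on S"
    by (simp add: holomorphic_on_def field_differentiable_at_within)
  moreover have "f z = h z * P Z z" if z: "z \<in> S" for z
  proof (cases "z \<in> Z")
    case True
    obtain r where r: "r > 0" "\<And>w. w\<in>ball z r \<Longrightarrow> f w = zor_poly f z w * (w - z) ^ m z"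
      using loc[OF z] by blast
    have "P Z z = (z - z) ^ m z * P (Z - {z}) z"
      unfolding P_def using Z(1) True by (subst prod.remove[of _ z]) auto
    thus ?thesis using r(2)[of z] r(1) P0[of z "Z - {z}"] Z True by (simp add: h_def)
  qed (use P0[of z Z] Z in \<open>simp add: h_def\<close>)
  moreover have "h z \<noteq> 0" if z: "z \<in> S" "f z \<noteq> 0 \<or> z \<in> Z" for z
    using loc[OF z(1)] P0[of z Z] P0[of z "Z - {z}"] z Z by (auto simp: h_def)
  ultimately show ?thesis
    by (intro that[of h]) (auto simp: P_def m_def)
qed

section \<open>Lower norm bounds from finite Blaschke products\<close>

lemma cmod_blaschke_factor:
  fixes r :: real and z \<zeta> :: complex
  assumes "cmod z = r" "cmod \<zeta> < r"
  shows "cmod (r * (z - \<zeta>)) = cmod (of_real (r\<^sup>2) - cnj \<zeta> * z)" "of_real (r\<^sup>2) - cnj \<zeta> * z \<noteq> 0"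
proof -
  have r: "r > 0" using assms norm_ge_zero[of \<zeta>] by linarith
  \<comment> \<open>On |z| = r one has r^2 = z * cnj z.\<close>
  have "of_real (r\<^sup>2) - cnj \<zeta> * z = z * cnj (z - \<zeta>)"
    using complex_norm_square[of z] assms(1) by (simp add: algebra_simps)
  hence "cmod (of_real (r\<^sup>2) - cnj \<zeta> * z) = cmod z * cmod (z - \<zeta>)"
    by (simp only: norm_mult complex_mod_cnj)
  thus 1: "cmod (r * (z - \<zeta>)) = cmod (of_real (r\<^sup>2) - cnj \<zeta> * z)"
    using r assms by (simp add: norm_mult)
  have "z \<noteq> \<zeta>" using assms by auto
  hence "cmod (r * (z - \<zeta>)) \<noteq> 0" using r by simp
  thus "of_real (r\<^sup>2) - cnj \<zeta> * z \<noteq> 0" using 1 by auto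
qed

text \<open>With \<open>B\<close> the Blaschke product of the circle of radius \<open>r\<close> and \<open>b = B 0\<close>, the bound is the
  expansion of \<open>\<bar>g - c (1 - cnj b B)\<bar>\<^sup>2 \<ge> 0\<close> on the circle, where \<open>\<bar>B\<bar> = 1\<close>.\<close>

lemma hardy_mean_ge_blaschke:
  assumes g: "g holomorphic_on ball 0 1" and h: "h holomorphic_on ball 0 1"
    and Z: "finite Z" "\<And>\<zeta>. \<zeta> \<in> Z \<Longrightarrow> cmod \<zeta> < r" and r: "0 < r" "r < 1"
    and gh: "\<And>z. cmod z < 1 \<Longrightarrow> g z = c + h z * (\<Prod>\<zeta>\<in>Z. (z - \<zeta>) ^ m \<zeta>)"
  shows "(cmod c)\<^sup>2 * (1 - (\<Prod>\<zeta>\<in>Z. (cmod \<zeta> / r) ^ (2 * m \<zeta>))) \<le> hardy_mean g r"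
proof -
  \<comment> \<open>The factors that turn each z - \<zeta> into a Blaschke factor of the circle |z|
    = r are moved into h, so that g = c + B * h1.\<close>
  define h1 where "h1 = (\<lambda>z. h z * (\<Prod>\<zeta>\<in>Z. ((of_real (r\<^sup>2) - cnj \<zeta> * z) / r) ^ m \<zeta>))"
  define B where "B = (\<lambda>z. \<Prod>\<zeta>\<in>Z. (r * (z - \<zeta>) / (of_real (r\<^sup>2) - cnj \<zeta> * z)) ^ m \<zeta>)"
  define b where "b = B 0"
  have h1: "h1 holomorphic_on ball 0 1"
    unfolding h1_def by (intro holomorphic_intros h) (use r in auto)
  have Bh: "g z = c + B z * h1 z" if z: "cmod z < 1" "\<And>\<zeta>. \<zeta> \<in> Z \<Longrightarrow> of_real (r\<^sup>2) - cnj \<zeta> * z \<noteq> 0" for z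
  proof -
    have "B z * h1 z = h z * (\<Prod>\<zeta>\<in>Z. (r * (z - \<zeta>) / (of_real (r\<^sup>2) - cnj \<zeta> * z)) ^ m \<zeta> * ((of_real (r\<^sup>2) - cnj \<zeta> * z) / r) ^ m \<zeta>)"
      by (simp add: B_def h1_def prod.distrib)
    also have "(\<Prod>\<zeta>\<in>Z. (r * (z - \<zeta>) / (of_real (r\<^sup>2) - cnj \<zeta> * z)) ^ m \<zeta> * ((of_real (r\<^sup>2) - cnj \<zeta> * z) / r) ^ m \<zeta>) =
        (\<Prod>\<zeta>\<in>Z. (z - \<zeta>) ^ m \<zeta>)"
      unfolding power_mult_distrib[symmetric]
      by (intro prod.cong refl arg_cong2[of _ _ _ _ "(^)"]) (use z(2) r in auto)
    finally show ?thesis using gh[OF z(1)] by simp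
  qed
  have B1: "cmod (B (r * cis t)) = 1" for t
  proof -
    have "cmod (r * (r * cis t - \<zeta>) / (of_real (r\<^sup>2) - cnj \<zeta> * (r * cis t))) = 1" if "\<zeta> \<in> Z" for \<zeta>
      using cmod_blaschke_factor[of "r * cis t" r \<zeta>] Z(2)[OF that] r
      by (simp only: norm_divide) (simp add: norm_mult)
    thus ?thesis unfolding B_def
      by (simp only: prod_norm[symmetric] norm_power) simp
  qed
  have bn: "(cmod b)\<^sup>2 = (\<Prod>\<zeta>\<in>Z. (cmod \<zeta> / r) ^ (2 * m \<zeta>))"
  proof -
    have "cmod b = (\<Prod>\<zeta>\<in>Z. (cmod \<zeta> / r) ^ m \<zeta>)"
      unfolding b_def B_def prod_norm[symmetric]
      by (intro prod.cong refl) (use r in \<open>simp add: norm_power norm_divide norm_mult power2_eq_square\<close>)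
    thus ?thesis
      by (simp only: prod_power_distrib power_mult[symmetric] mult.commute)
  qed
  \<comment> \<open>The cross term of the expansion, after |B| = 1 has been used, is twice the real
    part of this holomorphic function. It vanishes at 0 because b = B 0, so it disappears on
    averaging.\<close>
  define E where "E = (\<lambda>z. cnj c * (g z - c - b * h1 z))"
  have Eh: "E holomorphic_on ball 0 1" unfolding E_def by (intro holomorphic_intros g h1)
  have E0: "E 0 = 0" using Bh[of 0] r by (simp add: E_def b_def)
  have pw: "(cmod c)\<^sup>2 * (1 - (cmod b)\<^sup>2) + 2 * Re (E (r * cis t)) \<le> (cmod (g (r * cis t)))\<^sup>2" for t
  proof -
    define z where "z = of_real r * cis t"
    have nz: "of_real (r\<^sup>2) - cnj \<zeta> * z \<noteq> 0" if "\<zeta> \<in> Z" for \<zeta>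
      using cmod_blaschke_factor(2)[of z r \<zeta>] Z(2)[OF that] r by (simp add: z_def norm_mult)
    have gz: "g z = c + B z * h1 z"
      by (rule Bh) (use nz r in \<open>auto simp: z_def norm_mult\<close>)
    \<comment> \<open>In the Hardy space of the circle this is the element of least norm in c + B
      H^2: c times the reproducing kernel at 0 of the orthogonal complement of B H^2.\<close>
    define v where "v = c * (1 - cnj b * B z)"
    have BB: "B z * cnj (B z) = 1" using B1[of t] by (simp add: z_def complex_norm_square[symmetric])
    have "(g z - v) * cnj (g z - v) =
        g z * cnj (g z) - c * cnj c * (1 - b * cnj b) - (E z + cnj (E z)) +
        (B z * cnj (B z) - 1) * (c * cnj c * b * cnj b + b * cnj c * h1 z + c * cnj b * cnj (h1 z))"
      unfolding v_def E_def gz by (simp add: algebra_simps)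
    hence "(g z - v) * cnj (g z - v) = g z * cnj (g z) - c * cnj c * (1 - b * cnj b) - (E z + cnj (E z))"
      unfolding BB by simp
    hence "complex_of_real ((cmod (g z - v))\<^sup>2) = of_real ((cmod (g z))\<^sup>2 - (cmod c)\<^sup>2 * (1 - (cmod b)\<^sup>2) - 2 * Re (E z))"
      by (simp only: complex_norm_square complex_add_cnj of_real_diff of_real_mult of_real_1 of_real_numeral)
    hence "(cmod (g z - v))\<^sup>2 = (cmod (g z))\<^sup>2 - (cmod c)\<^sup>2 * (1 - (cmod b)\<^sup>2) - 2 * Re (E z)"
      by (simp only: of_real_eq_iff)
    thus ?thesis using zero_le_power2[of "cmod (g z - v)"] by (simp add: z_def)
  qed
  have cE: "continuous_on UNIV (\<lambda>t. E (r * cis t))"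
    by (rule continuous_on_circle[OF Eh]) (use r in auto)
  have cg: "continuous_on UNIV (\<lambda>t. g (r * cis t))"
    by (rule continuous_on_circle[OF g]) (use r in auto)
  have "(\<integral>t. E (r * cis t) \<partial>circ) = 0"
    using circ_mean_value[OF Eh, of r] r E0 by simp
  hence "(\<integral>t. Re (E (r * cis t)) \<partial>circ) = 0"
    by (subst integral_Re) (auto intro: circ_integral cE)
  hence "(cmod c)\<^sup>2 * (1 - (cmod b)\<^sup>2) = (\<integral>t. (cmod c)\<^sup>2 * (1 - (cmod b)\<^sup>2) + 2 * Re (E (r * cis t)) \<partial>circ)"
    by (subst Bochner_Integration.integral_add)
       (auto simp: measure_circ_UNIV intro!: circ_integral continuous_intros cE)
  also have "\<dots> \<le> hardy_mean g r"
    unfolding hardy_mean_eq[OF g less_imp_le[OF r(1)] r(2)]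
    by (intro integral_mono circ_integral continuous_intros cE cg pw)
  finally show ?thesis by (simp add: bn)
qed

text \<open>The estimate is taken on circles inside the disk, each with its own Blaschke product
  over the same zeros, and r then tends to 1.\<close>

lemma H2_norm_ge_blaschke:
  assumes g: "in_H2 g" and h: "h holomorphic_on ball 0 1"
    and Z: "finite Z" "Z \<subseteq> ball 0 1"
    and gh: "\<And>z. cmod z < 1 \<Longrightarrow> g z = c + h z * (\<Prod>\<zeta>\<in>Z. (z - \<zeta>) ^ m \<zeta>)"
  shows "(cmod c)\<^sup>2 * (1 - (\<Prod>\<zeta>\<in>Z. cmod \<zeta> ^ (2 * m \<zeta>))) \<le> (H2_norm g)\<^sup>2"
proof -
  have "((\<lambda>r. (cmod c)\<^sup>2 * (1 - (\<Prod>\<zeta>\<in>Z. (cmod \<zeta> / r) ^ (2 * m \<zeta>)))) \<longlongrightarrow>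
      (cmod c)\<^sup>2 * (1 - (\<Prod>\<zeta>\<in>Z. (cmod \<zeta> / 1) ^ (2 * m \<zeta>)))) (at_left 1)"
    by (intro tendsto_intros tendsto_prod) auto
  moreover have "eventually (\<lambda>r. (cmod c)\<^sup>2 * (1 - (\<Prod>\<zeta>\<in>Z. (cmod \<zeta> / r) ^ (2 * m \<zeta>))) \<le> (H2_norm g)\<^sup>2) (at_left 1)"
  proof -
    have "eventually (\<lambda>r. \<forall>\<zeta>\<in>Z. cmod \<zeta> < r) (at_left 1)"
    proof (rule eventually_ball_finite[OF Z(1)], rule ballI)
      fix \<zeta> assume "\<zeta> \<in> Z"
      hence "cmod \<zeta> < 1" using Z by auto
      thus "eventually (\<lambda>r. cmod \<zeta> < r) (at_left 1)"
        unfolding eventually_at_left_field by blast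
    qed
    thus ?thesis using eventually_at_left_1
    proof eventually_elim
      case (elim r)
      have "(cmod c)\<^sup>2 * (1 - (\<Prod>\<zeta>\<in>Z. (cmod \<zeta> / r) ^ (2 * m \<zeta>))) \<le> hardy_mean g r"
        by (rule hardy_mean_ge_blaschke[OF in_H2_holomorphic[OF g] h Z(1) _ _ _ gh]) (use elim in auto)
      also have "\<dots> \<le> (H2_norm g)\<^sup>2"
        by (rule hardy_mean_le_norm[OF g]) (use elim in auto)
      finally show ?case .
    qed
  qed
  ultimately show ?thesis
    using tendsto_upperbound[of _ _ "at_left (1::real)"] by force
qed

section \<open>The counting function through its finite partial sums\<close>

lemma zorder_preimage_nonneg:
  assumes \<phi>: "\<phi> holomorphic_on ball 0 1" and w: "w \<noteq> \<phi> 0" and z: "cmod z < 1"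
  shows "zorder (\<lambda>x. \<phi> x - w) z \<ge> 0"
proof -
  have "(\<lambda>x. \<phi> x - w) holomorphic_on ball 0 1" by (intro holomorphic_intros \<phi>)
  from zorder_exist_zero[OF this, of z] w z show ?thesis
    by (force split: if_splits)
qed

lemma nevanlinna_term:
  assumes \<phi>: "\<phi> holomorphic_on ball 0 1" and w: "w \<noteq> \<phi> 0"
    and Z: "Z \<subseteq> {z \<in> ball 0 1. \<phi> z = w}"
  shows "(\<Sum>z\<in>Z. ennreal (of_int (zorder (\<lambda>x. \<phi> x - w) z) * ln (1 / cmod z))) =
    ennreal (\<Sum>z\<in>Z. real (nat (zorder (\<lambda>x. \<phi> x - w) z)) * ln (1 / cmod z))"
proof -
  have nn: "real (nat (zorder (\<lambda>x. \<phi> x - w) z)) * ln (1 / cmod z) \<ge> 0" if "z \<in> Z" for z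
    using that Z w by (cases "z = 0") (auto intro!: mult_nonneg_nonneg)
  have "(\<Sum>z\<in>Z. ennreal (of_int (zorder (\<lambda>x. \<phi> x - w) z) * ln (1 / cmod z))) =
     (\<Sum>z\<in>Z. ennreal (real (nat (zorder (\<lambda>x. \<phi> x - w) z)) * ln (1 / cmod z)))"
    by (intro sum.cong refl) (use zorder_preimage_nonneg[OF \<phi> w] Z in auto)
  also have "\<dots> = ennreal (\<Sum>z\<in>Z. real (nat (zorder (\<lambda>x. \<phi> x - w) z)) * ln (1 / cmod z))"
    by (rule sum_ennreal) (rule nn)
  finally show ?thesis .
qed

text \<open>With this lemma and the next, the counting function enters only through finite subsets
  of a fibre, hence through finite Blaschke products.\<close>

lemma nevanlinna_leI:
  assumes \<phi>: "\<phi> holomorphic_on ball 0 1" and w: "w \<noteq> \<phi> 0"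
    and le: "\<And>Z. finite Z \<Longrightarrow> Z \<subseteq> {z \<in> ball 0 1. \<phi> z = w} \<Longrightarrow>
      (\<Sum>z\<in>Z. real (nat (zorder (\<lambda>x. \<phi> x - w) z)) * ln (1 / cmod z)) \<le> y"
  shows "nevanlinna \<phi> w \<le> ennreal y"
proof -
  have "(\<Sum>\<^sub>\<infinity> z \<in> {z \<in> ball 0 1. \<phi> z = w}.
     ennreal (of_int (zorder (\<lambda>x. \<phi> x - w) z) * ln (1 / cmod z))) \<le> ennreal y"
    by (rule infsum_le_finite_sums)
       (auto simp: nevanlinna_term[OF \<phi> w] intro!: ennreal_leI le nonneg_summable_on_complete)
  thus ?thesis using w by (simp add: nevanlinna_def)
qed

lemma nevanlinna_geD:
  assumes \<phi>: "\<phi> holomorphic_on ball 0 1" and w: "w \<noteq> \<phi> 0"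
    and Z: "finite Z" "Z \<subseteq> {z \<in> ball 0 1. \<phi> z = w}" and le: "nevanlinna \<phi> w \<le> ennreal y" and y: "y \<ge> 0"
  shows "(\<Sum>z\<in>Z. real (nat (zorder (\<lambda>x. \<phi> x - w) z)) * ln (1 / cmod z)) \<le> y"
proof -
  have "(\<Sum>z\<in>Z. ennreal (of_int (zorder (\<lambda>x. \<phi> x - w) z) * ln (1 / cmod z))) \<le>
      (\<Sum>\<^sub>\<infinity> z \<in> {z \<in> ball 0 1. \<phi> z = w}. ennreal (of_int (zorder (\<lambda>x. \<phi> x - w) z) * ln (1 / cmod z)))"
    using Z by (subst infsum_finite[OF Z(1), symmetric], intro infsum_mono_neutral)
      (auto intro!: nonneg_summable_on_complete)
  also have "\<dots> = nevanlinna \<phi> w" using w by (simp add: nevanlinna_def)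
  finally have "(\<Sum>z\<in>Z. ennreal (of_int (zorder (\<lambda>x. \<phi> x - w) z) * ln (1 / cmod z))) \<le> nevanlinna \<phi> w" .
  with le show ?thesis
    unfolding nevanlinna_term[OF \<phi> w Z(2)] using y by (metis ennreal_le_iff order_trans)
qed

section \<open>Necessity\<close>

definition szego :: "complex \<Rightarrow> complex \<Rightarrow> complex" where
  "szego a z = of_real (sqrt (1 - (cmod a)\<^sup>2)) / (1 - cnj a * z)"

lemma szego_denom:
  assumes "cmod a < 1" "cmod z < 1"
  shows "1 - cnj a * z \<noteq> 0"
proof -
  have "cmod (cnj a * z) < 1"
    using mult_strict_mono'[OF assms] by (simp add: norm_mult)
  thus ?thesis by auto
qed

lemma higher_deriv_szego:
  assumes a: "cmod a < 1" and z: "cmod z < 1"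
  shows "(deriv ^^ k) (szego a) z = of_real (sqrt (1 - (cmod a)\<^sup>2)) * fact k * cnj a ^ k / (1 - cnj a * z) ^ Suc k"
  using z
proof (induction k arbitrary: z)
  case 0
  thus ?case by (simp add: szego_def)
next
  case (Suc k)
  define s where "s = complex_of_real (sqrt (1 - (cmod a)\<^sup>2))"
  have "eventually (\<lambda>z. cmod z < 1) (nhds z)"
    using Suc.prems eventually_nhds_in_open[of "ball 0 1" z] by simp
  hence "eventually (\<lambda>z. (deriv ^^ k) (szego a) z = s * fact k * cnj a ^ k / (1 - cnj a * z) ^ Suc k) (nhds z)"
    by (rule eventually_mono) (use Suc.IH s_def in simp)
  hence "deriv ((deriv ^^ k) (szego a)) z = deriv (\<lambda>z. s * fact k * cnj a ^ k / (1 - cnj a * z) ^ Suc k) z"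
    by (rule deriv_cong_ev) simp
  also have "(\<lambda>z. s * fact k * cnj a ^ k / (1 - cnj a * z) ^ Suc k) =
      (\<lambda>z. s * fact k * cnj a ^ k * inverse (1 - cnj a * z) ^ Suc k)"
    by (simp only: divide_inverse power_inverse)
  also have "deriv \<dots> z = s * fact (Suc k) * cnj a ^ Suc k * inverse (1 - cnj a * z) ^ Suc (Suc k)"
  proof (rule DERIV_imp_deriv)
    have "((\<lambda>z. inverse (1 - cnj a * z)) has_field_derivative cnj a * (inverse (1 - cnj a * z))\<^sup>2) (at z)"
      using szego_denom[OF a Suc.prems]
      by (auto intro!: derivative_eq_intros simp: power2_eq_square)
    from DERIV_cmult[OF DERIV_power[OF this, of "Suc k"], of "s * fact k * cnj a ^ k"]
    show "((\<lambda>z. s * fact k * cnj a ^ k * inverse (1 - cnj a * z) ^ Suc k) has_field_derivative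
        s * fact (Suc k) * cnj a ^ Suc k * inverse (1 - cnj a * z) ^ Suc (Suc k)) (at z)"
      by (simp add: power2_eq_square mult_ac)
  qed
  also have "\<dots> = s * fact (Suc k) * cnj a ^ Suc k / (1 - cnj a * z) ^ Suc (Suc k)"
    by (simp only: divide_inverse power_inverse)
  finally show ?case by (simp add: s_def)
qed

lemma szego_holomorphic: "cmod a < 1 \<Longrightarrow> szego a holomorphic_on ball 0 1"
  unfolding szego_def using szego_denom by (intro holomorphic_intros) auto

lemma szego_H2:
  assumes a: "cmod a < 1"
  shows "in_H2 (szego a)" "H2_norm (szego a) = 1"
proof -
  have a2: "(cmod a)\<^sup>2 < 1" using a by (simp add: power_less_one_iff)
  have "(cmod (taylor_coeff (szego a) k))\<^sup>2 = (1 - (cmod a)\<^sup>2) * ((cmod a)\<^sup>2) ^ k" for k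
    unfolding taylor_coeff_def using a2
    by (subst higher_deriv_szego[OF a])
       (simp_all add: norm_mult norm_power power_mult_distrib power_mult[symmetric] mult.commute)
  moreover have "(\<lambda>k. (1 - (cmod a)\<^sup>2) * ((cmod a)\<^sup>2) ^ k) sums ((1 - (cmod a)\<^sup>2) * (1 / (1 - (cmod a)\<^sup>2)))"
    by (intro sums_mult geometric_sums) (use a2 in simp)
  ultimately have s: "(\<lambda>k. (cmod (taylor_coeff (szego a) k))\<^sup>2) sums 1"
    using a2 by simp
  show 1: "in_H2 (szego a)"
    using s szego_holomorphic[OF a] by (simp add: in_H2_iff sums_iff)
  have "(H2_norm (szego a))\<^sup>2 = 1"
    using s H2_norm_sq[OF 1] by (simp add: sums_iff)
  thus "H2_norm (szego a) = 1"
    using H2_norm_nonneg[OF 1] by (simp add: power2_eq_1_iff)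
qed

text \<open>The constant is 4^n * 2^(2n+1): the first factor bounds |a|^(-2n) for |a| >= 1/2, the
  second comes from 1 - |a|^2 <= 2 ln (1/|a|). The hypothesis \<open>small\<close> keeps 1 - exp (-2
  S) at most 1/2, so that it controls S itself.\<close>

lemma nevanlinna_le_szego:
  assumes \<phi>: "\<phi> holomorphic_on ball 0 1" "\<phi> ` ball 0 1 \<subseteq> ball 0 1"
    and a: "cmod a < 1" "a \<noteq> \<phi> 0" "cmod a \<ge> 1/2"
    and T: "in_H2 (D_op \<phi> n (szego a))"
    and small: "2 ^ (4*n+1) * (H2_norm (D_op \<phi> n (szego a)))\<^sup>2 \<le> 1/2"
  shows "nevanlinna \<phi> a \<le> ennreal (2 ^ (4*n+1) * (H2_norm (D_op \<phi> n (szego a)))\<^sup>2 * ln (1 / cmod a) ^ (2*n+1))"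
proof (rule nevanlinna_leI[OF \<phi>(1) a(2)])
  fix Z assume Z: "finite Z" "Z \<subseteq> {z \<in> ball 0 1. \<phi> z = a}"
  define m where "m z = nat (zorder (\<lambda>x. \<phi> x - a) z)" for z
  define S where "S = (\<Sum>z\<in>Z. real (m z) * ln (1 / cmod z))"
  define F where "F = (deriv ^^ n) (szego a)"
  define l where "l = ln (1 / cmod a)"
  define t where "t = 1 - (cmod a)\<^sup>2"
  define M where "M = (H2_norm (D_op \<phi> n (szego a)))\<^sup>2"
  have t0: "t > 0" unfolding t_def using a by (simp add: power_less_one_iff)
  have hol: "(\<lambda>x. \<phi> x - a) holomorphic_on ball 0 1" by (intro holomorphic_intros \<phi>)
  have ex: "\<exists>z\<in>ball 0 1. \<phi> z - a \<noteq> 0"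
    using a(2) by (intro bexI[of _ 0]) auto
  have Zs: "Z \<subseteq> ball 0 1" using Z by auto
  obtain h where h: "h holomorphic_on ball 0 1"
    "\<And>z. z \<in> ball 0 1 \<Longrightarrow> \<phi> z - a = h z * (\<Prod>\<zeta>\<in>Z. (z - \<zeta>) ^ m \<zeta>)"
    by (rule factor_out_zeros[OF hol open_ball connected_ball ex Z(1) Zs, folded m_def], rule that)
  have F: "F holomorphic_on ball 0 1"
    unfolding F_def by (intro holomorphic_higher_deriv szego_holomorphic a) auto
  \<comment> \<open>The difference quotient of F at a: F (\<phi> z) - F a then has \<phi> z - a as a
    factor and inherits its zeros over a.\<close>
  define q where "q = (\<lambda>z. if z = a then deriv F a else (F z - F a) / (z - a))"
  have q: "q holomorphic_on ball 0 1"
    unfolding q_def by (rule pole_lemma[OF F]) (use a in \<open>simp add: interior_open\<close>)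
  have qF: "F z = F a + q z * (z - a)" for z by (simp add: q_def)
  have lower: "(cmod (F a))\<^sup>2 * (1 - (\<Prod>\<zeta>\<in>Z. cmod \<zeta> ^ (2 * m \<zeta>))) \<le> M"
    unfolding M_def
  proof (rule H2_norm_ge_blaschke[OF T _ Z(1)])
    show "(\<lambda>z. q (\<phi> z) * h z) holomorphic_on ball 0 1"
      using holomorphic_on_compose_gen[OF \<phi>(1) q \<phi>(2)] by (intro holomorphic_intros h) (simp add: o_def)
    show "Z \<subseteq> ball 0 1" using Z by auto
    show "D_op \<phi> n (szego a) z = F a + q (\<phi> z) * h z * (\<Prod>\<zeta>\<in>Z. (z - \<zeta>) ^ m \<zeta>)" if "cmod z < 1" for z
      using qF[of "\<phi> z"] h(2)[of z] that by (simp add: D_op_def F_def mult.assoc)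
  qed
  \<comment> \<open>This is |B(0)|^2 for the Blaschke product B of Z; none of its zeros is 0,
    because a differs from \<phi> 0.\<close>
  have prodS: "(\<Prod>\<zeta>\<in>Z. cmod \<zeta> ^ (2 * m \<zeta>)) = exp (- 2 * S)"
  proof -
    have "exp (- 2 * S) = (\<Prod>\<zeta>\<in>Z. exp (- 2 * (real (m \<zeta>) * ln (1 / cmod \<zeta>))))"
      using Z(1) by (simp only: S_def sum_distrib_left exp_sum)
    also have "\<dots> = (\<Prod>\<zeta>\<in>Z. cmod \<zeta> ^ (2 * m \<zeta>))"
    proof (intro prod.cong refl)
      fix \<zeta> assume "\<zeta> \<in> Z"
      hence "\<zeta> \<noteq> 0" using Z a(2) by auto
      hence "cmod \<zeta> > 0" by simp
      thus "exp (- 2 * (real (m \<zeta>) * ln (1 / cmod \<zeta>))) = cmod \<zeta> ^ (2 * m \<zeta>)"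
        by (simp add: ln_div exp_of_nat_mult[symmetric] powr_realpow[symmetric] powr_def mult_ac)
    qed
    finally show ?thesis ..
  qed
  have Fa: "(cmod (F a))\<^sup>2 * t ^ (2*n+1) = (fact n)\<^sup>2 * cmod a ^ (2*n)"
  proof -
    have "1 - cnj a * a = of_real t"
      using complex_norm_square[of a] by (simp add: t_def mult.commute)
    hence "F a = of_real (sqrt t) * fact n * cnj a ^ n / of_real t ^ Suc n"
      unfolding F_def higher_deriv_szego[OF a(1) a(1)] t_def by simp
    hence "cmod (F a) = sqrt t * fact n * cmod a ^ n / t ^ Suc n"
      using t0 by (simp add: norm_mult norm_divide norm_power)
    hence "(cmod (F a))\<^sup>2 = t * (fact n)\<^sup>2 * cmod a ^ (2*n) / t ^ (2 * n + 2)"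
      using t0 by (simp add: power_divide power_mult_distrib power_mult[symmetric] mult.commute
          real_sqrt_pow2 flip: power_Suc)
    thus ?thesis using t0 by (simp add: field_simps)
  qed
  have "1 - exp (- 2 * S) \<le> 2 ^ (4*n+1) * M * l ^ (2*n+1)"
  proof -
    have M0: "M \<ge> 0" by (simp add: M_def)
    have l1: "t \<le> 2 * l"
    proof -
      have "cmod a - 1 \<ge> ln (cmod a)" by (rule ln_le_minus_one) (use a in linarith)
      hence "1 - cmod a \<le> l" using a by (cases "a = 0") (simp_all add: l_def ln_div)
      hence "2 * (1 - cmod a) \<le> 2 * l" by (rule mult_left_mono) simp
      moreover have "t \<le> 2 * (1 - cmod a)"
        unfolding t_def using zero_le_power2[of "1 - cmod a"] by (simp add: power2_eq_square algebra_simps)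
      ultimately show ?thesis by (rule order_trans[rotated])
    qed
    have "(1/4) ^ n = ((1/2)^(2*n) :: real)" by (simp add: power_mult power2_eq_square)
    also have "\<dots> \<le> 1 * cmod a ^ (2*n)" using a(3) by (simp add: power_mono)
    also have "\<dots> \<le> (fact n)\<^sup>2 * cmod a ^ (2*n)"
      by (intro mult_right_mono) (use fact_ge_1[of n, where ?'a = real] in \<open>auto simp: one_le_power\<close>)
    finally have low: "(1/4) ^ n \<le> (fact n)\<^sup>2 * cmod a ^ (2*n)" .
    have "(1/4) ^ n * (1 - exp (- 2 * S)) \<le> M * t ^ (2*n+1)"
    proof (cases "1 - exp (- 2 * S) \<le> 0")
      case True
      have "(1/4) ^ n * (1 - exp (- 2 * S)) \<le> 0" using True by (simp add: mult_nonneg_nonpos)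
      also have "0 \<le> M * t ^ (2*n+1)" using M0 t0 by (intro mult_nonneg_nonneg) auto
      finally show ?thesis .
    next
      case False
      have "(1/4) ^ n * (1 - exp (- 2 * S)) \<le> ((fact n)\<^sup>2 * cmod a ^ (2*n)) * (1 - exp (- 2 * S))"
        using low False by (intro mult_right_mono) auto
      also have "\<dots> = ((cmod (F a))\<^sup>2 * (1 - exp (- 2 * S))) * t ^ (2*n+1)"
        unfolding Fa[symmetric] by simp
      also have "\<dots> \<le> M * t ^ (2*n+1)"
        using lower t0 unfolding prodS by (intro mult_right_mono) auto
      finally show ?thesis .
    qed
    also have "\<dots> \<le> M * (2 * l) ^ (2*n+1)"
      using l1 t0 M0 by (intro mult_left_mono power_mono) auto
    finally have le: "4 ^ n * ((1/4) ^ n * (1 - exp (- 2 * S))) \<le> 4 ^ n * (M * (2 * l) ^ (2*n+1))"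
      by (intro mult_left_mono) auto
    have e1: "4 ^ n * ((1/4) ^ n * (1 - exp (- 2 * S))) = 1 - exp (-2 * S)"
      by (simp add: power_divide)
    have "(4::real) ^ n = 2 ^ (2*n)" by (simp add: power_mult)
    hence e2: "(4::real) ^ n * 2 ^ (2*n+1) = 2 ^ (4*n+1)"
      by (simp add: power_add[symmetric])
    have e3: "4 ^ n * (M * (2 * l) ^ (2*n+1)) = (4 ^ n * 2 ^ (2*n+1)) * M * l ^ (2*n+1)"
      unfolding power_mult_distrib by (simp only: mult_ac)
    show ?thesis using le unfolding e1 e3 e2 .
  qed
  moreover define y where "y = 2 ^ (4*n+1) * M * l ^ (2*n+1)"
  ultimately have Sy: "1 - exp (- 2 * S) \<le> y" by simp
  have l01: "0 \<le> l" "l \<le> 1"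
  proof -
    show "0 \<le> l" unfolding l_def
      by (rule ln_ge_zero) (use a in \<open>auto simp: le_divide_eq\<close>)
    have "cmod a > 0" using a(3) by linarith
    hence "l \<le> ln 2" unfolding l_def using a by (subst ln_le_cancel_iff) (auto simp: divide_le_eq)
    also have "\<dots> \<le> 1" using ln_2_less_1 by simp
    finally show "l \<le> 1" .
  qed
  have y0: "y \<ge> 0" unfolding y_def M_def using l01 by (intro mult_nonneg_nonneg) auto
  have "y \<le> 2 ^ (4*n+1) * M * 1"
    unfolding y_def using l01 by (intro mult_left_mono power_le_one) (auto simp: M_def)
  hence y1: "y \<le> 1/2" using small by (simp add: M_def)
  \<comment> \<open>For 0 <= y <= 1/2 this lower bound is at least -2 y, while ln (1 - y) <= -2
    S.\<close>
  have "- y - 2 * y\<^sup>2 \<le> ln (1 - y)"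
    by (rule ln_one_minus_pos_lower_bound) (use y0 y1 in auto)
  moreover have "y * y \<le> y * (1/2)" using y0 y1 by (intro mult_left_mono) auto
  moreover have "ln (1 - y) \<le> ln (exp (- 2 * S))"
    by (rule ln_mono) (use Sy y1 in auto)
  ultimately have "S \<le> y" by (simp add: power2_eq_square)
  thus "(\<Sum>z\<in>Z. real (nat (zorder (\<lambda>x. \<phi> x - a) z)) * ln (1 / cmod z)) \<le> 2 ^ (4*n+1) * (H2_norm (D_op \<phi> n (szego a)))\<^sup>2 * ln (1 / cmod a) ^ (2*n+1)"
    by (simp add: S_def m_def y_def M_def l_def)
qed

text \<open>\<open>Lim\<close> is a definite description, so the two means are compared through all
  their possible limits, whether or not one exists.\<close>

lemma H2_norm_cong:
  assumes "\<And>z. cmod z < 1 \<Longrightarrow> f z = g z"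
  shows "H2_norm f = H2_norm g"
proof -
  have "hardy_mean f r = hardy_mean g r" if "0 < r" "r < 1" for r
    unfolding hardy_mean_def using that
    by (intro arg_cong2[of _ _ _ _ "(*)"] refl integral_cong) (simp add: assms norm_mult)
  hence "eventually (\<lambda>r. hardy_mean f r = hardy_mean g r) (at_left 1)"
    using eventually_at_left_1 by (auto elim: eventually_mono)
  hence "(hardy_mean f \<longlongrightarrow> L) (at_left 1) \<longleftrightarrow> (hardy_mean g \<longlongrightarrow> L) (at_left 1)" for L
    by (rule tendsto_cong)
  thus ?thesis by (simp add: H2_norm_def t2_space_class.Lim_def)
qed

text \<open>Compactness yields only some norm limit g along a subsequence. Norm convergence implies
  pointwise convergence, and the images of the kernels tend to 0 pointwise, so g vanishes on the
  disk and the norms themselves tend to 0.\<close>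

theorem compact_imp_nevanlinna:
  assumes \<phi>: "\<phi> holomorphic_on ball 0 1" "\<phi> ` ball 0 1 \<subseteq> ball 0 1"
    and comp: "compact_on_H2 (D_op \<phi> n)" and \<epsilon>: "\<epsilon> > 0"
  shows "\<exists>\<delta><1. \<forall>w. \<delta> < cmod w \<and> cmod w < 1 \<longrightarrow>
        nevanlinna \<phi> w \<le> ennreal (\<epsilon> * (ln (1 / cmod w)) ^ (2 * n + 1))"
proof (rule ccontr)
  assume neg: "\<not> ?thesis"
  \<comment> \<open>The three bounds keep |a k| >= 1/2, keep a k different from \<phi> 0, and force
    |a k| to tend to 1.\<close>
  define \<delta> where "\<delta> k = max (max (1/2) (cmod (\<phi> 0))) (1 - inverse (real (Suc k)))" for k
  have "\<phi> 0 \<in> ball 0 1" using \<phi>(2) by (rule subsetD) simp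
  hence "\<delta> k < 1" for k by (simp add: \<delta>_def)
  hence "\<exists>w. \<delta> k < cmod w \<and> cmod w < 1 \<and>
      \<not> nevanlinna \<phi> w \<le> ennreal (\<epsilon> * (ln (1 / cmod w)) ^ (2 * n + 1))" for k
    using neg by blast
  then obtain a where a: "\<And>k. \<delta> k < cmod (a k)" "\<And>k. cmod (a k) < 1"
    "\<And>k. \<not> nevanlinna \<phi> (a k) \<le> ennreal (\<epsilon> * (ln (1 / cmod (a k))) ^ (2 * n + 1))"
    by metis
  have a': "cmod (a k) \<ge> 1/2" "a k \<noteq> \<phi> 0" "cmod (a k) \<ge> 1 - inverse (real (Suc k))" for k
    using a(1)[of k] by (auto simp: \<delta>_def)
  have "(\<lambda>k. cmod (a k)) \<longlonglongrightarrow> 1"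
  proof (rule tendsto_sandwich)
    show "(\<lambda>k. 1 - inverse (real (Suc k))) \<longlonglongrightarrow> 1"
      using tendsto_diff[OF tendsto_const LIMSEQ_inverse_real_of_nat, of 1] by simp
    show "eventually (\<lambda>k. 1 - inverse (real (Suc k)) \<le> cmod (a k)) sequentially"
      using a'(3) by simp
    show "eventually (\<lambda>k. cmod (a k) \<le> 1) sequentially"
      using a(2) by (simp add: less_imp_le)
  qed (rule tendsto_const)
  hence "(\<lambda>k. sqrt (1 - (cmod (a k))\<^sup>2)) \<longlonglongrightarrow> sqrt (1 - 1\<^sup>2)"
    by (intro tendsto_intros)
  hence sq: "(\<lambda>k. sqrt (1 - (cmod (a k))\<^sup>2)) \<longlonglongrightarrow> 0" by simp
  have "(\<forall>k. in_H2 (szego (a k))) \<and> bounded (range (\<lambda>k. H2_norm (szego (a k))))"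
    using szego_H2 a(2) by simp
  then obtain r g where r: "strict_mono r" "in_H2 g"
    "(\<lambda>k. H2_norm (\<lambda>z. D_op \<phi> n (szego (a (r k))) z - g z)) \<longlonglongrightarrow> 0"
    using comp unfolding compact_on_H2_def by meson
  have TH: "in_H2 (D_op \<phi> n (szego (a k)))" for k
    using comp szego_H2 a(2) unfolding compact_on_H2_def by blast
  have g0: "g z = 0" if z: "cmod z < 1" for z
  proof -
    \<comment> \<open>A lower bound for |1 - cnj (a k) * \<phi> z|^(n+1) that does not depend on
      k.\<close>
    define c where "c = (1 - cmod (\<phi> z)) ^ Suc n"
    have "\<phi> z \<in> ball 0 1" using \<phi>(2) by (rule subsetD) (use z in simp)
    hence pz: "cmod (\<phi> z) < 1" by simp
    have c: "c > 0" unfolding c_def using pz by simp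
    have bd: "cmod (D_op \<phi> n (szego (a k)) z) \<le> sqrt (1 - (cmod (a k))\<^sup>2) * (fact n / c)" for k
    proof -
      have "1 - cmod (\<phi> z) \<le> cmod 1 - cmod (cnj (a k) * \<phi> z)"
        using a(2)[of k] by (simp add: norm_mult mult_left_le_one_le)
      also have "\<dots> \<le> cmod (1 - cnj (a k) * \<phi> z)" by (rule norm_triangle_ineq2)
      finally have "c \<le> cmod (1 - cnj (a k) * \<phi> z) ^ Suc n"
        unfolding c_def using pz by (intro power_mono) auto
      moreover have "sqrt (1 - (cmod (a k))\<^sup>2) * fact n * cmod (a k) ^ n \<le> sqrt (1 - (cmod (a k))\<^sup>2) * fact n * 1"
        using a(2)[of k] by (intro mult_left_mono power_le_one) (auto simp: power_le_one)
      ultimately show ?thesis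
        unfolding D_op_def higher_deriv_szego[OF a(2) pz]
        using c a(2)[of k] by (auto simp: norm_mult norm_divide norm_power power_le_one intro!: frac_le)
    qed
    have T0: "(\<lambda>k. D_op \<phi> n (szego (a k)) z) \<longlonglongrightarrow> 0"
      by (rule Lim_null_comparison[OF always_eventually[OF allI, OF bd]])
         (rule tendsto_mult_left_zero[OF sq])
    have 1: "(\<lambda>k. D_op \<phi> n (szego (a (r k))) z - g z) \<longlonglongrightarrow> 0 - g z"
      using LIMSEQ_subseq_LIMSEQ[OF T0 r(1)] by (intro tendsto_intros) (simp add: o_def)
    have z2: "(cmod z)\<^sup>2 < 1" using z by (simp add: power_less_one_iff)
    have "(\<lambda>k. (cmod (D_op \<phi> n (szego (a (r k))) z - g z))\<^sup>2) \<longlonglongrightarrow> 0"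
    proof (rule tendsto_sandwich[where f = "\<lambda>_. 0"])
      show "(\<lambda>k. (H2_norm (\<lambda>z. D_op \<phi> n (szego (a (r k))) z - g z))\<^sup>2 / (1 - (cmod z)\<^sup>2)) \<longlonglongrightarrow> 0"
        using tendsto_divide[OF tendsto_power[OF r(3), of 2] tendsto_const[of "1 - (cmod z)\<^sup>2"]] z2 by simp
      show "eventually (\<lambda>k. (cmod (D_op \<phi> n (szego (a (r k))) z - g z))\<^sup>2 \<le>
          (H2_norm (\<lambda>z. D_op \<phi> n (szego (a (r k))) z - g z))\<^sup>2 / (1 - (cmod z)\<^sup>2)) sequentially"
        by (intro always_eventually allI H2_pointwise_bound H2_diff TH r(2) z)
    qed (auto intro: tendsto_const)
    moreover have "(\<lambda>k. (cmod (D_op \<phi> n (szego (a (r k))) z - g z))\<^sup>2) \<longlonglongrightarrow> (cmod (0 - g z))\<^sup>2"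
      by (intro tendsto_intros 1)
    ultimately have "(cmod (0 - g z))\<^sup>2 = 0" using LIMSEQ_unique by blast
    thus ?thesis by simp
  qed
  have "H2_norm (\<lambda>z. D_op \<phi> n (szego (a (r k))) z - g z) = H2_norm (D_op \<phi> n (szego (a (r k))))" for k
    by (rule H2_norm_cong) (simp add: g0)
  with r(3) have lim: "(\<lambda>k. H2_norm (D_op \<phi> n (szego (a (r k))))) \<longlonglongrightarrow> 0" by simp
  have "(\<lambda>k. 2 ^ (4*n+1) * (H2_norm (D_op \<phi> n (szego (a (r k)))))\<^sup>2) \<longlonglongrightarrow> 2 ^ (4*n+1) * 0\<^sup>2"
    by (intro tendsto_intros lim)
  hence "eventually (\<lambda>k. 2 ^ (4*n+1) * (H2_norm (D_op \<phi> n (szego (a (r k)))))\<^sup>2 < min (1/2) \<epsilon>) sequentially"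
    by (rule order_tendstoD) (use \<epsilon> in simp)
  then obtain k where k: "2 ^ (4*n+1) * (H2_norm (D_op \<phi> n (szego (a (r k)))))\<^sup>2 < min (1/2) \<epsilon>"
    by (auto simp: eventually_sequentially)
  define b where "b = a (r k)"
  have "cmod b > 0" "cmod b < 1" using a(2)[of "r k"] a'(1)[of "r k"] by (auto simp: b_def)
  hence l0: "ln (1 / cmod b) \<ge> 0" by (intro ln_ge_zero) (simp add: le_divide_eq)
  have "nevanlinna \<phi> b \<le> ennreal (2 ^ (4*n+1) * (H2_norm (D_op \<phi> n (szego b)))\<^sup>2 * ln (1 / cmod b) ^ (2*n+1))"
    unfolding b_def by (intro nevanlinna_le_szego \<phi> a a' TH) (use k in simp)
  also have "\<dots> \<le> ennreal (\<epsilon> * ln (1 / cmod b) ^ (2*n+1))"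
    using k l0 by (intro ennreal_leI mult_right_mono zero_le_power) (auto simp: b_def)
  finally show False using a(3)[of "r k"] by (simp add: b_def)
qed

section \<open>Jensen's inequality and the counting function\<close>

text \<open>ln |k| is the real part of a holomorphic logarithm, which exists because k is zero-free
  on the disk of radius R.\<close>

lemma mean_ln_cmod:
  fixes r :: real
  assumes k: "k holomorphic_on ball 0 R" "\<And>z. cmod z < R \<Longrightarrow> k z \<noteq> 0" and r: "0 \<le> r" "r < R"
  shows "continuous_on UNIV (\<lambda>t. ln (cmod (k (r * cis t))))"
    and "(\<integral>t. ln (cmod (k (r * cis t))) \<partial>circ) = ln (cmod (k 0))"
proof -
  obtain g where g: "g holomorphic_on ball 0 R" "\<And>x. x \<in> ball 0 R \<Longrightarrow> exp (g x) = k x"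
    using holomorphic_logarithm_exists[of "ball 0 R" k 0] k r by auto
  have ln: "ln (cmod (k z)) = Re (g z)" if "cmod z < R" for z
    using g(2)[of z] that by (simp add: norm_exp_eq_Re flip: g(2))
  have n: "cmod (r * cis t) < R" for t using r by (simp add: norm_mult)
  have c: "continuous_on UNIV (\<lambda>t. g (r * cis t))" by (rule continuous_on_circle[OF g(1) r])
  show "continuous_on UNIV (\<lambda>t. ln (cmod (k (r * cis t))))"
    unfolding ln[OF n] by (intro continuous_intros c)
  have "(\<integral>t. ln (cmod (k (r * cis t))) \<partial>circ) = Re (\<integral>t. g (r * cis t) \<partial>circ)"
    unfolding ln[OF n] by (rule integral_Re) (rule circ_integral[OF c])
  thus "(\<integral>t. ln (cmod (k (r * cis t))) \<partial>circ) = ln (cmod (k 0))"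
    using circ_mean_value[OF g(1) r] ln[of 0] r by simp
qed

text \<open>The value at 0 is set explicitly because \<open>ln (4 / 0) = 0\<close>; the constant 4 makes the potential
  nonnegative at the distances that occur.\<close>

definition logker :: "real \<Rightarrow> ennreal" where
  "logker x = (if x = 0 then \<infinity> else ennreal (ln (4 / x)))"

lemma logker_measurable [measurable]: "logker \<in> borel_measurable borel"
  unfolding logker_def by measurable

lemma logker_antimono: "0 \<le> x \<Longrightarrow> x \<le> y \<Longrightarrow> y > 0 \<Longrightarrow> ennreal (ln (4 / y)) \<le> logker x"
  unfolding logker_def by (auto intro!: ennreal_leI ln_mono divide_left_mono)

text \<open>An inequality only, since \<open>ennreal\<close> cuts negative values off to 0.\<close>

lemma ennreal_integral_le_nn_integral:
  fixes f :: "'a \<Rightarrow> real"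
  assumes "integrable M f"
  shows "ennreal (integral\<^sup>L M f) \<le> (\<integral>\<^sup>+x. ennreal (f x) \<partial>M)"
proof -
  have "integral\<^sup>L M f \<le> integral\<^sup>L M (\<lambda>x. max 0 (f x))"
    using assms by (intro integral_mono) auto
  hence "ennreal (integral\<^sup>L M f) \<le> ennreal (integral\<^sup>L M (\<lambda>x. max 0 (f x)))"
    by (rule ennreal_leI)
  also have "\<dots> = (\<integral>\<^sup>+x. ennreal (max 0 (f x)) \<partial>M)"
    using assms by (intro nn_integral_eq_integral[symmetric]) auto
  also have "\<dots> = (\<integral>\<^sup>+x. ennreal (f x) \<partial>M)"
    by (intro nn_integral_cong) (auto simp: max_def ennreal_neg)
  finally show ?thesis .
qed

text \<open>Each zero factor z - \<zeta> is replaced by 1 - cnj \<zeta> * z, which is at least as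
  large in the disk and has no zero there. The resulting k dominates \<phi> - w in modulus, and ln
  |k| at 0 exceeds ln |\<phi> - w| by exactly the counting sum over the removed zeros. Taking the
  factors of the unit disk instead of those of the circle gives up equality but makes the bound
  independent of r.\<close>

lemma Jensen_inequality:
  fixes r y :: real
  assumes \<phi>: "\<phi> holomorphic_on ball 0 1" and w: "w \<noteq> \<phi> 0" and r: "0 \<le> r" "r < 1"
    and le: "\<And>Z. finite Z \<Longrightarrow> Z \<subseteq> {z \<in> ball 0 1. \<phi> z = w} \<Longrightarrow>
      (\<Sum>z\<in>Z. real (nat (zorder (\<lambda>x. \<phi> x - w) z)) * ln (1 / cmod z)) \<le> y"
  shows "ennreal (ln (4 / cmod (\<phi> 0 - w)) - y) \<le> (\<integral>\<^sup>+t. logker (cmod (\<phi> (r * cis t) - w)) \<partial>circ)"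
proof -
  \<comment> \<open>A slightly larger disk: zeros on |z| = r are removed as well, and there are
    still only finitely many.\<close>
  define R where "R = (1 + r) / 2"
  have R: "r < R" "R < 1" "0 < R" using r by (auto simp: R_def)
  define Z where "Z = {z \<in> cball 0 R. \<phi> z - w = 0}"
  define m where "m z = nat (zorder (\<lambda>x. \<phi> x - w) z)" for z
  have hol: "(\<lambda>x. \<phi> x - w) holomorphic_on ball 0 1" by (intro holomorphic_intros \<phi>)
  have ex: "\<exists>z\<in>ball 0 1. \<phi> z - w \<noteq> 0"
    using w by (intro bexI[of _ 0]) auto
  have Zs: "Z \<subseteq> ball 0 1" using R by (auto simp: Z_def)
  have finZ: "finite Z"
  proof (cases "(\<lambda>x. \<phi> x - w) constant_on ball 0 1")
    case True
    then obtain c where c: "\<And>z. z \<in> ball 0 1 \<Longrightarrow> \<phi> z - w = c" by (auto simp: constant_on_def)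
    from c[of 0] w have "c \<noteq> 0" by auto
    have "z \<notin> Z" for z
    proof
      assume "z \<in> Z"
      hence "\<phi> z - w = 0" "z \<in> ball 0 1" using Zs by (auto simp: Z_def)
      thus False using c[of z] \<open>c \<noteq> 0\<close> by simp
    qed
    hence "Z = {}" by blast
    thus ?thesis by simp
  next
    case False
    thus ?thesis unfolding Z_def
      by (intro holomorphic_compact_finite_zeros[OF hol]) (use R in auto)
  qed
  obtain h where h: "h holomorphic_on ball 0 1"
    "\<And>z. z \<in> ball 0 1 \<Longrightarrow> \<phi> z - w = h z * (\<Prod>\<zeta>\<in>Z. (z - \<zeta>) ^ m \<zeta>)"
    "\<And>z. z \<in> ball 0 1 \<Longrightarrow> \<phi> z - w \<noteq> 0 \<or> z \<in> Z \<Longrightarrow> h z \<noteq> 0"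
    by (rule factor_out_zeros[OF hol open_ball connected_ball ex finZ Zs, folded m_def], rule that)
  define k where "k z = h z * (\<Prod>\<zeta>\<in>Z. (1 - cnj \<zeta> * z) ^ m \<zeta>)" for z
  have "k holomorphic_on ball 0 1"
    unfolding k_def by (intro holomorphic_intros h)
  hence k: "k holomorphic_on ball 0 R" by (rule holomorphic_on_subset) (use R in auto)
  have k0: "k z \<noteq> 0" if z: "cmod z < R" for z
  proof -
    have "h z \<noteq> 0" using z R by (intro h(3)) (auto simp: Z_def)
    moreover have "1 - cnj \<zeta> * z \<noteq> 0" if "\<zeta> \<in> Z" for \<zeta>
      using szego_denom[of \<zeta> z] that Zs z R by auto
    ultimately show ?thesis using finZ by (simp add: k_def)
  qed
  have dom: "cmod (\<phi> z - w) \<le> cmod (k z)" if z: "cmod z < 1" for z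
  proof -
    have "cmod (z - \<zeta>) \<le> cmod (1 - cnj \<zeta> * z)" if \<zeta>: "\<zeta> \<in> Z" for \<zeta>
    proof -
      have "(1 - (cmod \<zeta>)\<^sup>2) * (1 - (cmod z)\<^sup>2) \<ge> 0"
        using \<zeta> Zs z by (intro mult_nonneg_nonneg) (auto simp: power_le_one abs_square_le_1)
      moreover have "complex_of_real ((cmod (1 - cnj \<zeta> * z))\<^sup>2 - (cmod (z - \<zeta>))\<^sup>2) = of_real ((1 - (cmod \<zeta>)\<^sup>2) * (1 - (cmod z)\<^sup>2))"
        by (simp only: of_real_diff of_real_mult of_real_1 complex_norm_square) (simp add: algebra_simps)
      hence "(cmod (1 - cnj \<zeta> * z))\<^sup>2 - (cmod (z - \<zeta>))\<^sup>2 = (1 - (cmod \<zeta>)\<^sup>2) * (1 - (cmod z)\<^sup>2)"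
        by (simp only: of_real_eq_iff)
      ultimately have "(cmod (z - \<zeta>))\<^sup>2 \<le> (cmod (1 - cnj \<zeta> * z))\<^sup>2" by linarith
      thus ?thesis by (rule power2_le_imp_le) simp
    qed
    hence "(\<Prod>\<zeta>\<in>Z. cmod (z - \<zeta>) ^ m \<zeta>) \<le> (\<Prod>\<zeta>\<in>Z. cmod (1 - cnj \<zeta> * z) ^ m \<zeta>)"
      by (intro prod_mono conjI power_mono) auto
    thus ?thesis using h(2)[of z] z
      by (simp add: k_def norm_mult norm_power mult_left_mono flip: prod_norm)
  qed
  have kk: "ln (cmod (k 0)) \<le> ln (cmod (\<phi> 0 - w)) + y"
  proof -
    have z0: "\<zeta> \<noteq> 0" if "\<zeta> \<in> Z" for \<zeta> using that w by (auto simp: Z_def)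
    have h0: "h 0 \<noteq> 0" using h(3)[of 0] w by auto
    have "cmod (\<phi> 0 - w) = cmod (h 0) * (\<Prod>\<zeta>\<in>Z. cmod \<zeta> ^ m \<zeta>)"
      using h(2)[of 0] by (simp add: norm_mult norm_power flip: prod_norm)
    hence "ln (cmod (\<phi> 0 - w)) = ln (cmod (h 0)) + ln (\<Prod>\<zeta>\<in>Z. cmod \<zeta> ^ m \<zeta>)"
      using h0 z0 finZ by (subst ln_mult_pos[symmetric]) (auto intro!: prod_pos)
    also have "ln (\<Prod>\<zeta>\<in>Z. cmod \<zeta> ^ m \<zeta>) = (\<Sum>\<zeta>\<in>Z. ln (cmod \<zeta> ^ m \<zeta>))"
      by (rule ln_prod) (use finZ z0 in auto)
    also have "\<dots> = - (\<Sum>z\<in>Z. real (m z) * ln (1 / cmod z))"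
      unfolding sum_negf[symmetric]
      by (intro sum.cong refl) (use z0 in \<open>simp add: ln_realpow ln_div\<close>)
    finally have eq: "ln (cmod (\<phi> 0 - w)) = ln (cmod (h 0)) + - (\<Sum>z\<in>Z. real (m z) * ln (1 / cmod z))" .
    have "(\<Sum>z\<in>Z. real (m z) * ln (1 / cmod z)) \<le> y"
    proof -
      have "z \<in> ball 0 1 \<and> \<phi> z = w" if "z \<in> Z" for z
        using that Zs unfolding Z_def by (metis (mono_tags, lifting) eq_iff_diff_eq_0 mem_Collect_eq subsetD)
      hence "Z \<subseteq> {z \<in> ball 0 1. \<phi> z = w}" by blast
      from le[OF finZ this] show ?thesis by (simp add: m_def)
    qed
    thus ?thesis using eq by (simp add: k_def)
  qed
  have n: "cmod (r * cis t) < R" for t using r R by (simp add: norm_mult)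
  have e: "ln (4 / cmod (k (r * cis t))) = ln 4 - ln (cmod (k (r * cis t)))" for t
    using k0[OF n, of t] by (simp add: ln_div)
  note mk = mean_ln_cmod[OF k k0 r(1) R(1)]
  have "ln (4 / cmod (\<phi> 0 - w)) - y \<le> ln 4 - ln (cmod (k 0))"
    using kk w by (simp add: ln_div)
  also have "\<dots> = (\<integral>t. ln (4 / cmod (k (r * cis t))) \<partial>circ)"
    unfolding e by (subst Bochner_Integration.integral_diff)
       (use mk in \<open>auto simp: measure_circ_UNIV intro!: circ_integral continuous_intros\<close>)
  finally have "ennreal (ln (4 / cmod (\<phi> 0 - w)) - y) \<le> ennreal (\<integral>t. ln (4 / cmod (k (r * cis t))) \<partial>circ)"
    by (rule ennreal_leI)
  also have "\<dots> \<le> (\<integral>\<^sup>+t. ennreal (ln (4 / cmod (k (r * cis t)))) \<partial>circ)"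
    unfolding e by (intro ennreal_integral_le_nn_integral circ_integral continuous_intros mk(1))
  also have "\<dots> \<le> (\<integral>\<^sup>+t. logker (cmod (\<phi> (r * cis t) - w)) \<partial>circ)"
    using k0[OF n] n R by (intro nn_integral_mono logker_antimono dom) (auto intro: less_trans)
  finally show ?thesis .
qed

section \<open>The logarithmic potential of a circle\<close>

lemma mean_ln_dist_circle:
  fixes s :: real
  assumes "s > 0" "cmod x \<noteq> s"
  shows "continuous_on UNIV (\<lambda>t. ln (cmod (x - s * cis t)))"
    and "(\<integral>t. ln (cmod (x - s * cis t)) \<partial>circ) = ln (max (cmod x) s)"
proof -
  have "continuous_on UNIV (\<lambda>t. ln (cmod (x - s * cis t))) \<and>
     (\<integral>t. ln (cmod (x - s * cis t)) \<partial>circ) = ln (max (cmod x) s)"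
  proof (cases "cmod x > s")
    case True
    have "(\<lambda>z. x - z) holomorphic_on ball 0 (cmod x)" by (intro holomorphic_intros)
    from mean_ln_cmod[OF this, of s] True assms(1) show ?thesis by (auto simp: max_def)
  next
    case False
    hence xs: "cmod x < s" using assms by simp
    \<comment> \<open>The zero of s - cnj x * z has modulus s / |x| > 1; for x = 0 there is no zero
      and any R > 1 will do.\<close>
    define R where "R = (if x = 0 then 2 else s / cmod x)"
    have R: "R > 1" using xs assms by (auto simp: R_def)
    \<comment> \<open>Reflection: |x - s u| = |s - cnj x u| for |u| = 1, and the right side has no
      zero u in the closed unit disk.\<close>
    have e: "cmod (x - s * cis t) = cmod (s - cnj x * (of_real 1 * cis t))" for t
    proof -
      have "cis t * cnj (cis t) = 1" using complex_norm_square[of "cis t"] by simp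
      hence "s - cnj x * (of_real 1 * cis t) = - cis t * cnj (x - s * cis t)"
        by (simp add: algebra_simps)
      thus ?thesis by (simp only: norm_mult norm_minus_cancel complex_mod_cnj) simp
    qed
    have "(\<lambda>z. s - cnj x * z) holomorphic_on ball 0 R" by (intro holomorphic_intros)
    moreover have "s - cnj x * z \<noteq> 0" if "cmod z < R" for z
    proof -
      have "cmod (cnj x * z) < s"
        using that assms by (auto simp: norm_mult R_def less_divide_eq mult.commute split: if_splits)
      moreover have "cmod (complex_of_real s) = s" using assms(1) by simp
      ultimately show ?thesis by (metis eq_iff_diff_eq_0 less_irrefl)
    qed
    ultimately show ?thesis unfolding e
      using mean_ln_cmod[of "\<lambda>z. s - cnj x * z" R 1] R xs assms(1) by (auto simp: max_def)
  qed
  thus "continuous_on UNIV (\<lambda>t. ln (cmod (x - s * cis t)))"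
    "(\<integral>t. ln (cmod (x - s * cis t)) \<partial>circ) = ln (max (cmod x) s)" by auto
qed

text \<open>For |x| = s the singularity lies on the circle of integration; that case is approached
  radially from inside, and Fatou's lemma gives the inequality. The hypothesis on x keeps all
  distances at most 4, so that \<open>ennreal\<close> truncates nothing.\<close>

lemma nn_mean_logker_circle:
  fixes s :: real
  assumes s: "s > 0" and x: "cmod x + s \<le> 4"
  shows "(\<integral>\<^sup>+t. logker (cmod (x - s * cis t)) \<partial>circ) \<le> ennreal (ln (4 / max (cmod x) s))"
proof -
  have neq: "(\<integral>\<^sup>+t. logker (cmod (x - s * cis t)) \<partial>circ) = ennreal (ln (4 / max (cmod x) s))"
    if xs: "cmod x \<noteq> s" "cmod x + s \<le> 4" for x
  proof -
    note m = mean_ln_dist_circle[OF s xs(1)]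
    have nz: "x - s * cis t \<noteq> 0" for t
      using xs s by (auto simp: norm_mult)
    have e: "logker (cmod (x - s * cis t)) = ennreal (ln 4 - ln (cmod (x - s * cis t)))" for t
      using nz[of t] by (simp add: logker_def ln_div)
    have le4: "ln (cmod (x - s * cis t)) \<le> ln 4" for t
      using nz[of t] norm_triangle_ineq4[of x "s * cis t"] xs s by (intro ln_mono) (auto simp: norm_mult)
    have "(\<integral>\<^sup>+t. logker (cmod (x - s * cis t)) \<partial>circ) = ennreal (\<integral>t. ln 4 - ln (cmod (x - s * cis t)) \<partial>circ)"
      unfolding e by (rule nn_integral_eq_integral)
        (use m le4 in \<open>auto intro!: circ_integral continuous_intros\<close>)
    also have "(\<integral>t. ln 4 - ln (cmod (x - s * cis t)) \<partial>circ) = ln 4 - ln (max (cmod x) s)"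
      by (subst Bochner_Integration.integral_diff)
         (use m in \<open>auto simp: measure_circ_UNIV intro!: circ_integral continuous_intros\<close>)
    also have "\<dots> = ln (4 / max (cmod x) s)" using s by (simp add: ln_div)
    finally show ?thesis .
  qed
  show ?thesis
  proof (cases "cmod x = s")
    case False
    thus ?thesis using neq[OF False x] by simp
  next
    case True
    define X where "X k = x * of_real (1 - inverse (real (k + 2)))" for k
    have Xn: "cmod (X k) = s * (1 - inverse (real (k + 2)))" for k
      unfolding X_def norm_mult True norm_of_real by (simp add: inverse_le_1_iff)
    have Xs: "cmod (X k) < s" for k unfolding Xn using s by (simp add: algebra_simps)
    have int: "(\<lambda>k. inverse (real (k + 2))) \<longlonglongrightarrow> 0"
      using LIMSEQ_ignore_initial_segment[OF lim_inverse_n, of 2] by simp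
    have "X \<longlonglongrightarrow> x * of_real (1 - 0)" unfolding X_def by (intro tendsto_intros int)
    hence Xl: "X \<longlonglongrightarrow> x" by simp
    have lim: "(\<lambda>k. logker (cmod (X k - s * cis t))) \<longlonglongrightarrow> logker (cmod (x - s * cis t))" for t
    proof (cases "x = s * cis t")
      case True
      have "cmod (X k - s * cis t) = s / real (k + 2)" for k
      proof -
        have "X k - s * cis t = - x * of_real (inverse (real (k + 2)))"
          unfolding X_def True[symmetric] by (simp add: algebra_simps)
        hence "cmod (X k - s * cis t) = cmod x * \<bar>inverse (real (k + 2))\<bar>"
          by (simp only: norm_mult norm_minus_cancel norm_of_real)
        thus ?thesis using \<open>cmod x = s\<close> by (simp add: divide_inverse)
      qed
      moreover have "filterlim (\<lambda>k. ln (4 / (s / real (k + 2)))) at_top sequentially"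
      proof (rule filterlim_compose[OF ln_at_top])
        have "filterlim (\<lambda>k. 4 / s * real (k + 2)) at_top sequentially"
          by (rule filterlim_tendsto_pos_mult_at_top[OF tendsto_const])
             (use s in \<open>auto intro!: filterlim_tendsto_add_at_top[OF tendsto_const] filterlim_real_sequentially\<close>)
        thus "filterlim (\<lambda>k. 4 / (s / real (k + 2))) at_top sequentially" by simp
      qed
      ultimately show ?thesis using True s
        by (simp add: logker_def ennreal_tendsto_top_eq_at_top)
    next
      case False
      have "X k - s * cis t \<noteq> 0" for k using Xs[of k] s by (auto simp: norm_mult)
      thus ?thesis using False
        by (auto simp: logker_def intro!: tendsto_ennrealI tendsto_intros Xl)
    qed
    have "(\<integral>\<^sup>+t. logker (cmod (x - s * cis t)) \<partial>circ) = (\<integral>\<^sup>+t. liminf (\<lambda>k. logker (cmod (X k - s * cis t))) \<partial>circ)"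
      by (intro nn_integral_cong lim_imp_Liminf[symmetric] lim) auto
    also have "\<dots> \<le> liminf (\<lambda>k. \<integral>\<^sup>+t. logker (cmod (X k - s * cis t)) \<partial>circ)"
    proof (rule nn_integral_liminf)
      fix k
      have "(\<lambda>t. cmod (X k - s * cis t)) \<in> borel_measurable borel"
        by (intro borel_measurable_continuous_onI continuous_intros)
      thus "(\<lambda>t. logker (cmod (X k - s * cis t))) \<in> borel_measurable circ"
        unfolding measurable_cong_sets[OF sets_circ refl] by measurable
    qed
    also have "\<dots> = ennreal (ln (4 / s))"
    proof -
      have "(\<integral>\<^sup>+t. logker (cmod (X k - s * cis t)) \<partial>circ) = ennreal (ln (4 / s))" for k
        using neq[of "X k"] Xs[of k] x True s by (simp add: max_def)
      thus ?thesis by (simp add: Liminf_const)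
    qed
    finally show ?thesis using True by simp
  qed
qed

text \<open>\<open>ln\<^sup>+ (s / \<bar>z - b\<bar>) = ln max(\<bar>z - b\<bar>, s) - ln \<bar>z - b\<bar>\<close> is the average over the circle of centre
  \<open>b\<close> and radius \<open>s\<close> of logarithmic potentials, up to a function harmonic in the disk; Jensen's
  inequality therefore bounds its mean along \<open>\<phi>\<close> by counting functions on that circle.\<close>

lemma measure_near_boundary_point:
  fixes r s y :: real
  assumes \<phi>: "\<phi> holomorphic_on ball 0 1" "\<phi> ` ball 0 1 \<subseteq> ball 0 1"
    and b: "cmod b = 1" and s: "0 < s" "s \<le> 1" "s < cmod (\<phi> 0 - b)" and r: "0 \<le> r" "r < 1"
    and le: "\<And>\<tau> Z. finite Z \<Longrightarrow> Z \<subseteq> {z \<in> ball 0 1. \<phi> z = b + s * cis \<tau>} \<Longrightarrow>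
      (\<Sum>z\<in>Z. real (nat (zorder (\<lambda>x. \<phi> x - (b + s * cis \<tau>)) z)) * ln (1 / cmod z)) \<le> y"
  shows "measure circ {t. cmod (\<phi> (r * cis t) - b) \<le> s / 2} * ln 2 \<le> y"
proof -
  interpret sigma_finite_measure circ by (rule sigma_finite_circ)
  interpret P: pair_sigma_finite circ circ by unfold_locales
  define \<psi> where "\<psi> t = \<phi> (r * cis t)" for t
  have c\<psi>: "continuous_on UNIV \<psi>" unfolding \<psi>_def by (rule continuous_on_circle[OF \<phi>(1) r])
  have \<psi>1: "cmod (\<psi> t) < 1" for t
  proof -
    have "\<phi> (r * cis t) \<in> ball 0 1" using \<phi>(2) by (rule subsetD) (use r in \<open>simp add: norm_mult\<close>)
    thus ?thesis by (simp add: \<psi>_def)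
  qed
  have \<psi>b: "\<psi> t \<noteq> b" for t using \<psi>1[of t] b by auto
  have \<psi>b2: "cmod (\<psi> t - b) \<le> 2" for t
    using norm_triangle_ineq4[of "\<psi> t" b] \<psi>1[of t] b by linarith
  define p where "p = \<phi> 0"
  have p1: "cmod p < 1" using \<phi>(2) by (auto simp: p_def image_subset_iff)
  have pb: "p \<noteq> b" using p1 b by auto
  \<comment> \<open>The circle consists of points at distance s from b, and \<phi> 0 is farther
    away, so Jensen's inequality applies at each of them.\<close>
  have pne: "b + s * cis \<tau> \<noteq> \<phi> 0" for \<tau>
    using s by (auto simp: norm_mult algebra_simps dest!: sym[of _ "\<phi> 0"])
  have meas: "(\<lambda>(t, \<tau>). logker (cmod (\<psi> t - (b + s * cis \<tau>)))) \<in> borel_measurable (circ \<Otimes>\<^sub>M circ)"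
  proof -
    have "(\<lambda>x. cmod (\<psi> (fst x) - (b + s * cis (snd x)))) \<in> borel_measurable (borel :: (real \<times> real) measure)"
      by (intro borel_measurable_continuous_onI continuous_intros continuous_on_compose2[OF c\<psi>]) auto
    moreover have "sets (circ \<Otimes>\<^sub>M circ) = sets (borel :: (real \<times> real) measure)"
      by (simp add: borel_prod[symmetric] cong: sets_pair_measure_cong)
    ultimately have "(\<lambda>x. cmod (\<psi> (fst x) - (b + s * cis (snd x)))) \<in> borel_measurable (circ \<Otimes>\<^sub>M circ)"
      by (simp cong: measurable_cong_sets)
    thus ?thesis unfolding case_prod_unfold by measurable
  qed
  have cmax: "continuous_on UNIV (\<lambda>t. ln (4 / max (cmod (\<psi> t - b)) s))"
    using s by (intro continuous_intros c\<psi>) (auto simp: max_def)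
  have max2: "max (cmod (\<psi> t - b)) s \<le> 2" for t using \<psi>b2[of t] s by auto
  have "ennreal (ln (4 / cmod (p - b)) - y) \<le> ennreal (\<integral>\<tau>. ln (4 / cmod (p - b - s * cis \<tau>)) - y \<partial>circ)"
  proof -
    have sp: "s < cmod (p - b)" using s by (simp add: p_def)
    have nz: "p - b - s * cis \<tau> \<noteq> 0" for \<tau>
      using sp s by (auto simp: norm_mult)
    have e: "ln (4 / cmod (p - b - s * cis \<tau>)) = ln 4 - ln (cmod (p - b - s * cis \<tau>))" for \<tau>
      using nz[of \<tau>] by (simp add: ln_div)
    note m = mean_ln_dist_circle[OF s(1), of "p - b"]
    have "(\<integral>\<tau>. ln (4 / cmod (p - b - s * cis \<tau>)) - y \<partial>circ) = ln 4 - ln (cmod (p - b)) - y"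
      unfolding e using m sp
      by (simp add: Bochner_Integration.integral_diff circ_integral continuous_on_diff continuous_on_const measure_circ_UNIV max_def)
    thus ?thesis using pb by (simp add: ln_div)
  qed
  also have "\<dots> \<le> (\<integral>\<^sup>+\<tau>. ennreal (ln (4 / cmod (p - b - s * cis \<tau>)) - y) \<partial>circ)"
  proof (rule ennreal_integral_le_nn_integral, rule circ_integral)
    have nz: "p - b - s * cis \<tau> \<noteq> 0" for \<tau>
      using s by (auto simp: norm_mult p_def)
    show "continuous_on UNIV (\<lambda>\<tau>. ln (4 / cmod (p - b - s * cis \<tau>)) - y)"
      using nz by (intro continuous_intros) auto
  qed
  also have "\<dots> \<le> (\<integral>\<^sup>+\<tau>. (\<integral>\<^sup>+t. logker (cmod (\<psi> t - (b + s * cis \<tau>))) \<partial>circ) \<partial>circ)"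
  proof (rule nn_integral_mono)
    fix \<tau>
    show "ennreal (ln (4 / cmod (p - b - s * cis \<tau>)) - y) \<le> (\<integral>\<^sup>+t. logker (cmod (\<psi> t - (b + s * cis \<tau>))) \<partial>circ)"
      using Jensen_inequality[OF \<phi>(1) pne[of \<tau>] r le]
      by (simp add: \<psi>_def p_def algebra_simps)
  qed
  also have "\<dots> = (\<integral>\<^sup>+t. (\<integral>\<^sup>+\<tau>. logker (cmod (\<psi> t - (b + s * cis \<tau>))) \<partial>circ) \<partial>circ)"
    using P.Fubini'[OF meas] by simp
  also have "\<dots> \<le> (\<integral>\<^sup>+t. ennreal (ln (4 / max (cmod (\<psi> t - b)) s)) \<partial>circ)"
  proof (rule nn_integral_mono)
    fix t
    show "(\<integral>\<^sup>+\<tau>. logker (cmod (\<psi> t - (b + s * cis \<tau>))) \<partial>circ) \<le> ennreal (ln (4 / max (cmod (\<psi> t - b)) s))"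
      using nn_mean_logker_circle[OF s(1), of "\<psi> t - b"] \<psi>b2[of t] s by (simp add: diff_diff_eq)
  qed
  also have "\<dots> = ennreal (\<integral>t. ln (4 / max (cmod (\<psi> t - b)) s) \<partial>circ)"
  proof (rule nn_integral_eq_integral)
    show "AE t in circ. 0 \<le> ln (4 / max (cmod (\<psi> t - b)) s)"
      using max2 s by (intro AE_I2 ln_ge_zero) (simp add: le_divide_eq less_max_iff_disj del: max_less_iff_conj max.bounded_iff; fastforce intro: order_trans)
  qed (rule circ_integral[OF cmax])
  \<comment> \<open>\<open>ennreal\<close> may have truncated the left side; this is harmless
    because the right side is nonnegative.\<close>
  finally have A: "ln (4 / cmod (p - b)) - y \<le> (\<integral>t. ln (4 / max (cmod (\<psi> t - b)) s) \<partial>circ)"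
  proof (subst (asm) ennreal_le_iff)
    show "0 \<le> (\<integral>t. ln (4 / max (cmod (\<psi> t - b)) s) \<partial>circ)"
    proof (rule integral_nonneg_AE, rule AE_I2)
      fix t
      have "4 / max (cmod (\<psi> t - b)) s \<ge> 1" using max2[of t] s by (simp add: le_divide_eq less_max_iff_disj)
      thus "0 \<le> ln (4 / max (cmod (\<psi> t - b)) s)" by (rule ln_ge_zero)
    qed
  qed auto
  \<comment> \<open>b lies on the unit circle, outside the range of \<phi>, so here the logarithmic
    mean is an equality.\<close>
  have "(\<lambda>z. \<phi> z - b) holomorphic_on ball 0 1" by (intro holomorphic_intros \<phi>)
  moreover have "\<phi> z - b \<noteq> 0" if "cmod z < 1" for z
  proof -
    have "\<phi> z \<in> ball 0 1" using \<phi>(2) by (rule subsetD) (use that in simp)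
    thus ?thesis using b by auto
  qed
  ultimately have mb: "continuous_on UNIV (\<lambda>t. ln (cmod (\<psi> t - b)))"
    "(\<integral>t. ln (cmod (\<psi> t - b)) \<partial>circ) = ln (cmod (p - b))"
    unfolding \<psi>_def p_def using mean_ln_cmod[of "\<lambda>z. \<phi> z - b" 1 r] r by auto
  define g where "g t = ln 4 - ln (cmod (\<psi> t - b)) - ln (4 / max (cmod (\<psi> t - b)) s)" for t
  have cg: "continuous_on UNIV g" unfolding g_def by (intro continuous_intros mb cmax)
  have "(\<integral>t. g t \<partial>circ) = ln 4 - ln (cmod (p - b)) - (\<integral>t. ln (4 / max (cmod (\<psi> t - b)) s) \<partial>circ)"
    unfolding g_def using mb cmax
    by (simp add: Bochner_Integration.integral_diff circ_integral continuous_on_diff continuous_on_const measure_circ_UNIV)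
  also have "\<dots> \<le> y" using A pb by (simp add: ln_div)
  finally have gy: "(\<integral>t. g t \<partial>circ) \<le> y" .
  define E where "E = {t. cmod (\<psi> t - b) \<le> s / 2}"
  have "closed E" unfolding E_def by (intro closed_Collect_le continuous_intros c\<psi>)
  hence E: "E \<in> sets circ" by simp
  have geq: "g t = ln (max (cmod (\<psi> t - b)) s / cmod (\<psi> t - b))" for t
    using \<psi>b[of t] s by (simp add: g_def ln_div max_def)
  have gE: "indicator E t * ln 2 \<le> g t" for t
  proof (cases "t \<in> E")
    case True
    hence "2 \<le> max (cmod (\<psi> t - b)) s / cmod (\<psi> t - b)"
      using \<psi>b[of t] by (auto simp: E_def le_divide_eq)
    hence "ln 2 \<le> g t" unfolding geq by (intro ln_mono) auto
    thus ?thesis using True by simp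
  next
    case False
    have "1 \<le> max (cmod (\<psi> t - b)) s / cmod (\<psi> t - b)"
      using \<psi>b[of t] by (auto simp: le_divide_eq)
    hence "0 \<le> g t" unfolding geq by (rule ln_ge_zero)
    thus ?thesis using False by simp
  qed
  have intE: "integrable circ (indicator E :: real \<Rightarrow> real)"
    using E finite_measure.emeasure_finite[OF finite_measure_circ, of E]
    by (intro integrable_real_indicator) (auto simp: less_top)
  have "measure circ E * ln 2 = (\<integral>t. indicator E t * ln 2 \<partial>circ)"
    using E by simp
  also have "\<dots> \<le> (\<integral>t. g t \<partial>circ)"
    by (intro integral_mono integrable_mult_left intE circ_integral cg gE)
  finally show ?thesis using gy by (simp add: E_def \<psi>_def)
qed

section \<open>A Carleson embedding for derivatives\<close>

text \<open>Cauchy's formula at \<open>\<zeta>\<close> for \<open>F\<^sup>2 \<kappa>\<^sup>q\<close>, where \<open>\<kappa> z = (1 - \<bar>\<zeta>\<bar>\<^sup>2) / (1 - cnj \<zeta> z)\<close> equals 1 at \<open>\<zeta>\<close> and supplies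
  the decay away from \<open>\<zeta>\<close>.\<close>

lemma pointwise_circle_bound:
  fixes h :: real
  assumes F: "F holomorphic_on ball 0 1" and h: "0 < h" "h \<le> 1"
    and \<zeta>: "h / 2 < 1 - cmod \<zeta>" "1 - cmod \<zeta> \<le> h"
  shows "(cmod (F \<zeta>))\<^sup>2 \<le>
    (\<integral>\<tau>. (cmod (F ((1 - h/4) * cis \<tau>)))\<^sup>2 * (4 / h * (3 * h) ^ q / cmod (cis \<tau> - \<zeta>) ^ q) \<partial>circ)"
    and "continuous_on UNIV (\<lambda>\<tau>. (cmod (F ((1 - h/4) * cis \<tau>)))\<^sup>2 * (4 / h * (3 * h) ^ q / cmod (cis \<tau> - \<zeta>) ^ q))"
proof -
  \<comment> \<open>A circle between the layer and the boundary, at distance at least h/4 from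
    \<zeta>; this is the origin of the factor 4/h.\<close>
  define \<rho> where "\<rho> = 1 - h / 4"
  have \<rho>: "0 < \<rho>" "\<rho> < 1" "cmod \<zeta> < \<rho>" using h \<zeta> by (auto simp: \<rho>_def)
  have \<zeta>1: "cmod \<zeta> < 1" using \<rho> by simp
  define \<kappa> where "\<kappa> z = of_real (1 - (cmod \<zeta>)\<^sup>2) / (1 - cnj \<zeta> * z)" for z
  define G where "G z = (F z)\<^sup>2 * \<kappa> z ^ q" for z
  have \<kappa>\<zeta>: "\<kappa> \<zeta> = 1"
  proof -
    have "1 - cnj \<zeta> * \<zeta> = of_real (1 - (cmod \<zeta>)\<^sup>2)"
      using complex_norm_square[of \<zeta>] by (simp add: mult.commute)
    thus ?thesis using szego_denom[OF \<zeta>1 \<zeta>1] by (simp add: \<kappa>_def)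
  qed
  have G: "G holomorphic_on ball 0 1"
    unfolding G_def \<kappa>_def using szego_denom[OF \<zeta>1] by (intro holomorphic_intros F) auto
  have nz: "cis \<tau> - \<zeta> \<noteq> 0" for \<tau> using \<zeta>1 by auto
  have nz': "of_real \<rho> * cis \<tau> - \<zeta> \<noteq> 0" for \<tau> using \<rho> by (auto simp: norm_mult)
  have cF: "continuous_on UNIV (\<lambda>\<tau>. F (of_real \<rho> * cis \<tau>))"
    by (rule continuous_on_circle[OF F]) (use \<rho> in auto)
  have cG: "continuous_on UNIV (\<lambda>\<tau>. G (of_real \<rho> * cis \<tau>))"
    by (rule continuous_on_circle[OF G]) (use \<rho> in auto)
  have cR: "continuous_on UNIV (\<lambda>\<tau>. (cmod (F (of_real \<rho> * cis \<tau>)))\<^sup>2 * (4 / h * (3 * h) ^ q / cmod (cis \<tau> - \<zeta>) ^ q))"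
    using nz by (intro continuous_intros cF) auto
  have "cmod (G (of_real \<rho> * cis \<tau>) * (of_real \<rho> * cis \<tau>) / (of_real \<rho> * cis \<tau> - \<zeta>)) \<le>
      (cmod (F (of_real \<rho> * cis \<tau>)))\<^sup>2 * (4 / h * (3 * h) ^ q / cmod (cis \<tau> - \<zeta>) ^ q)" for \<tau>
  proof -
    define z where "z = of_real \<rho> * cis \<tau>"
    \<comment> \<open>Distances are measured to the boundary point \<open>cis \<tau>\<close> instead
      of z, because the Carleson bound concerns balls about boundary points; the cost is a factor
      3/2, which gives the constant 3.\<close>
    define d where "d = cmod (cis \<tau> - \<zeta>)"
    have d0: "d > 0" using nz by (simp add: d_def)
    have zn: "cmod z = \<rho>" using \<rho> by (simp add: z_def norm_mult)
    have "cis \<tau> * cnj (cis \<tau>) = 1" using complex_norm_square[of "cis \<tau>"] by simp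
    hence "1 - cnj \<zeta> * z = cis \<tau> * cnj (cis \<tau> - of_real \<rho> * \<zeta>)"
      unfolding z_def by (simp add: algebra_simps)
    hence D1: "cmod (1 - cnj \<zeta> * z) = cmod (cis \<tau> - of_real \<rho> * \<zeta>)"
      by (simp only: norm_mult complex_mod_cnj) simp
    have "d \<le> cmod (cis \<tau> - of_real \<rho> * \<zeta>) + cmod (\<zeta> - of_real \<rho> * \<zeta>)"
      unfolding d_def using norm_triangle_ineq4[of "cis \<tau> - of_real \<rho> * \<zeta>" "\<zeta> - of_real \<rho> * \<zeta>"] by simp
    moreover have "cmod (\<zeta> - of_real \<rho> * \<zeta>) \<le> h / 4"
    proof -
      have "\<zeta> - of_real \<rho> * \<zeta> = of_real (h / 4) * \<zeta>" by (simp add: \<rho>_def algebra_simps)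
      moreover have "h / 4 * cmod \<zeta> \<le> h / 4 * 1" using h \<zeta>1 by (intro mult_left_mono) auto
      ultimately show ?thesis using h by (simp only: norm_mult norm_of_real)
    qed
    moreover have "h / 2 \<le> cmod (1 - cnj \<zeta> * z)"
    proof -
      have "cmod (cnj \<zeta> * z) \<le> cmod \<zeta>" using zn \<rho> by (simp add: norm_mult mult_right_le_one_le)
      moreover have "cmod 1 - cmod (cnj \<zeta> * z) \<le> cmod (1 - cnj \<zeta> * z)" by (rule norm_triangle_ineq2)
      ultimately show ?thesis using \<zeta>(1) by simp
    qed
    ultimately have D2: "2 / 3 * d \<le> cmod (1 - cnj \<zeta> * z)" using D1 by linarith
    have "1 - (cmod \<zeta>)\<^sup>2 = (1 - cmod \<zeta>) * (1 + cmod \<zeta>)" by (simp add: power2_eq_square algebra_simps)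
    also have "\<dots> \<le> h * 2" using \<zeta> \<zeta>1 h by (intro mult_mono) auto
    finally have N: "1 - (cmod \<zeta>)\<^sup>2 \<le> 2 * h" by simp
    have "(cmod \<zeta>)\<^sup>2 \<le> 1" using \<zeta>1 by (simp add: power_le_one)
    hence "cmod (\<kappa> z) = (1 - (cmod \<zeta>)\<^sup>2) / cmod (1 - cnj \<zeta> * z)"
      unfolding \<kappa>_def norm_divide norm_of_real by simp
    also have "\<dots> \<le> 2 * h / (2 / 3 * d)"
      using N D2 d0 \<open>(cmod \<zeta>)\<^sup>2 \<le> 1\<close> by (intro frac_le) auto
    also have "\<dots> = 3 * h / d" by simp
    finally have K: "cmod (\<kappa> z) \<le> 3 * h / d" .
    have "cmod (z - \<zeta>) \<ge> cmod z - cmod \<zeta>" by (rule norm_triangle_ineq2)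
    hence L: "cmod (z - \<zeta>) \<ge> h / 4" using zn \<zeta> by (simp add: \<rho>_def)
    have "cmod (G z * z / (z - \<zeta>)) = (cmod (F z))\<^sup>2 * (cmod (\<kappa> z) ^ q * (\<rho> / cmod (z - \<zeta>)))"
      by (simp add: G_def norm_mult norm_divide norm_power zn)
    also have "\<dots> \<le> (cmod (F z))\<^sup>2 * ((3 * h / d) ^ q * (1 / (h / 4)))"
      using \<rho> h L d0 by (intro mult_left_mono mult_mono power_mono K frac_le) auto
    also have "\<dots> = (cmod (F z))\<^sup>2 * (4 / h * (3 * h) ^ q / d ^ q)"
      by (simp add: power_divide mult_ac)
    finally show ?thesis by (simp add: z_def d_def)
  qed
  note pw = this
  have "F \<zeta> ^ 2 = G \<zeta>" by (simp add: G_def \<kappa>\<zeta>)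
  also have "\<dots> = (\<integral>\<tau>. G (of_real \<rho> * cis \<tau>) * (of_real \<rho> * cis \<tau>) / (of_real \<rho> * cis \<tau> - \<zeta>) \<partial>circ)"
    using circ_Cauchy_higher[OF G \<rho>(1,2,3), of 0] by simp
  finally have "(cmod (F \<zeta>))\<^sup>2 = cmod (\<integral>\<tau>. G (of_real \<rho> * cis \<tau>) * (of_real \<rho> * cis \<tau>) / (of_real \<rho> * cis \<tau> - \<zeta>) \<partial>circ)"
    by (metis norm_power)
  also have "\<dots> \<le> (\<integral>\<tau>. cmod (G (of_real \<rho> * cis \<tau>) * (of_real \<rho> * cis \<tau>) / (of_real \<rho> * cis \<tau> - \<zeta>)) \<partial>circ)"
    by (rule integral_norm_bound)
  also have "\<dots> \<le> (\<integral>\<tau>. (cmod (F (of_real \<rho> * cis \<tau>)))\<^sup>2 * (4 / h * (3 * h) ^ q / cmod (cis \<tau> - \<zeta>) ^ q) \<partial>circ)"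
    using nz' by (intro integral_mono circ_integral cR pw continuous_intros cG) auto
  finally show "(cmod (F \<zeta>))\<^sup>2 \<le>
    (\<integral>\<tau>. (cmod (F ((1 - h/4) * cis \<tau>)))\<^sup>2 * (4 / h * (3 * h) ^ q / cmod (cis \<tau> - \<zeta>) ^ q) \<partial>circ)"
    by (simp add: \<rho>_def)
  show "continuous_on UNIV (\<lambda>\<tau>. (cmod (F ((1 - h/4) * cis \<tau>)))\<^sup>2 * (4 / h * (3 * h) ^ q / cmod (cis \<tau> - \<zeta>) ^ q))"
    using cR by (simp add: \<rho>_def)
qed

text \<open>The term with \<open>K\<close> accounts for the scales \<open>s\<close> at which the decay hypothesis says nothing: it exceeds
  the total mass 1 there, and its larger exponent makes it negligible as \<open>s\<close> tends to 0.\<close>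

definition carleson_bound :: "nat \<Rightarrow> real \<Rightarrow> real \<Rightarrow> (real \<Rightarrow> complex) \<Rightarrow> bool" where
  "carleson_bound n \<epsilon> K \<psi> \<longleftrightarrow> continuous_on UNIV \<psi> \<and> (\<forall>t. cmod (\<psi> t) < 1) \<and>
     (\<forall>b s. cmod b = 1 \<longrightarrow> 0 < s \<longrightarrow>
        measure circ {t. cmod (\<psi> t - b) \<le> s} \<le> \<epsilon> * s ^ (2*n+1) + K * s ^ (2*n+2))"

definition layer :: "(real \<Rightarrow> complex) \<Rightarrow> real \<Rightarrow> real set" where
  "layer \<psi> h = {t. h / 2 < 1 - cmod (\<psi> t) \<and> 1 - cmod (\<psi> t) \<le> h}"

lemma layer_sets:
  assumes "continuous_on UNIV \<psi>"
  shows "layer \<psi> h \<in> sets borel"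
proof -
  have "(\<lambda>t. 1 - cmod (\<psi> t)) \<in> borel_measurable borel"
    by (intro borel_measurable_continuous_onI continuous_intros assms)
  thus ?thesis unfolding layer_def by measurable
qed

lemma dyadic_annulus:
  fixes d h :: real
  assumes h: "0 < h" "h / 2 \<le> d" and M: "d \<le> 2 ^ M * h"
  obtains m where "m \<le> M" "d \<le> 2 ^ m * h" "2 ^ m * h / 2 \<le> d"
proof -
  define m where "m = (LEAST m. d \<le> 2 ^ m * h)"
  have m: "d \<le> 2 ^ m * h" "m \<le> M" unfolding m_def using M by (auto intro: LeastI Least_le)
  have "2 ^ m * h / 2 \<le> d"
  proof (cases m)
    case (Suc k)
    have "\<not> d \<le> 2 ^ k * h" using Suc not_less_Least[of k "\<lambda>m. d \<le> 2 ^ m * h"] by (auto simp: m_def)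
    thus ?thesis using Suc by simp
  qed (use h in simp)
  thus ?thesis using that m by blast
qed

text \<open>A sum over dyadic annuli about \<open>cis \<tau>\<close>. On the m-th annulus the kernel
  is at most (4/h) (6/2^m)^q and the mass at most \<epsilon> (2^m h)^(2n+1) + K (2^m h)^(2n+2). With
  q = 2n+3 the two products decay like 4^(-m) and 2^(-m); with one power less the K part would not
  decay.\<close>

lemma layer_kernel_bound:
  assumes \<psi>: "carleson_bound n \<epsilon> K \<psi>" and \<epsilon>: "\<epsilon> \<ge> 0" "K \<ge> 0" and h: "0 < h" "h \<le> 1"
  shows "(\<integral>\<^sup>+t. indicator (layer \<psi> h) t * ennreal (4 / h * (3 * h) ^ (2*n+3) / cmod (cis \<tau> - \<psi> t) ^ (2*n+3)) \<partial>circ)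
    \<le> ennreal (8 * 6 ^ (2*n+3) * (\<epsilon> * h ^ (2*n) + K * h ^ (2*n+1)))"
proof -
  have c\<psi>: "continuous_on UNIV \<psi>" and \<psi>1: "\<And>t. cmod (\<psi> t) < 1"
    and mb: "\<And>b s. cmod b = 1 \<Longrightarrow> 0 < s \<Longrightarrow>
        measure circ {t. cmod (\<psi> t - b) \<le> s} \<le> \<epsilon> * s ^ (2*n+1) + K * s ^ (2*n+2)"
    using \<psi> by (auto simp: carleson_bound_def)
  define q where "q = 2*n+3"
  \<comment> \<open>All distances from \<open>cis \<tau>\<close> to values of \<psi> are less than
    2, so the annuli up to index M cover them.\<close>
  obtain M where "2 / h < 2 ^ M" using real_arch_pow[of 2 "2/h"] by auto
  hence M: "2 \<le> 2 ^ M * h" using h by (simp add: divide_less_eq)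
  define E where "E m = {t. cmod (\<psi> t - cis \<tau>) \<le> 2 ^ m * h}" for m :: nat
  define c where "c m = 4 / h * (3 * h) ^ q * (2 / (2 ^ m * h)) ^ q" for m :: nat
  have c0: "c m \<ge> 0" for m using h by (simp add: c_def)
  have "closed (E m)" for m unfolding E_def by (intro closed_Collect_le continuous_intros c\<psi>)
  hence E: "E m \<in> sets circ" for m by simp
  have intE: "integrable circ (indicator (E m) :: real \<Rightarrow> real)" for m
    using E finite_measure.emeasure_finite[OF finite_measure_circ, of "E m"]
    by (intro integrable_real_indicator) (auto simp: less_top)
  have pw: "indicator (layer \<psi> h) t * ennreal (4 / h * (3 * h) ^ q / cmod (cis \<tau> - \<psi> t) ^ q)
      \<le> ennreal (\<Sum>m\<le>M. c m * indicator (E m) t)" for t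
  proof (cases "t \<in> layer \<psi> h")
    case True
    define d where "d = cmod (cis \<tau> - \<psi> t)"
    have "cmod (cis \<tau>) - cmod (\<psi> t) \<le> d" unfolding d_def by (rule norm_triangle_ineq2)
    hence d1: "h / 2 \<le> d" using True by (simp add: layer_def)
    have d2: "d \<le> 2 ^ M * h"
      using norm_triangle_ineq4[of "cis \<tau>" "\<psi> t"] \<psi>1[of t] M by (simp add: d_def)
    obtain m where m: "m \<le> M" "d \<le> 2 ^ m * h" "2 ^ m * h / 2 \<le> d"
      using dyadic_annulus[OF h(1) d1 d2] by blast
    have d0: "d > 0" using d1 h by linarith
    have "1 / d \<le> 2 / (2 ^ m * h)" using m(3) d0 h by (simp add: field_simps)
    hence "(1 / d) ^ q \<le> (2 / (2 ^ m * h)) ^ q" using d0 by (intro power_mono) auto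
    hence "4 / h * (3 * h) ^ q * (1 / d) ^ q \<le> c m"
      unfolding c_def using h by (intro mult_left_mono) auto
    hence "4 / h * (3 * h) ^ q / d ^ q \<le> c m * indicator (E m) t"
      using m(2) by (simp add: E_def d_def norm_minus_commute power_divide)
    also have "\<dots> \<le> (\<Sum>m\<le>M. c m * indicator (E m) t)"
      using m(1) c0 by (intro member_le_sum) auto
    finally show ?thesis using True by (simp add: d_def ennreal_leI)
  qed simp
  have "(\<integral>\<^sup>+t. indicator (layer \<psi> h) t * ennreal (4 / h * (3 * h) ^ q / cmod (cis \<tau> - \<psi> t) ^ q) \<partial>circ)
      \<le> (\<integral>\<^sup>+t. ennreal (\<Sum>m\<le>M. c m * indicator (E m) t) \<partial>circ)"
    by (intro nn_integral_mono pw)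
  also have "\<dots> = ennreal (\<integral>t. (\<Sum>m\<le>M. c m * indicator (E m) t) \<partial>circ)"
    by (intro nn_integral_eq_integral Bochner_Integration.integrable_sum integrable_mult_right intE)
       (auto intro!: sum_nonneg mult_nonneg_nonneg c0)
  also have "(\<integral>t. (\<Sum>m\<le>M. c m * indicator (E m) t) \<partial>circ) = (\<Sum>m\<le>M. c m * measure circ (E m))"
    using E by (subst Bochner_Integration.integral_sum) (auto intro!: integrable_mult_right intE)
  also have "\<dots> \<le> (\<Sum>m\<le>M. 4 * 6 ^ q * (\<epsilon> * h ^ (2*n) + K * h ^ (2*n+1)) * (1/2) ^ m)"
  proof (rule sum_mono)
    fix m
    define x where "x = (2::real) ^ m"
    have x: "x \<ge> 1" by (simp add: x_def)
    have "c m = 4 * 6 ^ q / (h * x ^ q)"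
    proof -
      have "(3 * h) ^ q * (2 / (x * h)) ^ q = (6 / x) ^ q"
        unfolding power_mult_distrib[symmetric] using h x by (simp add: field_simps)
      hence "c m = 4 / h * (6 / x) ^ q" by (simp add: c_def x_def mult.assoc)
      thus ?thesis by (simp add: power_divide)
    qed
    moreover have "measure circ (E m) \<le> \<epsilon> * (x * h) ^ (2*n+1) + K * (x * h) ^ (2*n+2)"
      unfolding E_def x_def using h by (intro mb) auto
    ultimately have "c m * measure circ (E m) \<le> 4 * 6 ^ q / (h * x ^ q) * (\<epsilon> * (x * h) ^ (2*n+1) + K * (x * h) ^ (2*n+2))"
      using c0[of m] by (metis mult_left_mono)
    also have "\<dots> = 4 * 6 ^ q * (\<epsilon> * h ^ (2*n) * ((1/x) * (1/x)) + K * h ^ (2*n+1) * (1/x))"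
    proof -
      have "x ^ q = x ^ (2*n+1) * x * x" "x ^ (2*n+2) = x ^ (2*n+1) * x" "h ^ (2*n+2) = h ^ (2*n+1) * h" "h ^ (2*n+1) = h ^ (2*n) * h"
        by (simp_all add: q_def power_add power2_eq_square power3_eq_cube)
      thus ?thesis using x h by (simp add: power_mult_distrib divide_simps) (simp add: algebra_simps)
    qed
    \<comment> \<open>One factor 1/x <= 1 of the \<epsilon> part is dropped, so that both parts
      share the ratio 1/2.\<close>
    also have "\<dots> \<le> 4 * 6 ^ q * (\<epsilon> * h ^ (2*n) * (1 * (1/x)) + K * h ^ (2*n+1) * (1/x))"
      using x h \<epsilon> by (intro mult_left_mono add_mono mult_right_mono) auto
    also have "\<dots> = 4 * 6 ^ q * (\<epsilon> * h ^ (2*n) + K * h ^ (2*n+1)) * (1/2) ^ m"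
      by (simp add: x_def power_divide algebra_simps)
    finally show "c m * measure circ (E m) \<le> 4 * 6 ^ q * (\<epsilon> * h ^ (2*n) + K * h ^ (2*n+1)) * (1/2) ^ m" .
  qed
  also have "\<dots> = 4 * 6 ^ q * (\<epsilon> * h ^ (2*n) + K * h ^ (2*n+1)) * (\<Sum>m\<le>M. (1/2) ^ m)"
    by (rule sum_distrib_left[symmetric])
  also have "\<dots> \<le> 4 * 6 ^ q * (\<epsilon> * h ^ (2*n) + K * h ^ (2*n+1)) * 2"
  proof (rule mult_left_mono)
    have "(\<Sum>m<Suc M. (1/2::real) ^ m) \<le> (\<Sum>m. (1/2) ^ m)"
      by (rule sum_le_suminf) auto
    thus "(\<Sum>m\<le>M. (1/2::real) ^ m) \<le> 2"
      by (simp add: suminf_geometric lessThan_Suc_atMost)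
  qed (use h \<epsilon> in auto)
  finally show ?thesis by (simp add: q_def ennreal_leI mult_ac)
qed

text \<open>The pointwise bound is integrated over the layer. After Tonelli the kernel is integrated
  in t for each fixed \<tau>, and what remains is the mean of |F|^2 on the single circle of radius 1
  - h/4.\<close>

lemma layer_bound:
  fixes h :: real
  assumes \<psi>: "carleson_bound n \<epsilon> K \<psi>" and \<epsilon>: "\<epsilon> \<ge> 0" "K \<ge> 0" and h: "0 < h" "h \<le> 1"
    and F: "F holomorphic_on ball 0 1"
  shows "(\<integral>\<^sup>+t. indicator (layer \<psi> h) t * ennreal ((cmod (F (\<psi> t)))\<^sup>2) \<partial>circ)
    \<le> ennreal (8 * 6 ^ (2*n+3) * (\<epsilon> * h ^ (2*n) + K * h ^ (2*n+1)) * hardy_mean F (1 - h/4))"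
proof -
  interpret sigma_finite_measure circ by (rule sigma_finite_circ)
  interpret P: pair_sigma_finite circ circ by unfold_locales
  define q where "q = 2*n+3"
  define A where "A = layer \<psi> h"
  define k where "k t \<tau> = 4 / h * (3 * h) ^ q / cmod (cis \<tau> - \<psi> t) ^ q" for t \<tau>
  define g where "g \<tau> = (cmod (F ((1 - h/4) * cis \<tau>)))\<^sup>2" for \<tau>
  define C where "C = 8 * 6 ^ (2*n+3) * (\<epsilon> * h ^ (2*n) + K * h ^ (2*n+1))"
  have C0: "C \<ge> 0" unfolding C_def using h \<epsilon> by auto
  have c\<psi>: "continuous_on UNIV \<psi>" and \<psi>1: "\<And>t. cmod (\<psi> t) < 1"
    using \<psi> by (auto simp: carleson_bound_def)
  have A: "A \<in> sets borel" unfolding A_def by (rule layer_sets[OF c\<psi>])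
  have cg: "continuous_on UNIV g"
    unfolding g_def using continuous_on_circle[OF F, of "1 - h/4"] h by (auto intro!: continuous_intros)
  have k0: "k t \<tau> \<ge> 0" for t \<tau> unfolding k_def using h by auto
  have ck: "continuous_on UNIV (\<lambda>x. k (fst x) (snd x))"
  proof -
    have "cis (snd x) - \<psi> (fst x) \<noteq> 0" for x
      using \<psi>1[of "fst x"] norm_cis[of "snd x"] by (metis eq_iff_diff_eq_0 less_irrefl)
    thus ?thesis unfolding k_def
      by (intro continuous_intros continuous_on_compose2[OF c\<psi>]) auto
  qed
  have pairs: "sets (circ \<Otimes>\<^sub>M circ) = sets (borel :: (real \<times> real) measure)"
    by (simp add: borel_prod[symmetric] cong: sets_pair_measure_cong)
  have mk: "(\<lambda>x. k (fst x) (snd x)) \<in> borel_measurable (circ \<Otimes>\<^sub>M circ)"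
    unfolding measurable_cong_sets[OF pairs refl] by (rule borel_measurable_continuous_onI[OF ck])
  have mg[measurable]: "g \<in> borel_measurable borel" by (rule borel_measurable_continuous_onI[OF cg])
  have mA: "(\<lambda>t. indicator A t :: ennreal) \<in> borel_measurable borel" using A by simp
  have meas: "(\<lambda>(t,\<tau>). indicator A t * ennreal (g \<tau> * k t \<tau>)) \<in> borel_measurable (circ \<Otimes>\<^sub>M circ)"
  proof -
    have "(\<lambda>x. indicator A (fst x) :: ennreal) \<in> borel_measurable (circ \<Otimes>\<^sub>M circ)"
      by (rule measurable_compose[OF measurable_fst], rule borel_measurable_indicator) (simp add: A)
    moreover have "(\<lambda>x. g (snd x)) \<in> borel_measurable (circ \<Otimes>\<^sub>M circ)"
      by (rule measurable_compose[OF measurable_snd]) (simp add: mg)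
    ultimately show ?thesis unfolding case_prod_unfold using mk by measurable
  qed
  have mkt: "(\<lambda>t. k t \<tau>) \<in> borel_measurable borel" for \<tau>
  proof (rule borel_measurable_continuous_onI)
    have "continuous_on UNIV (\<lambda>t::real. (t, \<tau>))" by (intro continuous_intros)
    from continuous_on_compose2[OF ck this] show "continuous_on UNIV (\<lambda>t. k t \<tau>)" by simp
  qed
  have "(\<integral>\<^sup>+t. indicator A t * ennreal ((cmod (F (\<psi> t)))\<^sup>2) \<partial>circ)
     \<le> (\<integral>\<^sup>+t. (\<integral>\<^sup>+\<tau>. indicator A t * ennreal (g \<tau> * k t \<tau>) \<partial>circ) \<partial>circ)"
  proof (rule nn_integral_mono)
    fix t
    show "indicator A t * ennreal ((cmod (F (\<psi> t)))\<^sup>2) \<le> (\<integral>\<^sup>+\<tau>. indicator A t * ennreal (g \<tau> * k t \<tau>) \<partial>circ)"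
    proof (cases "t \<in> A")
      case True
      hence \<zeta>: "h / 2 < 1 - cmod (\<psi> t)" "1 - cmod (\<psi> t) \<le> h" by (auto simp: A_def layer_def)
      note b = pointwise_circle_bound[OF F h \<zeta>, of q, folded g_def k_def]
      have "ennreal ((cmod (F (\<psi> t)))\<^sup>2) \<le> ennreal (\<integral>\<tau>. g \<tau> * k t \<tau> \<partial>circ)"
        using b(1) unfolding g_def k_def by (rule ennreal_leI)
      also have "\<dots> \<le> (\<integral>\<^sup>+\<tau>. ennreal (g \<tau> * k t \<tau>) \<partial>circ)"
        by (rule ennreal_integral_le_nn_integral, rule circ_integral)
           (use b(2) in \<open>simp add: g_def k_def\<close>)
      finally show ?thesis using True by simp
    qed simp
  qed
  also have "\<dots> = (\<integral>\<^sup>+\<tau>. (\<integral>\<^sup>+t. indicator A t * ennreal (g \<tau> * k t \<tau>) \<partial>circ) \<partial>circ)"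
    using P.Fubini'[OF meas] by simp
  also have "\<dots> \<le> (\<integral>\<^sup>+\<tau>. ennreal (g \<tau> * C) \<partial>circ)"
  proof (rule nn_integral_mono)
    fix \<tau>
    have "(\<integral>\<^sup>+t. indicator A t * ennreal (g \<tau> * k t \<tau>) \<partial>circ) = (\<integral>\<^sup>+t. ennreal (g \<tau>) * (indicator A t * ennreal (k t \<tau>)) \<partial>circ)"
      using k0 by (intro nn_integral_cong) (simp add: g_def ennreal_mult' mult_ac)
    also have "\<dots> = ennreal (g \<tau>) * (\<integral>\<^sup>+t. indicator A t * ennreal (k t \<tau>) \<partial>circ)"
    proof (rule nn_integral_cmult)
      show "(\<lambda>t. indicator A t * ennreal (k t \<tau>)) \<in> borel_measurable circ"
        unfolding measurable_cong_sets[OF sets_circ refl] using mA mkt[of \<tau>] by measurable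
    qed
    also have "\<dots> \<le> ennreal (g \<tau>) * ennreal C"
      using layer_kernel_bound[OF \<psi> \<epsilon> h, of \<tau>] unfolding A_def k_def q_def C_def
      by (rule mult_left_mono) simp
    also have "\<dots> = ennreal (g \<tau> * C)" using C0 by (simp add: g_def ennreal_mult)
    finally show "(\<integral>\<^sup>+t. indicator A t * ennreal (g \<tau> * k t \<tau>) \<partial>circ) \<le> ennreal (g \<tau> * C)" .
  qed
  also have "\<dots> = ennreal (\<integral>\<tau>. g \<tau> * C \<partial>circ)"
    using C0 by (intro nn_integral_eq_integral circ_integral continuous_intros cg) (auto simp: g_def)
  also have "(\<integral>\<tau>. g \<tau> * C \<partial>circ) = C * hardy_mean F (1 - h/4)"
    using hardy_mean_eq[OF F, of "1 - h/4"] h by (simp add: g_def mult.commute)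
  finally show ?thesis by (simp add: A_def C_def)
qed

text \<open>The difference on the right telescopes when y runs through successive halves. Multiplied
  by exp (y/2), the claim compares one term of the exponential series at y/4 with exp (y/4) - 1, and
  n >= 1 makes that term different from the constant one.\<close>

lemma exp_telescope_bound:
  fixes y :: real
  assumes "y \<ge> 0" "n \<ge> 1"
  shows "y ^ (2*n) * exp (- (y/2)) \<le> 4 ^ (2*n) * fact (2*n) * (exp (- (y/4)) - exp (- (y/2)))"
proof -
  have "(y/4) ^ (2*n) / fact (2*n) \<le> exp (y/4) - 1"
  proof -
    define x where "x = y / 4"
    have e: "(\<lambda>k. x ^ k /\<^sub>R fact k) sums exp x" by (rule exp_converges)
    have "(\<Sum>k\<in>{0, 2*n}. x ^ k /\<^sub>R fact k) \<le> (\<Sum>k. x ^ k /\<^sub>R fact k)"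
    proof (rule sum_le_suminf[OF sums_summable[OF e]])
      show "0 \<le> x ^ k /\<^sub>R fact k" for k using assms by (simp add: x_def)
    qed simp
    also have "\<dots> = exp x" by (rule sums_unique[OF e, symmetric])
    also have "(\<Sum>k\<in>{0, 2*n}. x ^ k /\<^sub>R fact k) = 1 + x ^ (2*n) / fact (2*n)"
      using assms by (simp add: divide_inverse mult.commute[of "x ^ (2*n)"])
    finally show ?thesis unfolding x_def by linarith
  qed
  hence "(y/4) ^ (2*n) \<le> (exp (y/4) - 1) * fact (2*n)"
    by (simp only: pos_divide_le_eq[OF fact_gt_zero])
  hence "4 ^ (2*n) * (y/4) ^ (2*n) \<le> 4 ^ (2*n) * ((exp (y/4) - 1) * fact (2*n))"
    by (intro mult_left_mono) auto
  moreover have "4 ^ (2*n) * (y/4) ^ (2*n) = y ^ (2*n)" by (simp add: power_divide)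
  ultimately have "y ^ (2*n) \<le> 4 ^ (2*n) * fact (2*n) * (exp (y/4) - 1)"
    by (simp only: mult_ac)
  hence "y ^ (2*n) * exp (- (y/2)) \<le> 4 ^ (2*n) * fact (2*n) * (exp (y/4) - 1) * exp (- (y/2))"
    by (intro mult_right_mono) auto
  also have "(exp (y/4) - 1) * exp (- (y/2)) = exp (- (y/4)) - exp (- (y/2))"
    by (simp add: algebra_simps flip: exp_add)
  hence "4 ^ (2*n) * fact (2*n) * (exp (y/4) - 1) * exp (- (y/2)) = 4 ^ (2*n) * fact (2*n) * (exp (- (y/4)) - exp (- (y/2)))"
    by (simp only: mult.assoc)
  finally show ?thesis .
qed

text \<open>The weight 2^(-2nj) pays for the factor (k+n)^(2n) produced by n derivatives: up to a
  constant the terms are at most y^(2n) exp (-y/2) with y = 2^(-j) (k+n), and their sum over j is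
  bounded uniformly in k.\<close>

lemma dyadic_weight_sum:
  assumes n: "n \<ge> 1"
  shows "(\<Sum>j<M. ((1/2) ^ j) ^ (2*n) * (real (k + n) ^ (2*n) * (1 - (1/2)^j/4) ^ (2*k)))
    \<le> exp (real n) * (4 ^ (2*n) * fact (2*n))"
proof -
  define y where "y j = (1/2) ^ j * real (k + n)" for j :: nat
  have y0: "y j \<ge> 0" for j by (simp add: y_def)
  have "((1/2) ^ j) ^ (2*n) * (real (k + n) ^ (2*n) * (1 - (1/2)^j/4) ^ (2*k)) \<le>
      exp (real n) * (4 ^ (2*n) * fact (2*n)) * (exp (- (y (Suc j) / 2)) - exp (- (y j / 2)))" for j :: nat
  proof -
    define h where "h = (1/2::real) ^ j"
    have h: "0 < h" "h \<le> 1" by (simp_all add: h_def power_le_one)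
    have "(1 - h/4) ^ (2*k) \<le> exp (- (h/4)) ^ (2*k)"
      using h exp_ge_add_one_self[of "- (h/4)"] by (intro power_mono) auto
    also have "\<dots> = exp (- (h * real k / 2))"
      by (simp add: exp_of_nat_mult[symmetric] mult_ac)
    \<comment> \<open>Passing from k to k + n in the exponent leaves y j as the only variable, at
      the price of a factor at most exp n.\<close>
    also have "\<dots> = exp (h * real n / 2) * exp (- (y j / 2))"
    proof -
      have "y j = h * real k + h * real n" by (simp add: y_def h_def algebra_simps)
      thus ?thesis by (simp add: exp_add[symmetric] add_divide_distrib)
    qed
    also have "\<dots> \<le> exp (real n) * exp (- (y j / 2))"
    proof -
      have "h * real n \<le> 1 * real n" using h by (intro mult_right_mono) auto
      thus ?thesis by simp
    qed
    finally have "((1/2) ^ j) ^ (2*n) * (real (k + n) ^ (2*n) * (1 - (1/2)^j/4) ^ (2*k)) \<le>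
        h ^ (2*n) * (real (k + n) ^ (2*n) * (exp (real n) * exp (- (y j / 2))))"
      unfolding h_def[symmetric] using h by (intro mult_left_mono) auto
    also have "\<dots> = exp (real n) * (y j ^ (2*n) * exp (- (y j / 2)))"
      by (simp add: y_def h_def power_mult_distrib mult_ac)
    also have "\<dots> \<le> exp (real n) * (4 ^ (2*n) * fact (2*n) * (exp (- (y j / 4)) - exp (- (y j / 2))))"
      by (intro mult_left_mono exp_telescope_bound y0 n) auto
    also have "y j / 4 = y (Suc j) / 2" by (simp add: y_def)
    finally show ?thesis by (simp only: mult.assoc)
  qed
  hence "(\<Sum>j<M. ((1/2) ^ j) ^ (2*n) * (real (k + n) ^ (2*n) * (1 - (1/2)^j/4) ^ (2*k)))
     \<le> (\<Sum>j<M. exp (real n) * (4 ^ (2*n) * fact (2*n)) * (exp (- (y (Suc j) / 2)) - exp (- (y j / 2))))"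
    by (intro sum_mono)
  also have "\<dots> = exp (real n) * (4 ^ (2*n) * fact (2*n)) * (exp (- (y M / 2)) - exp (- (y 0 / 2)))"
    by (simp only: sum_distrib_left[symmetric] sum_lessThan_telescope[of "\<lambda>j. exp (- (y j / 2))" M])
  also have "\<dots> \<le> exp (real n) * (4 ^ (2*n) * fact (2*n)) * 1"
  proof (rule mult_left_mono)
    have "exp (- (y M / 2)) \<le> 1" using y0[of M] by simp
    thus "exp (- (y M / 2)) - exp (- (y 0 / 2)) \<le> 1" using exp_ge_zero[of "- (y 0 / 2)"] by linarith
  qed simp
  finally show ?thesis by simp
qed

lemma higher_deriv_add_index: "(deriv ^^ k) ((deriv ^^ n) f) = (deriv ^^ (k + n)) f"
  by (simp add: funpow_add)

text \<open>Differentiation multiplies the coefficient by (k+n)!/k!, a product of n factors that are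
  at most k+n.\<close>

lemma taylor_coeff_higher_deriv:
  "cmod (taylor_coeff ((deriv ^^ n) f) k) \<le> cmod (taylor_coeff f (k + n)) * real (k + n) ^ n"
proof -
  have "fact (k + n) div fact k \<le> (k + n) ^ n"
    using fact_div_fact_le_pow[of n "k + n"] by simp
  hence "fact (k + n) div fact k * fact k \<le> (k + n) ^ n * fact k" by (rule mult_le_mono1)
  moreover have "fact (k + n) div fact k * fact k = (fact (k + n) :: nat)"
    by (rule dvd_div_mult_self) (simp add: fact_dvd)
  ultimately have "real (fact (k + n)) \<le> real ((k + n) ^ n * fact k)"
    by (simp only: of_nat_le_iff)
  hence "(fact (k + n) :: real) \<le> real (k + n) ^ n * fact k" by simp
  hence "fact (k + n) / fact k \<le> real (k + n) ^ n" by (simp add: divide_le_eq)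
  hence "cmod (taylor_coeff f (k + n)) * (fact (k + n) / fact k) \<le> cmod (taylor_coeff f (k + n)) * real (k + n) ^ n"
    by (intro mult_left_mono) auto
  thus ?thesis by (simp add: taylor_coeff_def higher_deriv_add_index norm_divide)
qed

text \<open>One half of a discrete Littlewood-Paley equivalence. Parseval's identity reduces it,
  coefficient by coefficient, to \<open>dyadic_weight_sum\<close>; since M is finite, only a finite
  sum of series is interchanged.\<close>

lemma sum_layers:
  assumes n: "n \<ge> 1" and f: "in_H2 f"
  shows "(\<Sum>j<M. ((1/2) ^ j) ^ (2*n) * hardy_mean ((deriv ^^ n) f) (1 - (1/2)^j/4))
    \<le> exp (real n) * (4 ^ (2*n) * fact (2*n)) * (H2_norm f)\<^sup>2"
proof -
  define C where "C = exp (real n) * (4 ^ (2*n) * fact (2*n))"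
  define a where "a k = (cmod (taylor_coeff f k))\<^sup>2" for k
  define b where "b k = (cmod (taylor_coeff ((deriv ^^ n) f) k))\<^sup>2" for k
  have s: "summable a" unfolding a_def using f by (simp add: in_H2_iff)
  have hol: "(deriv ^^ n) f holomorphic_on ball 0 1"
    by (intro holomorphic_higher_deriv in_H2_holomorphic f) auto
  have h: "0 < (1/2::real)^j" "(1/2::real)^j \<le> 1" for j by (simp_all add: power_le_one)
  have P: "(\<lambda>k. b k * (1 - (1/2)^j/4) ^ (2*k)) sums hardy_mean ((deriv ^^ n) f) (1 - (1/2)^j/4)" for j
    unfolding b_def by (rule Parseval[OF hol]) (use h[of j] in linarith)+
  have S: "(\<lambda>k. \<Sum>j<M. ((1/2) ^ j) ^ (2*n) * (b k * (1 - (1/2)^j/4) ^ (2*k))) sums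
      (\<Sum>j<M. ((1/2) ^ j) ^ (2*n) * hardy_mean ((deriv ^^ n) f) (1 - (1/2)^j/4))"
    by (intro sums_sum sums_mult P)
  have ba: "b k \<le> a (k + n) * real (k + n) ^ (2*n)" for k
  proof -
    have "b k \<le> (cmod (taylor_coeff f (k + n)) * real (k + n) ^ n)\<^sup>2"
      unfolding b_def by (intro power_mono taylor_coeff_higher_deriv) auto
    thus ?thesis by (simp add: a_def power_mult_distrib power_mult[symmetric] mult.commute)
  qed
  have trm: "(\<Sum>j<M. ((1/2) ^ j) ^ (2*n) * (b k * (1 - (1/2)^j/4) ^ (2*k))) \<le> C * a (k + n)" for k
  proof -
    have "(\<Sum>j<M. ((1/2) ^ j) ^ (2*n) * (b k * (1 - (1/2)^j/4) ^ (2*k))) \<le>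
        (\<Sum>j<M. a (k + n) * (((1/2) ^ j) ^ (2*n) * (real (k + n) ^ (2*n) * (1 - (1/2)^j/4) ^ (2*k))))"
    proof (rule sum_mono)
      fix j
      have "((1/2) ^ j) ^ (2*n) * (b k * (1 - (1/2)^j/4) ^ (2*k)) \<le>
          ((1/2) ^ j) ^ (2*n) * ((a (k + n) * real (k + n) ^ (2*n)) * (1 - (1/2)^j/4) ^ (2*k))"
        using ba[of k] by (intro mult_left_mono mult_right_mono zero_le_even_power) auto
      thus "((1/2) ^ j) ^ (2*n) * (b k * (1 - (1/2)^j/4) ^ (2*k)) \<le>
          a (k + n) * (((1/2) ^ j) ^ (2*n) * (real (k + n) ^ (2*n) * (1 - (1/2)^j/4) ^ (2*k)))"
        by (simp only: mult_ac)
    qed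
    also have "\<dots> = a (k + n) * (\<Sum>j<M. ((1/2) ^ j) ^ (2*n) * (real (k + n) ^ (2*n) * (1 - (1/2)^j/4) ^ (2*k)))"
      by (rule sum_distrib_left[symmetric])
    also have "\<dots> \<le> a (k + n) * C"
      unfolding C_def by (intro mult_left_mono dyadic_weight_sum n) (simp add: a_def)
    finally show ?thesis by (simp add: mult.commute)
  qed
  have sn: "summable (\<lambda>k. a (k + n))" using s by (simp add: summable_iff_shift)
  have "(\<Sum>j<M. ((1/2) ^ j) ^ (2*n) * hardy_mean ((deriv ^^ n) f) (1 - (1/2)^j/4)) \<le> (\<Sum>k. C * a (k + n))"
    unfolding sums_unique[OF S]
    by (rule suminf_le) (use trm S sn in \<open>auto simp: sums_iff intro: summable_mult\<close>)
  also have "\<dots> = C * (\<Sum>k. a (k + n))" by (rule suminf_mult[OF sn])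
  also have "\<dots> \<le> C * (\<Sum>k. a k)"
  proof (rule mult_left_mono)
    have "(\<Sum>k. a k) = (\<Sum>k. a (k + n)) + (\<Sum>k<n. a k)" by (rule suminf_split_initial_segment[OF s])
    moreover have "(\<Sum>k<n. a k) \<ge> 0" by (intro sum_nonneg) (simp add: a_def)
    ultimately show "(\<Sum>k. a (k + n)) \<le> (\<Sum>k. a k)" by linarith
  qed (simp add: C_def)
  also have "(\<Sum>k. a k) = (H2_norm f)\<^sup>2" unfolding a_def by (rule H2_norm_sq[OF f, symmetric])
  finally show ?thesis by (simp add: C_def)
qed

text \<open>The constant 8 * 6^(2n+3) of \<open>layer_bound\<close>, doubled because the K part is
  absorbed into the \<epsilon> part, times the constant of \<open>sum_layers\<close>.\<close>

definition carleson_const :: "nat \<Rightarrow> real" where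
  "carleson_const n = 16 * 6 ^ (2*n+3) * (exp (real n) * (4 ^ (2*n) * fact (2*n)))"

text \<open>In the layers from index J on, K h <= \<epsilon>, so the K part is at most the
  \<epsilon> part; \<open>sum_layers\<close> then adds up the layers with a bound independent of
  their number.\<close>

lemma carleson_tail:
  assumes n: "n \<ge> 1" and f: "in_H2 f" and \<psi>: "carleson_bound n \<epsilon> K \<psi>"
    and \<epsilon>: "\<epsilon> \<ge> 0" "K \<ge> 0" and J: "K * (1/2) ^ J \<le> \<epsilon>"
  shows "(\<integral>\<^sup>+t. indicator {t. 1 - cmod (\<psi> t) \<le> (1/2) ^ J} t * ennreal ((cmod ((deriv ^^ n) f (\<psi> t)))\<^sup>2) \<partial>circ)
    \<le> ennreal (carleson_const n * \<epsilon> * (H2_norm f)\<^sup>2)"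
proof -
  define F where "F = (deriv ^^ n) f"
  define g where "g t = ennreal ((cmod (F (\<psi> t)))\<^sup>2)" for t
  define hh where "hh j = (1/2::real) ^ j" for j :: nat
  have hh: "0 < hh j" "hh j \<le> 1" for j by (simp_all add: hh_def power_le_one)
  have c\<psi>: "continuous_on UNIV \<psi>" and \<psi>1: "\<And>t. cmod (\<psi> t) < 1"
    using \<psi> by (auto simp: carleson_bound_def)
  have hol: "F holomorphic_on ball 0 1"
    unfolding F_def by (intro holomorphic_higher_deriv in_H2_holomorphic f) auto
  have cF: "continuous_on UNIV (\<lambda>t. F (\<psi> t))"
    by (rule continuous_on_compose2[OF holomorphic_on_imp_continuous_on[OF hol] c\<psi>]) (use \<psi>1 in auto)
  have mg: "g \<in> borel_measurable borel"
  proof -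
    have "(\<lambda>t. (cmod (F (\<psi> t)))\<^sup>2) \<in> borel_measurable borel"
      by (intro borel_measurable_continuous_onI continuous_intros cF)
    thus ?thesis unfolding g_def by measurable
  qed
  have pw: "indicator {t. 1 - cmod (\<psi> t) \<le> (1/2) ^ J} t * g t \<le> (\<Sum>i. indicator (layer \<psi> (hh (i + J))) t * g t)" for t
  proof (cases "1 - cmod (\<psi> t) \<le> (1/2) ^ J")
    case True
    define d where "d = 1 - cmod (\<psi> t)"
    have d0: "d > 0" using \<psi>1[of t] by (simp add: d_def)
    obtain N where N: "(1/2::real) ^ N < d" using real_arch_pow_inv[OF d0, of "1/2"] by auto
    \<comment> \<open>The least such m exceeds J, and t lies in the layer of index m - 1.\<close>
    define m where "m = (LEAST m. (1/2::real) ^ m < d)"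
    have m: "(1/2::real) ^ m < d" unfolding m_def using N by (rule LeastI)
    have mJ: "m > J"
    proof (rule ccontr)
      assume "\<not> m > J"
      hence "(1/2::real) ^ J \<le> (1/2) ^ m" by (intro power_decreasing) auto
      thus False using m True unfolding d_def by linarith
    qed
    then obtain i where i: "m = Suc (i + J)" by (metis add.commute less_imp_Suc_add)
    have "\<not> (1/2::real) ^ (i + J) < d"
      using not_less_Least[of "i + J" "\<lambda>m. (1/2::real) ^ m < d"] i by (simp add: m_def)
    hence "t \<in> layer \<psi> (hh (i + J))" using m i by (simp add: layer_def hh_def d_def)
    hence "g t = (\<Sum>i\<in>{i}. indicator (layer \<psi> (hh (i + J))) t * g t)" by simp
    also have "\<dots> \<le> (\<Sum>i. indicator (layer \<psi> (hh (i + J))) t * g t)"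
      by (rule sum_le_suminf) auto
    finally show ?thesis using True by simp
  qed simp
  have part: "(\<Sum>i<N. (\<integral>\<^sup>+t. indicator (layer \<psi> (hh (i + J))) t * g t \<partial>circ)) \<le> ennreal (carleson_const n * \<epsilon> * (H2_norm f)\<^sup>2)" for N
  proof -
    define c where "c j = 16 * 6 ^ (2*n+3) * \<epsilon> * (hh j ^ (2*n) * hardy_mean F (1 - hh j / 4))" for j
    have c0: "c j \<ge> 0" for j unfolding c_def using hh[of j] \<epsilon> hardy_mean_nonneg[of F] by auto
    have le: "(\<integral>\<^sup>+t. indicator (layer \<psi> (hh (i + J))) t * g t \<partial>circ) \<le> ennreal (c (i + J))" for i
    proof -
      define h where "h = hh (i + J)"
      have h: "0 < h" "h \<le> 1" using hh by (auto simp: h_def)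
      have "K * h \<le> K * (1/2) ^ J"
        unfolding h_def hh_def using \<epsilon> by (intro mult_left_mono power_decreasing) auto
      hence "K * h \<le> \<epsilon>" using J by linarith
      hence "h ^ (2*n) * (K * h) \<le> h ^ (2*n) * \<epsilon>" using h by (intro mult_left_mono) auto
      hence "\<epsilon> * h ^ (2*n) + K * h ^ (2*n+1) \<le> 2 * (\<epsilon> * h ^ (2*n))" by (simp add: algebra_simps)
      hence "8 * 6 ^ (2*n+3) * (\<epsilon> * h ^ (2*n) + K * h ^ (2*n+1)) * hardy_mean F (1 - h/4) \<le>
          8 * 6 ^ (2*n+3) * (2 * (\<epsilon> * h ^ (2*n))) * hardy_mean F (1 - h/4)"
        by (intro mult_right_mono mult_left_mono hardy_mean_nonneg) auto
      also have "\<dots> = c (i + J)" by (simp add: c_def h_def)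
      finally have "ennreal (8 * 6 ^ (2*n+3) * (\<epsilon> * h ^ (2*n) + K * h ^ (2*n+1)) * hardy_mean F (1 - h/4)) \<le> ennreal (c (i + J))"
        by (rule ennreal_leI)
      with layer_bound[OF \<psi> \<epsilon> h hol] show ?thesis
        unfolding g_def h_def by (rule order_trans)
    qed
    have "(\<Sum>i<N. (\<integral>\<^sup>+t. indicator (layer \<psi> (hh (i + J))) t * g t \<partial>circ)) \<le> (\<Sum>i<N. ennreal (c (i + J)))"
      by (intro sum_mono le)
    also have "\<dots> = ennreal (\<Sum>i<N. c (i + J))" by (rule sum_ennreal) (rule c0)
    also have "(\<Sum>i<N. c (i + J)) = (\<Sum>j\<in>{J..<N+J}. c j)"
      using sum.shift_bounds_nat_ivl[of c 0 J N] by (simp add: atLeast0LessThan)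
    also have "\<dots> \<le> (\<Sum>j<N+J. c j)" by (intro sum_mono2) (auto simp: c0)
    also have "\<dots> = 16 * 6 ^ (2*n+3) * \<epsilon> * (\<Sum>j<N+J. hh j ^ (2*n) * hardy_mean F (1 - hh j / 4))"
      unfolding c_def by (rule sum_distrib_left[symmetric])
    also have "\<dots> \<le> 16 * 6 ^ (2*n+3) * \<epsilon> * (exp (real n) * (4 ^ (2*n) * fact (2*n)) * (H2_norm f)\<^sup>2)"
      using \<epsilon> unfolding hh_def F_def by (intro mult_left_mono sum_layers n f) auto
    also have "\<dots> = carleson_const n * \<epsilon> * (H2_norm f)\<^sup>2" by (simp add: carleson_const_def mult_ac)
    finally show ?thesis by (simp add: ennreal_leI)
  qed
  have "(\<integral>\<^sup>+t. indicator {t. 1 - cmod (\<psi> t) \<le> (1/2) ^ J} t * g t \<partial>circ) \<le>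
      (\<integral>\<^sup>+t. (\<Sum>i. indicator (layer \<psi> (hh (i + J))) t * g t) \<partial>circ)"
    by (intro nn_integral_mono pw)
  also have "\<dots> = (\<Sum>i. \<integral>\<^sup>+t. indicator (layer \<psi> (hh (i + J))) t * g t \<partial>circ)"
  proof (rule nn_integral_suminf)
    fix i
    show "(\<lambda>t. indicator (layer \<psi> (hh (i + J))) t * g t) \<in> borel_measurable circ"
      unfolding measurable_cong_sets[OF sets_circ refl]
      using mg layer_sets[OF c\<psi>, of "hh (i + J)"] by measurable
  qed
  also have "\<dots> \<le> ennreal (carleson_const n * \<epsilon> * (H2_norm f)\<^sup>2)"
    by (rule suminf_le_const[OF summableI part])
  finally show ?thesis by (simp add: g_def F_def)
qed

section \<open>Sufficiency\<close>

definition nev_cond :: "(complex \<Rightarrow> complex) \<Rightarrow> nat \<Rightarrow> bool" where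
  "nev_cond \<phi> n \<longleftrightarrow> (\<forall>\<epsilon>>0. \<exists>\<delta><1. \<forall>w. \<delta> < cmod w \<and> cmod w < 1 \<longrightarrow>
        nevanlinna \<phi> w \<le> ennreal (\<epsilon> * (ln (1 / cmod w)) ^ (2 * n + 1)))"

lemma ln_inverse_le:
  fixes x :: real
  assumes "1/2 \<le> x" "x < 1"
  shows "ln (1 / x) \<le> 2 * (1 - x)" "0 \<le> ln (1 / x)"
proof -
  have "ln (1 / x) \<le> 1 / x - 1" using assms by (intro ln_le_minus_one) auto
  also have "\<dots> = (1 - x) / x" using assms by (simp add: field_simps)
  also have "\<dots> \<le> (1 - x) / (1/2)" using assms by (intro divide_left_mono) auto
  finally show "ln (1 / x) \<le> 2 * (1 - x)" by simp
  show "0 \<le> ln (1 / x)" using assms by (intro ln_ge_zero) (auto simp: le_divide_eq)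
qed

lemma nev_cond_carleson:
  assumes \<phi>: "\<phi> holomorphic_on ball 0 1" "\<phi> ` ball 0 1 \<subseteq> ball 0 1"
    and nev: "nev_cond \<phi> n" and \<epsilon>: "\<epsilon> > 0"
  obtains K where "K \<ge> 0" "\<And>r. 0 \<le> r \<Longrightarrow> r < 1 \<Longrightarrow> carleson_bound n \<epsilon> K (\<lambda>t. \<phi> (of_real r * cis t))"
proof -
  \<comment> \<open>The measure estimate is applied with radius 2 s, where ln (1/|w|) <= 4 s; this
    explains 4^(2n+1), and ln 2 is the loss in that estimate.\<close>
  define \<epsilon>0 where "\<epsilon>0 = \<epsilon> * ln 2 / 4 ^ (2*n+1)"
  have \<epsilon>0: "\<epsilon>0 > 0" using \<epsilon> by (simp add: \<epsilon>0_def)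
  obtain \<delta> where \<delta>: "\<delta> < 1" "\<And>w. \<delta> < cmod w \<Longrightarrow> cmod w < 1 \<Longrightarrow>
      nevanlinna \<phi> w \<le> ennreal (\<epsilon>0 * (ln (1 / cmod w)) ^ (2 * n + 1))"
    using nev \<epsilon>0 unfolding nev_cond_def by meson
  have p1: "cmod (\<phi> 0) < 1"
  proof -
    have "\<phi> 0 \<in> ball 0 1" using \<phi>(2) by (rule subsetD) simp
    thus ?thesis by simp
  qed
  \<comment> \<open>For s <= s0, a point w at distance 2 s from b satisfies |w| >= 1 - 2 s, hence
    |w| > \<delta>, |w| > |\<phi> 0| and |w| >= 1/2.\<close>
  define s0 where "s0 = min (1/4) (min ((1 - \<delta>) / 3) ((1 - cmod (\<phi> 0)) / 3))"
  have s0: "0 < s0" "s0 \<le> 1/4" "3 * s0 \<le> 1 - \<delta>" "3 * s0 \<le> 1 - cmod (\<phi> 0)"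
    using \<delta>(1) p1 by (auto simp: s0_def min_def)
  define K where "K = 1 / s0 ^ (2*n+2)"
  have K: "K \<ge> 0" using s0 by (simp add: K_def)
  have "carleson_bound n \<epsilon> K (\<lambda>t. \<phi> (of_real r * cis t))" if r: "0 \<le> r" "r < 1" for r
    unfolding carleson_bound_def
  proof (intro conjI allI impI)
    show "continuous_on UNIV (\<lambda>t. \<phi> (of_real r * cis t))"
      by (rule continuous_on_circle[OF \<phi>(1) r])
    fix t
    have "\<phi> (of_real r * cis t) \<in> ball 0 1"
      using \<phi>(2) by (rule subsetD) (use r in \<open>simp add: norm_mult\<close>)
    thus "cmod (\<phi> (of_real r * cis t)) < 1" by simp
  next
    fix b :: complex and s :: real
    assume b: "cmod b = 1" and s: "0 < s"
    show "measure circ {t. cmod (\<phi> (of_real r * cis t) - b) \<le> s} \<le> \<epsilon> * s ^ (2*n+1) + K * s ^ (2*n+2)"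
    proof (cases "s \<le> s0")
      case False
      have "measure circ {t. cmod (\<phi> (of_real r * cis t) - b) \<le> s} \<le> 1"
        using finite_measure.bounded_measure[OF finite_measure_circ] by (simp add: measure_circ_UNIV)
      also have "\<dots> \<le> K * s ^ (2*n+2)"
      proof -
        have "s0 ^ (2*n+2) \<le> s ^ (2*n+2)" using False s0 by (intro power_mono) auto
        thus ?thesis using s0 by (simp add: K_def)
      qed
      finally show ?thesis using \<epsilon> s by (simp add: add_increasing)
    next
      case True
      define y where "y = \<epsilon>0 * (4 * s) ^ (2*n+1)"
      have y0: "y \<ge> 0" using \<epsilon>0 s by (simp add: y_def)
      have "measure circ {t. cmod (\<phi> (of_real r * cis t) - b) \<le> (2 * s) / 2} * ln 2 \<le> y"
      proof (rule measure_near_boundary_point[OF \<phi> b _ _ _ r])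
        show "0 < 2 * s" "2 * s \<le> 1" using s True s0 by auto
        have "1 - cmod (\<phi> 0) \<le> cmod (\<phi> 0 - b)"
          using norm_triangle_ineq2[of b "\<phi> 0"] b by (simp add: norm_minus_commute)
        thus "2 * s < cmod (\<phi> 0 - b)" using True s0 s by linarith
        fix \<tau> Z
        assume Z: "finite Z" "Z \<subseteq> {z \<in> ball 0 1. \<phi> z = b + of_real (2 * s) * cis \<tau>}"
        define w where "w = b + of_real (2 * s) * cis \<tau>"
        show "(\<Sum>z\<in>Z. real (nat (zorder (\<lambda>x. \<phi> x - (b + of_real (2 * s) * cis \<tau>)) z)) * ln (1 / cmod z)) \<le> y"
        \<comment> \<open>A nonempty Z puts w into the range of \<phi>, hence into the disk, where
          the decay hypothesis speaks about it.\<close>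
        proof (cases "Z = {}")
          case False
          then obtain z where "z \<in> Z" by blast
          with Z(2) have z: "z \<in> ball 0 1" "\<phi> z = w" by (auto simp: w_def)
          have "\<phi> z \<in> ball 0 1" by (rule subsetD[OF \<phi>(2) imageI[OF z(1)]])
          hence w1: "cmod w < 1" using z by simp
          have "cmod b - cmod (of_real (2 * s) * cis \<tau>) \<le> cmod w"
            unfolding w_def using norm_triangle_ineq4[of w "of_real (2 * s) * cis \<tau>"] by (simp add: w_def)
          hence w2: "1 - 2 * s \<le> cmod w" using b s by (simp add: norm_mult)
          have w3: "\<delta> < cmod w" "cmod (\<phi> 0) < cmod w" "1/2 \<le> cmod w"
            using w2 True s0 s by linarith+
          have l: "ln (1 / cmod w) \<le> 4 * s" "0 \<le> ln (1 / cmod w)"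
            using ln_inverse_le[OF w3(3) w1] w2 by auto
          have "nevanlinna \<phi> w \<le> ennreal (\<epsilon>0 * (ln (1 / cmod w)) ^ (2 * n + 1))"
            by (rule \<delta>(2)[OF w3(1) w1])
          also have "\<dots> \<le> ennreal y"
            unfolding y_def using l \<epsilon>0 by (intro ennreal_leI mult_left_mono power_mono) auto
          finally have "nevanlinna \<phi> w \<le> ennreal y" .
          from nevanlinna_geD[OF \<phi>(1) _ Z(1) _ this y0] w3(2) Z(2) show ?thesis
            unfolding w_def[symmetric] by auto
        qed (use y0 in simp)
      qed
      hence "measure circ {t. cmod (\<phi> (of_real r * cis t) - b) \<le> s} \<le> y / ln 2"
        by (simp add: le_divide_eq)
      also have "y / ln 2 = \<epsilon> * s ^ (2*n+1)"
        by (simp add: y_def \<epsilon>0_def power_mult_distrib del: power_Suc)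
      finally show ?thesis using K s by (simp add: add_increasing2)
    qed
  qed
  with K that show ?thesis by blast
qed

text \<open>J depends on \<eta> but not on f or r. Where \<phi> stays in a compact disk only the
  size M of the derivative matters; the rest is at most \<eta> times the squared norm. The choice
  \<eta> = 1 shows that the operator maps into H^2, small \<eta> gives compactness.\<close>

lemma D_op_hardy_mean_bound:
  assumes \<phi>: "\<phi> holomorphic_on ball 0 1" "\<phi> ` ball 0 1 \<subseteq> ball 0 1" and n: "n \<ge> 1"
    and nev: "nev_cond \<phi> n" and \<eta>: "\<eta> > 0"
  obtains J :: nat where "\<And>f r M. in_H2 f \<Longrightarrow> 0 < r \<Longrightarrow> r < 1 \<Longrightarrow>
     (\<And>\<zeta>. cmod \<zeta> \<le> 1 - (1/2)^J \<Longrightarrow> (cmod ((deriv ^^ n) f \<zeta>))\<^sup>2 \<le> M) \<Longrightarrow>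
     hardy_mean (D_op \<phi> n f) r \<le> M + \<eta> * (H2_norm f)\<^sup>2"
proof -
  have C: "carleson_const n > 0" by (simp add: carleson_const_def)
  define \<epsilon> where "\<epsilon> = \<eta> / carleson_const n"
  have \<epsilon>: "\<epsilon> > 0" using \<eta> C by (simp add: \<epsilon>_def)
  obtain K where K: "K \<ge> 0" "\<And>r. 0 \<le> r \<Longrightarrow> r < 1 \<Longrightarrow> carleson_bound n \<epsilon> K (\<lambda>t. \<phi> (of_real r * cis t))"
    using nev_cond_carleson[OF \<phi> nev \<epsilon>] by blast
  \<comment> \<open>K + 1 in place of K keeps the divisor positive.\<close>
  obtain J where J0: "(1/2::real) ^ J < \<epsilon> / (K + 1)"
    using real_arch_pow_inv[of "\<epsilon> / (K + 1)" "1/2"] \<epsilon> K(1) by auto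
  hence "(K + 1) * (1/2) ^ J < \<epsilon>" using K(1) by (simp add: less_divide_eq mult.commute)
  hence J: "K * (1/2) ^ J \<le> \<epsilon>" by (simp add: algebra_simps) (smt (verit) zero_le_power divide_nonneg_nonneg)
  have "hardy_mean (D_op \<phi> n f) r \<le> M + \<eta> * (H2_norm f)\<^sup>2"
    if f: "in_H2 f" and r: "0 < r" "r < 1"
      and M: "\<And>\<zeta>. cmod \<zeta> \<le> 1 - (1/2)^J \<Longrightarrow> (cmod ((deriv ^^ n) f \<zeta>))\<^sup>2 \<le> M" for f r M
  proof -
    define \<psi> where "\<psi> t = \<phi> (of_real r * cis t)" for t
    define F where "F = (deriv ^^ n) f"
    have cb: "carleson_bound n \<epsilon> K \<psi>" unfolding \<psi>_def using K(2)[of r] r by simp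
    have F: "F holomorphic_on ball 0 1"
      unfolding F_def by (intro holomorphic_higher_deriv in_H2_holomorphic f) auto
    have T: "D_op \<phi> n f holomorphic_on ball 0 1"
      using holomorphic_on_compose_gen[OF \<phi>(1) F \<phi>(2)] by (simp add: D_op_def F_def o_def)
    have M0: "M \<ge> 0"
    proof -
      have "0 \<le> (cmod ((deriv ^^ n) f 0))\<^sup>2" by simp
      also have "\<dots> \<le> M" by (rule M) (simp add: power_le_one)
      finally show ?thesis .
    qed
    have c: "continuous_on UNIV (\<lambda>t. (cmod (F (\<psi> t)))\<^sup>2)"
      using continuous_on_circle[OF T, of r] r unfolding D_op_def F_def[symmetric] \<psi>_def
      by (intro continuous_intros) auto
    define A where "A = {t. 1 - cmod (\<psi> t) \<le> (1/2) ^ J}"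
    have c\<psi>: "continuous_on UNIV \<psi>" using cb by (simp add: carleson_bound_def)
    have "closed A" unfolding A_def by (intro closed_Collect_le continuous_intros c\<psi>)
    hence A: "A \<in> sets borel" by simp
    have "ennreal (hardy_mean (D_op \<phi> n f) r) = ennreal (\<integral>t. (cmod (F (\<psi> t)))\<^sup>2 \<partial>circ)"
      using hardy_mean_eq[OF T, of r] r by (simp add: D_op_def F_def \<psi>_def)
    also have "\<dots> = (\<integral>\<^sup>+t. ennreal ((cmod (F (\<psi> t)))\<^sup>2) \<partial>circ)"
      by (intro nn_integral_eq_integral[symmetric] circ_integral c) auto
    also have "\<dots> \<le> (\<integral>\<^sup>+t. ennreal M + indicator A t * ennreal ((cmod (F (\<psi> t)))\<^sup>2) \<partial>circ)"
    proof (rule nn_integral_mono)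
      fix t
      show "ennreal ((cmod (F (\<psi> t)))\<^sup>2) \<le> ennreal M + indicator A t * ennreal ((cmod (F (\<psi> t)))\<^sup>2)"
      proof (cases "t \<in> A")
        case False
        hence "(cmod (F (\<psi> t)))\<^sup>2 \<le> M" unfolding F_def by (intro M) (simp add: A_def)
        thus ?thesis using False by (simp add: ennreal_leI)
      qed simp
    qed
    also have "\<dots> = (\<integral>\<^sup>+t. ennreal M \<partial>circ) + (\<integral>\<^sup>+t. indicator A t * ennreal ((cmod (F (\<psi> t)))\<^sup>2) \<partial>circ)"
    proof (rule nn_integral_add)
      have "(\<lambda>t. (cmod (F (\<psi> t)))\<^sup>2) \<in> borel_measurable borel" by (rule borel_measurable_continuous_onI[OF c])
      thus "(\<lambda>t. indicator A t * ennreal ((cmod (F (\<psi> t)))\<^sup>2)) \<in> borel_measurable circ"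
        unfolding measurable_cong_sets[OF sets_circ refl] using A by measurable
    qed simp
    also have "(\<integral>\<^sup>+t. ennreal M \<partial>circ) = ennreal M" by (simp add: emeasure_circ_UNIV)
    also have "ennreal M + (\<integral>\<^sup>+t. indicator A t * ennreal ((cmod (F (\<psi> t)))\<^sup>2) \<partial>circ)
        \<le> ennreal M + ennreal (carleson_const n * \<epsilon> * (H2_norm f)\<^sup>2)"
      unfolding A_def F_def
      by (intro add_left_mono carleson_tail[OF n f cb less_imp_le[OF \<epsilon>] K(1) J])
    also have "\<dots> = ennreal (M + \<eta> * (H2_norm f)\<^sup>2)"
      using M0 C \<eta> by (simp add: \<epsilon>_def ennreal_plus)
    finally show ?thesis using M0 \<eta> by (subst (asm) ennreal_le_iff) auto
  qed
  thus ?thesis using that by blast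
qed

section \<open>Normal families in H^2\<close>

lemma H2_bounded_locally:
  assumes "in_H2 f" "H2_norm f \<le> B" "cmod z \<le> q" "q < 1"
  shows "cmod (f z) \<le> sqrt (B\<^sup>2 / (1 - q\<^sup>2))"
proof (rule real_le_rsqrt)
  have q: "0 \<le> q" using assms(3) norm_ge_zero[of z] by linarith
  have "q\<^sup>2 < 1" using q assms(4) by (simp add: power_less_one_iff)
  have B: "0 \<le> H2_norm f" using assms(1) by (rule H2_norm_nonneg)
  have "(cmod (f z))\<^sup>2 \<le> (H2_norm f)\<^sup>2 / (1 - (cmod z)\<^sup>2)"
    by (rule H2_pointwise_bound) (use assms in auto)
  also have "\<dots> \<le> B\<^sup>2 / (1 - q\<^sup>2)"
    using \<open>q\<^sup>2 < 1\<close> assms B by (intro frac_le power_mono diff_left_mono) auto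
  finally show "(cmod (f z))\<^sup>2 \<le> B\<^sup>2 / (1 - q\<^sup>2)" .
qed

text \<open>The pointwise bound makes the sequence locally bounded, as Montel's theorem requires.
  The limit stays in H^2 because every Taylor coefficient converges, so each finite sum of squares
  inherits the bound B^2.\<close>

lemma H2_locally_uniform_subsequence:
  assumes fs: "\<And>k::nat. in_H2 (fs k)" "\<And>k. H2_norm (fs k) \<le> B"
  obtains f r where "strict_mono (r :: nat \<Rightarrow> nat)" "in_H2 f" "(H2_norm f)\<^sup>2 \<le> B\<^sup>2"
    "\<And>q. q < 1 \<Longrightarrow> uniform_limit (cball 0 q) (\<lambda>k. fs (r k)) f sequentially"
proof -
  have bdd: "\<exists>M. \<forall>h\<in>range fs. \<forall>z\<in>K. cmod (h z) \<le> M" if K: "compact K" "K \<subseteq> ball 0 1" for K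
  proof (cases "K = {}")
    case False
    obtain z0 where z0: "z0 \<in> K" "\<And>z. z \<in> K \<Longrightarrow> cmod z \<le> cmod z0"
      using continuous_attains_sup[OF K(1) False, of cmod] by (auto intro: continuous_intros)
    have "cmod z0 < 1" using z0 K by auto
    thus ?thesis using H2_bounded_locally[OF fs(1) fs(2) z0(2)] by blast
  qed simp
  obtain f r where f: "f holomorphic_on ball 0 1" "strict_mono (r :: nat \<Rightarrow> nat)"
    "\<And>K. compact K \<Longrightarrow> K \<subseteq> ball 0 1 \<Longrightarrow> uniform_limit K (fs \<circ> r) f sequentially"
  proof (rule Montel[of "ball 0 1" "range fs" fs])
    show "h holomorphic_on ball 0 1" if "h \<in> range fs" for h
      using that fs(1) in_H2_holomorphic by auto
  qed (use bdd in auto)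
  have ul: "uniform_limit (cball 0 q) (\<lambda>k. fs (r k)) f sequentially" if "q < 1" for q
  proof -
    have "cball 0 q \<subseteq> ball (0::complex) 1" using that by auto
    from f(3)[OF compact_cball this] show ?thesis by (simp add: o_def)
  qed
  have coeff: "(\<lambda>k. taylor_coeff (fs (r k)) j) \<longlonglongrightarrow> taylor_coeff f j" for j
    unfolding taylor_coeff_def
  proof (intro tendsto_intros)
    show "(\<lambda>k. (deriv ^^ j) (fs (r k)) 0) \<longlonglongrightarrow> (deriv ^^ j) f 0"
    proof (rule higher_deriv_complex_uniform_limit)
      show "uniform_limit (ball 0 (1/2)) (\<lambda>k. fs (r k)) f sequentially"
        by (rule uniform_limit_on_subset[OF ul[of "1/2"]]) auto
      show "\<forall>\<^sub>F k in sequentially. fs (r k) holomorphic_on ball 0 (1/2)"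
        by (intro always_eventually allI holomorphic_on_subset[OF in_H2_holomorphic[OF fs(1)]]) auto
    qed auto
  qed simp
  have le: "(\<Sum>j<N. (cmod (taylor_coeff f j))\<^sup>2) \<le> B\<^sup>2" for N
  proof (rule LIMSEQ_le_const2)
    show "(\<lambda>k. \<Sum>j<N. (cmod (taylor_coeff (fs (r k)) j))\<^sup>2) \<longlonglongrightarrow> (\<Sum>j<N. (cmod (taylor_coeff f j))\<^sup>2)"
      by (intro tendsto_intros coeff)
    have "(\<Sum>j<N. (cmod (taylor_coeff (fs k) j))\<^sup>2) \<le> B\<^sup>2" for k
    proof -
      have "(\<Sum>j<N. (cmod (taylor_coeff (fs k) j))\<^sup>2) \<le> (\<Sum>j. (cmod (taylor_coeff (fs k) j))\<^sup>2)"
        by (rule sum_le_suminf) (use fs(1)[of k] in \<open>auto simp: in_H2_iff\<close>)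
      also have "\<dots> = (H2_norm (fs k))\<^sup>2" by (rule H2_norm_sq[OF fs(1), symmetric])
      also have "\<dots> \<le> B\<^sup>2" by (intro power_mono fs H2_norm_nonneg)
      finally show ?thesis .
    qed
    thus "\<exists>N0. \<forall>k\<ge>N0. (\<Sum>j<N. (cmod (taylor_coeff (fs (r k)) j))\<^sup>2) \<le> B\<^sup>2" by blast
  qed
  have s: "summable (\<lambda>k. (cmod (taylor_coeff f k))\<^sup>2)"
    by (rule bounded_imp_summable[where B = "B\<^sup>2"])
       (use le[of "Suc n" for n] in \<open>auto simp: lessThan_Suc_atMost\<close>)
  have H: "in_H2 f" using f(1) s by (simp add: in_H2_iff)
  moreover have "(H2_norm f)\<^sup>2 \<le> B\<^sup>2"
    unfolding H2_norm_sq[OF H] by (rule suminf_le_const[OF s le])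
  ultimately show ?thesis using that f(2) ul by blast
qed

lemma uniform_limit_higher_deriv_diff:
  assumes fs: "\<And>k::nat. fs k holomorphic_on ball 0 1" and f: "f holomorphic_on ball 0 1"
    and ul: "\<And>q. q < 1 \<Longrightarrow> uniform_limit (cball 0 q) fs f sequentially" and q: "q < 1" and M: "M > 0"
  shows "eventually (\<lambda>k. \<forall>\<zeta>. cmod \<zeta> \<le> q \<longrightarrow> cmod ((deriv ^^ n) (\<lambda>z. fs k z - f z) \<zeta>) \<le> M) sequentially"
proof -
  define d where "d = (1 - q) / 2"
  have d: "0 < d" "q + d < 1" using q by (auto simp: d_def field_simps)
  \<comment> \<open>Chosen so that Cauchy's estimate on circles of radius d returns exactly
    M.\<close>
  define e where "e = M * d ^ n / fact n"
  have e: "e > 0" using M d by (simp add: e_def)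
  have "\<forall>\<^sub>F k in sequentially. \<forall>z\<in>cball 0 (q + d). dist (fs k z) (f z) < e"
    using ul[OF d(2)] e unfolding uniform_limit_iff by blast
  thus ?thesis
  proof eventually_elim
    case (elim k)
    show ?case
    proof (intro allI impI)
      fix \<zeta> :: complex assume \<zeta>: "cmod \<zeta> \<le> q"
      have sub: "cball \<zeta> d \<subseteq> cball 0 (q + d)"
      proof
        fix x assume "x \<in> cball \<zeta> d"
        hence "cmod (x - \<zeta>) \<le> d" by (simp add: dist_norm norm_minus_commute)
        moreover have "cmod x \<le> cmod \<zeta> + cmod (x - \<zeta>)" by (rule norm_triangle_sub)
        ultimately show "x \<in> cball 0 (q + d)" using \<zeta> by simp
      qed
      have sub1: "cball \<zeta> d \<subseteq> ball 0 1" using sub d by (auto simp: subset_iff)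
      have hol: "(\<lambda>z. fs k z - f z) holomorphic_on ball 0 1" by (intro holomorphic_intros fs f)
      have "cmod ((deriv ^^ n) (\<lambda>z. fs k z - f z) \<zeta>) \<le> fact n * e / d ^ n"
      proof (rule Cauchy_inequality)
        show "(\<lambda>z. fs k z - f z) holomorphic_on ball \<zeta> d"
          using sub1 by (intro holomorphic_on_subset[OF hol]) auto
        show "continuous_on (cball \<zeta> d) (\<lambda>z. fs k z - f z)"
          using sub1 by (intro holomorphic_on_imp_continuous_on holomorphic_on_subset[OF hol]) auto
        show "cmod (fs k z - f z) \<le> e" if "cmod (\<zeta> - z) = d" for z
        proof -
          have "z \<in> cball 0 (q + d)" using that by (intro subsetD[OF sub]) (simp add: dist_norm)
          thus ?thesis using elim by (auto simp: dist_norm intro: less_imp_le)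
        qed
      qed (rule d(1))
      also have "\<dots> = M" using d by (simp add: e_def)
      finally show "cmod ((deriv ^^ n) (\<lambda>z. fs k z - f z) \<zeta>) \<le> M" .
    qed
  qed
qed

text \<open>The image of the locally uniform limit f serves as g. The differences \<open>e k\<close>
  are bounded in norm and their n-th derivatives tend to 0 uniformly on smaller disks, which
  controls the two terms of \<open>D_op_hardy_mean_bound\<close>.\<close>

theorem nevanlinna_imp_compact:
  assumes \<phi>: "\<phi> holomorphic_on ball 0 1" "\<phi> ` ball 0 1 \<subseteq> ball 0 1" and n: "n \<ge> 1"
    and nev: "nev_cond \<phi> n"
  shows "compact_on_H2 (D_op \<phi> n)"
proof -
  have T_hol: "D_op \<phi> n f holomorphic_on ball 0 1" if "f holomorphic_on ball 0 1" for f
  proof -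
    have "(deriv ^^ n) f holomorphic_on ball 0 1" by (intro holomorphic_higher_deriv that) auto
    from holomorphic_on_compose_gen[OF \<phi>(1) this \<phi>(2)] show ?thesis by (simp add: D_op_def o_def)
  qed
  have T_H2: "in_H2 (D_op \<phi> n f)" if f: "in_H2 f" for f
  proof -
    obtain J :: nat where J: "\<And>f r M. in_H2 f \<Longrightarrow> 0 < r \<Longrightarrow> r < 1 \<Longrightarrow>
       (\<And>\<zeta>. cmod \<zeta> \<le> 1 - (1/2)^J \<Longrightarrow> (cmod ((deriv ^^ n) f \<zeta>))\<^sup>2 \<le> M) \<Longrightarrow>
       hardy_mean (D_op \<phi> n f) r \<le> M + 1 * (H2_norm f)\<^sup>2"
      using D_op_hardy_mean_bound[OF \<phi> n nev zero_less_one] by blast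
    have "(deriv ^^ n) f holomorphic_on ball 0 1"
      by (intro holomorphic_higher_deriv in_H2_holomorphic f) auto
    moreover have "cball 0 (1 - (1/2)^J) \<subseteq> ball (0::complex) 1"
      by (auto simp: cball_subset_ball_iff)
    ultimately have "continuous_on (cball 0 (1 - (1/2)^J)) ((deriv ^^ n) f)"
      by (intro holomorphic_on_imp_continuous_on) (rule holomorphic_on_subset)
    hence "bounded ((deriv ^^ n) f ` cball 0 (1 - (1/2)^J))"
      by (intro compact_imp_bounded compact_continuous_image) auto
    then obtain b where "\<forall>\<zeta>\<in>cball 0 (1 - (1/2)^J). cmod ((deriv ^^ n) f \<zeta>) \<le> b"
      by (auto simp: bounded_iff)
    hence b: "cmod ((deriv ^^ n) f \<zeta>) \<le> b" if "cmod \<zeta> \<le> 1 - (1/2)^J" for \<zeta>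
      using that by (simp add: mem_cball)
    have "(cmod ((deriv ^^ n) f \<zeta>))\<^sup>2 \<le> b\<^sup>2" if "cmod \<zeta> \<le> 1 - (1/2)^J" for \<zeta>
      using b[OF that] by (intro power_mono) auto
    from J[OF f _ _ this] show ?thesis
      by (intro in_H2_bounded(1)[OF T_hol[OF in_H2_holomorphic[OF f]]]) blast
  qed
  have "\<exists>r g. strict_mono r \<and> in_H2 g \<and> (\<lambda>k. H2_norm (\<lambda>z. D_op \<phi> n (fs (r k)) z - g z)) \<longlonglongrightarrow> 0"
    if fs: "\<And>k. in_H2 (fs k)" and bd: "bounded (range (\<lambda>k. H2_norm (fs k)))" for fs :: "nat \<Rightarrow> complex \<Rightarrow> complex"
  proof -
    obtain B0 where B0: "\<And>k. \<bar>H2_norm (fs k)\<bar> \<le> B0" using bd by (auto simp: bounded_iff)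
    \<comment> \<open>The summand 1 makes B positive; B^2 is a divisor below.\<close>
    define B where "B = B0 + 1"
    have B: "H2_norm (fs k) \<le> B" "B > 0" for k
      using B0[of k] unfolding B_def by linarith+
    obtain f r where f: "strict_mono (r :: nat \<Rightarrow> nat)" "in_H2 f" "(H2_norm f)\<^sup>2 \<le> B\<^sup>2"
      "\<And>q. q < 1 \<Longrightarrow> uniform_limit (cball 0 q) (\<lambda>k. fs (r k)) f sequentially"
      by (rule H2_locally_uniform_subsequence[OF fs B(1)], rule that)
    define e where "e k = (\<lambda>z. fs (r k) z - f z)" for k
    have e: "in_H2 (e k)" "(H2_norm (e k))\<^sup>2 \<le> 4 * B\<^sup>2" for k
    proof -
      show "in_H2 (e k)" unfolding e_def by (intro H2_diff fs f)
      have "(H2_norm (e k))\<^sup>2 \<le> 2 * (H2_norm (fs (r k)))\<^sup>2 + 2 * (H2_norm f)\<^sup>2"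
        unfolding e_def by (intro H2_diff fs f)
      moreover have "(H2_norm (fs (r k)))\<^sup>2 \<le> B\<^sup>2" by (intro power_mono B H2_norm_nonneg fs)
      ultimately show "(H2_norm (e k))\<^sup>2 \<le> 4 * B\<^sup>2" using f(3) by linarith
    qed
    have diff: "H2_norm (\<lambda>z. D_op \<phi> n (fs (r k)) z - D_op \<phi> n f z) = H2_norm (D_op \<phi> n (e k))" for k
    proof (rule H2_norm_cong)
      fix z assume "cmod z < 1"
      hence "\<phi> z \<in> ball 0 1" using \<phi>(2) by (intro subsetD[OF \<phi>(2)]) simp
      hence "(deriv ^^ n) (\<lambda>w. fs (r k) w - f w) (\<phi> z) = (deriv ^^ n) (fs (r k)) (\<phi> z) - (deriv ^^ n) f (\<phi> z)"
        by (intro higher_deriv_diff[of _ "ball 0 1"] in_H2_holomorphic fs f) auto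
      thus "D_op \<phi> n (fs (r k)) z - D_op \<phi> n f z = D_op \<phi> n (e k) z"
        by (simp add: D_op_def e_def)
    qed
    have "(\<lambda>k. H2_norm (D_op \<phi> n (e k))) \<longlonglongrightarrow> 0"
    proof (rule LIMSEQ_I)
      fix c :: real assume c: "c > 0"
      \<comment> \<open>Then \<eta> * 4 B^2 = c^2/4, and with (c/2)^2 from the compact disk the
        total is c^2/2 < c^2.\<close>
      define \<eta> where "\<eta> = c\<^sup>2 / (16 * B\<^sup>2)"
      have \<eta>: "\<eta> > 0" using c B(2) by (simp add: \<eta>_def)
      obtain J :: nat where J: "\<And>f r M. in_H2 f \<Longrightarrow> 0 < r \<Longrightarrow> r < 1 \<Longrightarrow>
         (\<And>\<zeta>. cmod \<zeta> \<le> 1 - (1/2)^J \<Longrightarrow> (cmod ((deriv ^^ n) f \<zeta>))\<^sup>2 \<le> M) \<Longrightarrow>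
         hardy_mean (D_op \<phi> n f) r \<le> M + \<eta> * (H2_norm f)\<^sup>2"
        using D_op_hardy_mean_bound[OF \<phi> n nev \<eta>] by blast
      have "eventually (\<lambda>k. \<forall>\<zeta>. cmod \<zeta> \<le> 1 - (1/2)^J \<longrightarrow> cmod ((deriv ^^ n) (\<lambda>z. fs (r k) z - f z) \<zeta>) \<le> c / 2) sequentially"
        by (rule uniform_limit_higher_deriv_diff[OF _ _ f(4)])
           (use c in \<open>auto intro: in_H2_holomorphic fs f\<close>)
      hence "eventually (\<lambda>k. norm (H2_norm (D_op \<phi> n (e k)) - 0) < c) sequentially"
      proof eventually_elim
        case (elim k)
        have "(cmod ((deriv ^^ n) (e k) \<zeta>))\<^sup>2 \<le> (c/2)\<^sup>2" if "cmod \<zeta> \<le> 1 - (1/2)^J" for \<zeta>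
          using elim that unfolding e_def by (intro power_mono) auto
        hence "hardy_mean (D_op \<phi> n (e k)) \<rho> \<le> (c/2)\<^sup>2 + \<eta> * (H2_norm (e k))\<^sup>2" if "0 < \<rho>" "\<rho> < 1" for \<rho>
          using J[OF e(1) that] by blast
        hence "(H2_norm (D_op \<phi> n (e k)))\<^sup>2 \<le> (c/2)\<^sup>2 + \<eta> * (H2_norm (e k))\<^sup>2"
          by (intro in_H2_bounded(2) T_hol in_H2_holomorphic e)
        also have "\<dots> \<le> (c/2)\<^sup>2 + \<eta> * (4 * B\<^sup>2)"
          using \<eta> e(2) by (intro add_left_mono mult_left_mono) auto
        also have "\<dots> = c\<^sup>2 / 2" using B(2) by (simp add: \<eta>_def power_divide)
        also have "\<dots> < c\<^sup>2" using c by simp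
        finally have "H2_norm (D_op \<phi> n (e k)) < c" by (rule power2_less_imp_less) (use c in simp)
        thus ?case using H2_norm_nonneg[OF T_H2[OF e(1)]] by simp
      qed
      thus "\<exists>N. \<forall>k\<ge>N. norm (H2_norm (D_op \<phi> n (e k)) - 0) < c"
        by (simp add: eventually_sequentially)
    qed
    thus ?thesis using f(1) T_H2[OF f(2)] by (intro exI[of _ r] exI[of _ "D_op \<phi> n f"]) (simp add: diff)
  qed
  thus ?thesis unfolding compact_on_H2_def using T_H2 by blast
qed

theorem theorem2p2:
  fixes \<phi> :: "complex \<Rightarrow> complex" and n :: nat
  assumes "\<phi> holomorphic_on ball 0 1" and "\<phi> ` ball 0 1 \<subseteq> ball 0 1" and "n \<ge> 1"
  shows "compact_on_H2 (D_op \<phi> n) \<longleftrightarrow>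
    (\<forall>\<epsilon>>0. \<exists>\<delta><1. \<forall>w. \<delta> < cmod w \<and> cmod w < 1 \<longrightarrow>
        nevanlinna \<phi> w \<le> ennreal (\<epsilon> * (ln (1 / cmod w)) ^ (2 * n + 1)))"
  using compact_imp_nevanlinna[OF assms(1,2)] nevanlinna_imp_compact[OF assms]
  unfolding nev_cond_def by blast

end
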